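(* Let $\mathcal G=\mathcal G_\Delta$ be a plabic graph for $\operatorname{Gr}(2,\mathbb C^n)$, corresponding to a triangulation $\Delta$ of the disk $D_n$, and let $T=T_\Delta$ be the corresponding labelled trivalent tree. Then the associated initial ideals are equal: $$\operatorname{in}_{\mathbf w_{\mathcal G}}(I_{2,n})=\operatorname{in}_{\mathbf w_T}(I_{2,n}).$$
   Context: $I_{2,n}\subset\mathbb C[p_{ij}\mid 1\le i<j\le n]$ is the Plücker ideal, generated by $p_{ij}p_{kl}-p_{ik}p_{jl}+p_{il}p_{jk}$ for $i<j<k<l$. For $\mathbf w\in\mathbb R^{\binom n2}$, $\operatorname{in}_{\mathbf w}(f)$ is the sum of the terms of $f$ of minimal $\mathbf w$-weight and $\operatorname{in}_{\mathbf w}(I)=\langle\operatorname{in}_{\mathbf w}(f)\mid f\in I\rangle$. Let $n\ge4$ and $D_n$ be a disk with $n$ marked boundary points labelled $1,\dots,n$ counterclockwise. A triangulation $\Delta$ is a maximal collection of pairwise non-crossing arcs connecting marked points; it consists of the $n$ boundary arcs $(i,i+1)$ (mod $n$) and $n-3$ internal arcs. Tree. $T_\Delta$ has one internal vertex $v_t$ for every triangle $t$; $v_t,v_{t'}$ are joined by an edge if $t,t'$ share an arc; and for each boundary arc $(i,i+1)$ (mod $n$) there is a leaf labelled $i+1$ attached to $v_t$, where $t$ is the triangle containing this arc. An edge is internal if it joins two internal vertices. The weight vector $\mathbf w_{T}$ has entries $(\mathbf w_T)_{ij}=-\#\{\text{internal edges on the path from leaf }i\text{ to leaf }j\}$. Plabic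 graph (Kodama-Williams). In every triangle of $\Delta$ put a black vertex joined to the three vertices of the triangle; colour a marked point white if it is an endpoint of an internal arc, and black otherwise; erase all arcs of $\Delta$; contract edges between vertices of the same colour; finally attach to each (former) marked point $m$ an edge to a new boundary vertex $m$ on the boundary of a surrounding disk, without crossings. The result is $\mathcal G_\Delta$; all plabic graphs for $\operatorname{Gr}(2,\mathbb C^n)$ (reduced, trip permutation $\pi_{2,n}=(n-1,n,1,\dots,n-2)$) arise this way up to contracting/splitting vertices of equal colour and inserting/removing degree-2 vertices. Plabic weight. Fix a perfect orientation of $\mathcal G$ (each internal white vertex has exactly one incoming edge, each internal black vertex exactly one outgoing edge) with source set $\{1,2\}$. For $J=\{i,j\}$, a $J$-flow is a collection of self-avoiding, vertex-disjoint directed paths with sources $\{1,2\}\setminus J$ and sinks $J\setminus\{1,2\}$. The degree of a path is the number of internal faces (faces not meeting the boundary of the disk) to its left; the degree of a flow is the sum of the degrees of its paths. $(\mathbf w_{\mathcal G})_{ij}$ is the minimal degree of a $\{i,j\}$-flow. *)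

theory Defs
  imports
    Complex_Main
    "HOL-Library.Poly_Mapping"
    "HOL-Algebra.Ideal"
    "HOL-Combinatorics.Orbits"
begin

section \<open>Initial ideals in the Pluecker algebra\<close>

type_synonym pmonom = "(nat \<times> nat) \<Rightarrow>\<^sub>0 nat"
type_synonym ppoly = "pmonom \<Rightarrow>\<^sub>0 complex"

definition pairs :: "nat \<Rightarrow> (nat \<times> nat) set" where
  "pairs n = {(i, j). 1 \<le> i \<and> i < j \<and> j \<le> n}"

text \<open>The type \<open>ppoly\<close> has a variable for every pair of naturals; the ring
  \<open>\<complex>[p\<^sub>i\<^sub>j | 1 \<le> i < j \<le> n]\<close> is the subring of polynomials in the variables from \<open>pairs n\<close>.\<close>

definition ppoly_ring :: "nat \<Rightarrow> ppoly ring" where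
  "ppoly_ring n =
    \<lparr>carrier = {f. \<forall>m \<in> Poly_Mapping.keys f. Poly_Mapping.keys m \<subseteq> pairs n},
     monoid.mult = (*), one = 1, zero = 0, add = (+)\<rparr>"

definition pvar :: "nat \<Rightarrow> nat \<Rightarrow> ppoly" where
  "pvar i j = Poly_Mapping.single (Poly_Mapping.single (i, j) 1) 1"

definition plucker_ideal :: "nat \<Rightarrow> ppoly set" where
  "plucker_ideal n = Idl\<^bsub>ppoly_ring n\<^esub>
    {pvar i j * pvar k l - pvar i k * pvar j l + pvar i l * pvar j k | i j k l.
      1 \<le> i \<and> i < j \<and> j < k \<and> k < l \<and> l \<le> n}"

definition monom_weight :: "(nat \<times> nat \<Rightarrow> real) \<Rightarrow> pmonom \<Rightarrow> real" where
  "monom_weight w m = (\<Sum>v \<in> Poly_Mapping.keys m. w v * real (Poly_Mapping.lookup m v))"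

definition initial_form :: "(nat \<times> nat \<Rightarrow> real) \<Rightarrow> ppoly \<Rightarrow> ppoly" where
  "initial_form w f =
    (\<Sum>m \<in> {m \<in> Poly_Mapping.keys f.
             \<forall>m' \<in> Poly_Mapping.keys f. monom_weight w m \<le> monom_weight w m'}.
       Poly_Mapping.single m (Poly_Mapping.lookup f m))"

definition initial_ideal :: "nat \<Rightarrow> (nat \<times> nat \<Rightarrow> real) \<Rightarrow> ppoly set \<Rightarrow> ppoly set" where
  "initial_ideal n w I = Idl\<^bsub>ppoly_ring n\<^esub> (initial_form w ` I)"


section \<open>Triangulations of a disk with marked points \<open>1, \<dots>, n\<close>\<close>

text \<open>Marked points are numbered counterclockwise; \<open>csucc n\<close> and \<open>cpred n\<close> are the
  counterclockwise and the clockwise neighbour. An arc is the set of its two end points.\<close>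

definition csucc :: "nat \<Rightarrow> nat \<Rightarrow> nat" where
  "csucc n i = (if i = n then 1 else i + 1)"

definition cpred :: "nat \<Rightarrow> nat \<Rightarrow> nat" where
  "cpred n i = (if i = 1 then n else i - 1)"

definition arcs :: "nat \<Rightarrow> nat set set" where
  "arcs n = {{i, j} | i j. 1 \<le> i \<and> i < j \<and> j \<le> n}"

definition boundary_arcs :: "nat \<Rightarrow> nat set set" where
  "boundary_arcs n = {{i, csucc n i} | i. 1 \<le> i \<and> i \<le> n}"

definition crossing :: "nat set \<Rightarrow> nat set \<Rightarrow> bool" where
  "crossing a b \<longleftrightarrow> (\<exists>i j k l. i < j \<and> j < k \<and> k < l \<and>
     (a = {i, k} \<and> b = {j, l} \<or> a = {j, l} \<and> b = {i, k}))"

definition noncrossing :: "nat \<Rightarrow> nat set set \<Rightarrow> bool" where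
  "noncrossing n A \<longleftrightarrow> A \<subseteq> arcs n \<and> (\<forall>a \<in> A. \<forall>b \<in> A. \<not> crossing a b)"

definition triangulation :: "nat \<Rightarrow> nat set set \<Rightarrow> bool" where
  "triangulation n \<Delta> \<longleftrightarrow>
     noncrossing n \<Delta> \<and> (\<forall>A. noncrossing n A \<and> \<Delta> \<subseteq> A \<longrightarrow> A = \<Delta>)"

text \<open>A triangle is the set of its corners. Three pairwise joined marked points bound a
  triangle without further arcs inside, since all marked points lie on the boundary of the disk.\<close>

definition triangles :: "nat set set \<Rightarrow> nat set set" where
  "triangles \<Delta> = {{i, j, k} | i j k. i < j \<and> j < k \<and> {i, j} \<in> \<Delta> \<and> {j, k} \<in> \<Delta> \<and> {i, k} \<in> \<Delta>}"


section \<open>The trivalent tree and its weight vector\<close>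

datatype tree_vertex = Node "nat set" | Leaf nat

definition tree_edges :: "nat \<Rightarrow> nat set set \<Rightarrow> tree_vertex set set" where
  "tree_edges n \<Delta> =
     {{Node t, Node t'} | t t'. t \<in> triangles \<Delta> \<and> t' \<in> triangles \<Delta> \<and> t \<noteq> t' \<and>
        (\<exists>a \<in> \<Delta>. a \<subseteq> t \<and> a \<subseteq> t')} \<union>
     {{Node t, Leaf (csucc n i)} | t i. t \<in> triangles \<Delta> \<and> 1 \<le> i \<and> i \<le> n \<and> {i, csucc n i} \<subseteq> t}"

definition tree_path ::
  "nat \<Rightarrow> nat set set \<Rightarrow> tree_vertex \<Rightarrow> tree_vertex \<Rightarrow> tree_vertex list \<Rightarrow> bool" where
  "tree_path n \<Delta> u v p \<longleftrightarrow> p \<noteq> [] \<and> hd p = u \<and> last p = v \<and> distinct p \<and>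
     successively (\<lambda>x y. {x, y} \<in> tree_edges n \<Delta>) p"

fun internal_edge_count :: "tree_vertex list \<Rightarrow> nat" where
  "internal_edge_count (x # y # p) =
     (case (x, y) of (Node _, Node _) \<Rightarrow> 1 | _ \<Rightarrow> 0) + internal_edge_count (y # p)"
| "internal_edge_count _ = 0"

definition tree_weight :: "nat \<Rightarrow> nat set set \<Rightarrow> nat \<times> nat \<Rightarrow> real" where
  "tree_weight n \<Delta> = (\<lambda>(i, j).
     - real (internal_edge_count (THE p. tree_path n \<Delta> (Leaf i) (Leaf j) p)))"


section \<open>Bicoloured graphs embedded in a disk\<close>

datatype colour = Black | White

text \<open>A graph drawn in an oriented disk, up to isotopy, is given as a rotation system.
  A dart is an edge together with a direction; \<open>opp\<close> reverses it and \<open>org\<close> is the vertex it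
  leaves. The darts of the graph itself are \<open>darts\<close>. The segments of the boundary circle of
  the disk between consecutive boundary vertices are not edges of the graph; their darts are
  collected in \<open>rim\<close>. The map \<open>rot\<close> sends a dart (in \<open>darts \<union> rim\<close>) to the next one in
  clockwise order around its origin. Boundary vertices, and only these, have colour \<open>None\<close>;
  \<open>bdry m\<close> is the boundary vertex labelled \<open>m\<close>.\<close>

record ('d, 'v) disk_graph =
  darts :: "'d set"
  rim :: "'d set"
  opp :: "'d \<Rightarrow> 'd"
  org :: "'d \<Rightarrow> 'v"
  rot :: "'d \<Rightarrow> 'd"
  col :: "'v \<Rightarrow> colour option"
  bdry :: "nat \<Rightarrow> 'v"

definition dest :: "('d, 'v) disk_graph \<Rightarrow> 'd \<Rightarrow> 'v" where
  "dest G d = org G (opp G d)"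

subsection \<open>Faces\<close>

text \<open>A walk that keeps a face on its left arrives along \<open>d\<close> and leaves along the first dart
  clockwise after \<open>opp G d\<close>. So the orbit of \<open>d\<close> under this step is the face to the left
  of \<open>d\<close>, and the face to the right of \<open>d\<close> is \<open>left_face G (opp G d)\<close>.\<close>

definition left_face :: "('d, 'v) disk_graph \<Rightarrow> 'd \<Rightarrow> 'd set" where
  "left_face G d = orbit (\<lambda>e. rot G (opp G e)) d"

definition internal_faces :: "('d, 'v) disk_graph \<Rightarrow> 'd set set" where
  "internal_faces G =
     {F \<in> left_face G ` (darts G \<union> rim G). \<forall>d \<in> F. col G (org G d) \<noteq> None}"

subsection \<open>Contraction of edges between vertices of the same colour\<close>

definition mono_darts :: "('d, 'v) disk_graph \<Rightarrow> 'd set" where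
  "mono_darts G =
     {d \<in> darts G. col G (org G d) \<noteq> None \<and> col G (org G d) = col G (dest G d)}"

definition merge_class :: "('d, 'v) disk_graph \<Rightarrow> 'v \<Rightarrow> 'v set" where
  "merge_class G v = {u. (v, u) \<in> {(org G d, dest G d) | d. d \<in> mono_darts G}\<^sup>*}"

text \<open>The vertices of the contracted graph are the classes of merged vertices. When the
  clockwise walk around a merged vertex meets a contracted dart \<open>e\<close>, it continues at the
  other end of that edge, with the clockwise successor of \<open>opp G e\<close>.\<close>

definition contract_mono :: "('d, 'v) disk_graph \<Rightarrow> ('d, 'v set) disk_graph" where
  "contract_mono G =
    \<lparr>darts = darts G - mono_darts G,
     rim = rim G,
     opp = opp G,
     org = (\<lambda>d. merge_class G (org G d)),
     rot = (\<lambda>d. let f = (\<lambda>e. rot G (opp G e))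
                in (f ^^ (LEAST k. (f ^^ k) (rot G d) \<notin> mono_darts G)) (rot G d)),
     col = (\<lambda>V. col G (SOME v. v \<in> V)),
     bdry = (\<lambda>m. merge_class G (bdry G m))\<rparr>"

subsection \<open>Perfect orientations and flows\<close>

text \<open>An orientation is given by the set of those darts that point in the direction of their edge.\<close>

definition perfect_orientation :: "('d, 'v) disk_graph \<Rightarrow> 'd set \<Rightarrow> bool" where
  "perfect_orientation G ori \<longleftrightarrow>
     ori \<subseteq> darts G \<and>
     (\<forall>d \<in> darts G. d \<in> ori \<longleftrightarrow> opp G d \<notin> ori) \<and>
     (\<forall>v \<in> org G ` darts G.
        (col G v = Some White \<longrightarrow> (\<exists>!d. d \<in> ori \<and> dest G d = v)) \<and>
        (col G v = Some Black \<longrightarrow> (\<exists>!d. d \<in> ori \<and> org G d = v)))"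

definition source_set :: "('d, 'v) disk_graph \<Rightarrow> 'd set \<Rightarrow> nat set" where
  "source_set G ori = {m. \<exists>d \<in> ori. org G d = bdry G m}"

definition walk_verts :: "('d, 'v) disk_graph \<Rightarrow> 'd list \<Rightarrow> 'v list" where
  "walk_verts G p = map (org G) p @ [dest G (last p)]"

definition directed_path :: "('d, 'v) disk_graph \<Rightarrow> 'd set \<Rightarrow> 'd list \<Rightarrow> bool" where
  "directed_path G ori p \<longleftrightarrow>
     p \<noteq> [] \<and> set p \<subseteq> ori \<and> successively (\<lambda>d e. dest G d = org G e) p \<and>
     distinct (walk_verts G p)"

definition is_flow :: "('d, 'v) disk_graph \<Rightarrow> 'd set \<Rightarrow> nat set \<Rightarrow> 'd list set \<Rightarrow> bool" where
  "is_flow G ori J P \<longleftrightarrow>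
     finite P \<and> (\<forall>p \<in> P. directed_path G ori p) \<and>
     pairwise (\<lambda>p q. set (walk_verts G p) \<inter> set (walk_verts G q) = {}) P \<and>
     (\<lambda>p. org G (hd p)) ` P = bdry G ` (source_set G ori - J) \<and>
     (\<lambda>p. dest G (last p)) ` P = bdry G ` (J - source_set G ori)"

text \<open>A path between two boundary vertices cuts the disk in two. The part on its left consists
  of the faces that can be reached from a face immediately to the left of the path by
  crossing edges of the graph that do not lie on the path, without leaving the disk.\<close>

definition off_path_adj :: "('d, 'v) disk_graph \<Rightarrow> 'd list \<Rightarrow> ('d set \<times> 'd set) set" where
  "off_path_adj G p =
     {(left_face G d, left_face G (opp G d)) | d. d \<in> darts G - (set p \<union> opp G ` set p)}"

definition faces_left_of :: "('d, 'v) disk_graph \<Rightarrow> 'd list \<Rightarrow> 'd set set" where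
  "faces_left_of G p = (off_path_adj G p)\<^sup>* `` (left_face G ` set p)"

definition path_degree :: "('d, 'v) disk_graph \<Rightarrow> 'd list \<Rightarrow> nat" where
  "path_degree G p = card (internal_faces G \<inter> faces_left_of G p)"

definition flow_degree :: "('d, 'v) disk_graph \<Rightarrow> 'd list set \<Rightarrow> nat" where
  "flow_degree G P = (\<Sum>p \<in> P. path_degree G p)"

definition plabic_weight :: "('d, 'v) disk_graph \<Rightarrow> 'd set \<Rightarrow> nat \<times> nat \<Rightarrow> real" where
  "plabic_weight G ori = (\<lambda>(i, j).
     real (LEAST k. \<exists>P. is_flow G ori {i, j} P \<and> k = flow_degree G P))"


section \<open>The plabic graph of a triangulation\<close>

datatype vertex = Centre "nat set" | Marked nat | Boundary nat

definition ccw :: "nat \<Rightarrow> nat \<Rightarrow> nat \<Rightarrow> bool" where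
  "ccw a b c \<longleftrightarrow> a < b \<and> b < c \<or> b < c \<and> c < a \<or> c < a \<and> a < b"

definition ccw_corner :: "nat set \<Rightarrow> nat \<Rightarrow> nat" where
  "ccw_corner t a = (THE b. \<exists>c. t = {a, b, c} \<and> ccw a b c)"

definition cw_corner :: "nat set \<Rightarrow> nat \<Rightarrow> nat" where
  "cw_corner t a = (THE b. \<exists>c. t = {a, b, c} \<and> ccw a c b)"

text \<open>Clockwise order around the vertices before contraction. Around the marked point \<open>m\<close>,
  it starts with the edge to the boundary vertex \<open>m\<close>, enters the disk in the triangle at the
  arc from \<open>m\<close> to \<open>cpred n m\<close>, runs through the triangles at \<open>m\<close> by crossing one arc after
  the other, and ends in the triangle at the arc from \<open>m\<close> to \<open>csucc n m\<close>. Around the boundary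
  vertex \<open>m\<close>, it is: rim segment to \<open>cpred n m\<close>, edge to the marked point \<open>m\<close>, rim segment
  to \<open>csucc n m\<close>.\<close>

fun triangulation_rot :: "nat \<Rightarrow> nat set set \<Rightarrow> vertex \<times> vertex \<Rightarrow> vertex \<times> vertex" where
  "triangulation_rot n \<Delta> (Centre t, Marked m) = (Centre t, Marked (cw_corner t m))"
| "triangulation_rot n \<Delta> (Marked m, Centre t) =
     (let a = ccw_corner t m in
      (Marked m,
       if a = csucc n m then Boundary m
       else Centre (THE t'. t' \<in> triangles \<Delta> \<and> t' \<noteq> t \<and> {m, a} \<subseteq> t')))"
| "triangulation_rot n \<Delta> (Marked m, Boundary _) =
     (Marked m, Centre (THE t. t \<in> triangles \<Delta> \<and> {cpred n m, m} \<subseteq> t))"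
| "triangulation_rot n \<Delta> (Boundary m, Marked _) = (Boundary m, Boundary (csucc n m))"
| "triangulation_rot n \<Delta> (Boundary m, Boundary k) =
     (if k = csucc n m then (Boundary m, Boundary (cpred n m)) else (Boundary m, Marked m))"
| "triangulation_rot n \<Delta> d = d"

fun vertex_colour :: "nat \<Rightarrow> nat set set \<Rightarrow> vertex \<Rightarrow> colour option" where
  "vertex_colour n \<Delta> (Centre t) = Some Black"
| "vertex_colour n \<Delta> (Marked m) =
     Some (if \<exists>a \<in> \<Delta> - boundary_arcs n. m \<in> a then White else Black)"
| "vertex_colour n \<Delta> (Boundary m) = None"

text \<open>The boundary vertices are attached before the contraction, so that the rotation system
  records at which corner of a merged vertex the new edge sits. These edges are not affected
  by the contraction, because boundary vertices have no colour.\<close>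

definition uncontracted_graph :: "nat \<Rightarrow> nat set set \<Rightarrow> (vertex \<times> vertex, vertex) disk_graph" where
  "uncontracted_graph n \<Delta> =
    (let E = {(Centre t, Marked m) | t m. t \<in> triangles \<Delta> \<and> m \<in> t} \<union>
             {(Marked m, Boundary m) | m. 1 \<le> m \<and> m \<le> n};
         R = {(Boundary m, Boundary (csucc n m)) | m. 1 \<le> m \<and> m \<le> n}
     in \<lparr>darts = E \<union> E\<inverse>,
         rim = R \<union> R\<inverse>,
         opp = prod.swap,
         org = fst,
         rot = triangulation_rot n \<Delta>,
         col = vertex_colour n \<Delta>,
         bdry = Boundary\<rparr>)"

definition plabic_graph ::
  "nat \<Rightarrow> nat set set \<Rightarrow> (vertex \<times> vertex, vertex set) disk_graph" where
  "plabic_graph n \<Delta> = contract_mono (uncontracted_graph n \<Delta>)"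

end

(*
  Relabel the marked point 1 as n + 1, so that every arc is a pair a < b in {2..n+1} and every triangle of the
  triangulation has a unique middle corner c in {3..n}, its apex. Having the sources 1 and 2 forces a perfect
  orientation: every triangle points to its apex. A directed path therefore moves down the dual tree, and a
  triangle l < c < r that it visits has the arc (l, c) on its right and (c, r) on its left; triangles that it
  does not visit lie on one side. Internal faces correspond to diagonals, and so the minimal degree of an
  {i, j}-flow with i < j is the number of diagonals (a, b) with a >= j plus the number of those with a >= i or
  b >= j (minus the number of all diagonals if i = 2), and it is attained by a pair of greedy paths. On the other
  hand the tree weight counts, with a minus sign, the diagonals that separate the leaves i and j. Comparing the
  counts, the plabic weight is 1/2 times the tree weight plus a vector of the form c_i + c_j. The Pluecker ideal
  is homogeneous for the grading in which p_ij has degree c_i + c_j, so adding this vector does not change the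
  initial ideal, nor does scaling by 1/2.
*)
theory Submission
  imports Defs
begin

section \<open>Initial ideals and lineality\<close>

text \<open>The sources 1 and 2 are neighbours on the circle. Cutting between them makes the arc
  that joins them the longest chord, \<open>(2, n + 1)\<close>. All other chords nest below it, so
  comparisons of labels replace planar geometry, and inductions run over widths of chords.

  The left side of a path is defined by reachability, which shapes both bounds. For a lower bound,
  faces are reached by descending from a chord on the left through triangles that the path avoids.
  For an upper bound, a set of chords is exhibited that contains those on the immediate left of the
  path and is closed under crossing edges off the path.

  In a flow with two paths only the path from 2 is constrained by the other one: disjointness forces
  every diagonal \<open>(a, b)\<close> with b \<ge> j to its left. Let A_v be the set of diagonals
  with v \<le> a, and B_v of those with a < v \<le> b. The flow then has degree |A_i| + |A_j| + |B_i
  \<inter> B_j| at least, whereas the tree weight counts the symmetric difference of B_i and B_j.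
  The factor 1/2 comes from writing its size as |B_i| + |B_j| - 2 |B_i \<inter> B_j|.\<close>

definition part :: "('a \<Rightarrow> bool) \<Rightarrow> ('a \<Rightarrow>\<^sub>0 'b::comm_monoid_add) \<Rightarrow> ('a \<Rightarrow>\<^sub>0 'b)" where
  "part P f = (\<Sum>m \<in> {m \<in> Poly_Mapping.keys f. P m}. Poly_Mapping.single m (Poly_Mapping.lookup f m))"

lemma lookup_part: "Poly_Mapping.lookup (part P f) m = (if P m then Poly_Mapping.lookup f m else 0)"
  by (auto simp: part_def lookup_sum lookup_single when_def sum.delta in_keys_iff)

lemma keys_part: "Poly_Mapping.keys (part P f) = {m \<in> Poly_Mapping.keys f. P m}"
  by (auto simp: in_keys_iff lookup_part split: if_splits)

lemma part_add: "part P (f + g) = part P f + part P g"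
  by (rule poly_mapping_eqI) (simp add: lookup_part lookup_add)

lemma part_sum: "part P (sum f A) = (\<Sum>a\<in>A. part P (f a))"
  by (rule poly_mapping_eqI) (simp add: lookup_part lookup_sum)

lemma part_uminus: "part P (- f) = - part P (f :: 'a \<Rightarrow>\<^sub>0 'b::ab_group_add)"
  by (rule poly_mapping_eqI) (simp add: lookup_part)

lemma part_single: "part P (Poly_Mapping.single m c) = (if P m then Poly_Mapping.single m c else 0)"
  by (rule poly_mapping_eqI) (auto simp: lookup_part lookup_single when_def)

lemma part_True: "part (\<lambda>_. True) f = f"
  by (rule poly_mapping_eqI) (simp add: lookup_part)

lemma part_eq_self: "(\<And>m. m \<in> Poly_Mapping.keys f \<Longrightarrow> P m) \<Longrightarrow> part P f = f"
  by (rule poly_mapping_eqI) (auto simp: lookup_part in_keys_iff)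

lemma part_eq_0: "(\<And>m. m \<in> Poly_Mapping.keys f \<Longrightarrow> \<not> P m) \<Longrightarrow> part P f = 0"
  by (rule poly_mapping_eqI) (auto simp: lookup_part in_keys_iff)

lemma sum_singles: "(\<Sum>m\<in>Poly_Mapping.keys f. Poly_Mapping.single m (Poly_Mapping.lookup f m)) = f"
  using part_True[of f] by (simp add: part_def)

text \<open>Stated for one monomial because the predicate is then merely translated by its exponent;
  a general factor is handled as a sum of monomials.\<close>

lemma part_single_mult:
  fixes f :: "'a::cancel_comm_monoid_add \<Rightarrow>\<^sub>0 'b::comm_semiring_0"
  shows "part P (Poly_Mapping.single m c * f) = Poly_Mapping.single m c * part (\<lambda>k. P (m + k)) f"
proof -
  have "part P (Poly_Mapping.single m c * (\<Sum>k\<in>Poly_Mapping.keys f. Poly_Mapping.single k (Poly_Mapping.lookup f k)))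
      = Poly_Mapping.single m c * part (\<lambda>k. P (m + k)) (\<Sum>k\<in>Poly_Mapping.keys f. Poly_Mapping.single k (Poly_Mapping.lookup f k))"
    by (auto simp: sum_distrib_left part_sum mult_single part_single intro!: sum.cong)
  then show ?thesis by (simp only: sum_singles)
qed

lemma sum_graded_parts:
  assumes "finite A" "h ` Poly_Mapping.keys f \<subseteq> A"
  shows "(\<Sum>r\<in>A. part (\<lambda>m. h m = r) f) = f"
  using assms by (intro poly_mapping_eqI) (auto simp: lookup_sum lookup_part in_keys_iff image_subset_iff)

section \<open>Weights of monomials and the polynomial ring\<close>

lemma monom_weight_eq_sum:
  assumes "finite A" "Poly_Mapping.keys m \<subseteq> A"
  shows "monom_weight w m = (\<Sum>v\<in>A. w v * real (Poly_Mapping.lookup m v))"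
  unfolding monom_weight_def using assms
  by (intro sum.mono_neutral_left) (auto simp: in_keys_iff)

lemma monom_weight_add: "monom_weight w (m + m') = monom_weight w m + monom_weight w m'"
proof -
  let ?A = "Poly_Mapping.keys m \<union> Poly_Mapping.keys m'"
  have "Poly_Mapping.keys (m + m') \<subseteq> ?A" by (rule Poly_Mapping.keys_add)
  then show ?thesis
    by (simp add: monom_weight_eq_sum[of ?A] lookup_add sum.distrib algebra_simps)
qed

lemma monom_weight_single: "monom_weight w (Poly_Mapping.single v k) = w v * real k"
  by (cases "k = 0") (simp_all add: monom_weight_def)

lemma ppoly_ring_simps [simp]:
  "monoid.mult (ppoly_ring n) = (*)" "ring.add (ppoly_ring n) = (+)" "ring.zero (ppoly_ring n) = 0" "monoid.one (ppoly_ring n) = 1"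
  by (simp_all add: ppoly_ring_def)

lemma cring_ppoly_ring: "cring (ppoly_ring n)"
proof (rule cringI)
  have add: "f + g \<in> carrier (ppoly_ring n)" if "f \<in> carrier (ppoly_ring n)" "g \<in> carrier (ppoly_ring n)" for f g
    using that Poly_Mapping.keys_add[of f g] by (fastforce simp: ppoly_ring_def)
  have neg: "- f \<in> carrier (ppoly_ring n)" if "f \<in> carrier (ppoly_ring n)" for f
    using that by (auto simp: ppoly_ring_def)
  have mult: "f * g \<in> carrier (ppoly_ring n)" if "f \<in> carrier (ppoly_ring n)" "g \<in> carrier (ppoly_ring n)" for f g
  proof -
    have "Poly_Mapping.keys m \<subseteq> pairs n" if m: "m \<in> Poly_Mapping.keys (f * g)" for m
    proof -
      obtain a b where "m = a + b" "a \<in> Poly_Mapping.keys f" "b \<in> Poly_Mapping.keys g"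
        using subsetD[OF keys_mult m] by auto
      then show ?thesis
        using \<open>f \<in> _\<close> \<open>g \<in> _\<close> Poly_Mapping.keys_add[of a b] unfolding ppoly_ring_def by (simp, blast)
    qed
    then show ?thesis by (auto simp: ppoly_ring_def)
  qed
  have inv: "\<exists>g\<in>carrier (ppoly_ring n). g + f = 0" if "f \<in> carrier (ppoly_ring n)" for f
    using neg[OF that] by (intro bexI[of _ "- f"]) auto
  show "abelian_group (ppoly_ring n)"
  proof (rule abelian_groupI, goal_cases)
    case 1 then show ?case using add by simp
  next
    case 2 show ?case by (simp add: ppoly_ring_def)
  next
    case 6 then show ?case using inv by simp
  qed (simp_all add: add_ac)
  show "comm_monoid (ppoly_ring n)"
  proof (rule comm_monoidI, goal_cases)
    case 1 then show ?case using mult by simp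
  next
    case 2 show ?case by (simp add: ppoly_ring_def)
  qed (simp_all add: mult_ac)
qed (simp add: distrib_right)

lemma ideal_ppoly_sum:
  assumes "ideal I (ppoly_ring n)" "\<And>a. a \<in> A \<Longrightarrow> f a \<in> I"
  shows "sum f A \<in> I"
proof -
  interpret ideal I "ppoly_ring n" by fact
  show ?thesis
    using assms(2)
  proof (induction A rule: infinite_finite_induct)
    case (insert x F)
    have "f x \<oplus>\<^bsub>ppoly_ring n\<^esub> sum f F \<in> I" using insert by (intro additive_subgroup.a_closed[OF is_additive_subgroup]) auto
    with insert show ?case by simp
  qed (use additive_subgroup.zero_closed[OF is_additive_subgroup] in auto)
qed

lemma single_in_ppoly_ring: "Poly_Mapping.keys m \<subseteq> pairs n \<Longrightarrow> Poly_Mapping.single m c \<in> carrier (ppoly_ring n)"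
  by (simp add: ppoly_ring_def)

lemma pvar_in_ppoly_ring: "1 \<le> i \<Longrightarrow> i < j \<Longrightarrow> j \<le> n \<Longrightarrow> pvar i j \<in> carrier (ppoly_ring n)"
  by (auto simp: pvar_def pairs_def intro!: single_in_ppoly_ring)

section \<open>Homogeneity of the Pluecker ideal\<close>

abbreviation plucker_relations :: "nat \<Rightarrow> ppoly set" where
  "plucker_relations n \<equiv>
    {pvar i j * pvar k l - pvar i k * pvar j l + pvar i l * pvar j k | i j k l.
      1 \<le> i \<and> i < j \<and> j < k \<and> k < l \<and> l \<le> n}"

lemma plucker_relations_subset: "plucker_relations n \<subseteq> carrier (ppoly_ring n)"
proof -
  interpret R: cring "ppoly_ring n" by (rule cring_ppoly_ring)
  have minus: "f - g \<in> carrier (ppoly_ring n)" if "f \<in> carrier (ppoly_ring n)" "g \<in> carrier (ppoly_ring n)" for f g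
    using that Poly_Mapping.keys_diff[of f g] by (fastforce simp: ppoly_ring_def)
  have plus: "f + g \<in> carrier (ppoly_ring n)" if "f \<in> carrier (ppoly_ring n)" "g \<in> carrier (ppoly_ring n)" for f g
    using R.a_closed[OF that] by simp
  have times: "f * g \<in> carrier (ppoly_ring n)" if "f \<in> carrier (ppoly_ring n)" "g \<in> carrier (ppoly_ring n)" for f g
    using R.m_closed[OF that] by simp
  have "pvar i j * pvar k l - pvar i k * pvar j l + pvar i l * pvar j k \<in> carrier (ppoly_ring n)"
    if "1 \<le> i" "i < j" "j < k" "k < l" "l \<le> n" for i j k l
    using that by (intro plus minus times pvar_in_ppoly_ring) linarith+
  then show ?thesis by blast
qed

lemma ideal_plucker_ideal: "ideal (plucker_ideal n) (ppoly_ring n)"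
  unfolding plucker_ideal_def
  by (intro ring.genideal_ideal cring.axioms(1) cring_ppoly_ring plucker_relations_subset)

text \<open>The polynomials all of whose homogeneous components lie in the ideal form an ideal
  \<open>J\<close>. It contains the generators, because each of the three terms of a relation
  involves the indices i, j, k, l once and so has degree c i + c j + c k + c l. Degrees are real, as
  the vector that is added later may have half-integral entries.\<close>

lemma homogeneous_part_plucker_ideal:
  fixes c :: "nat \<Rightarrow> real"
  defines "deg \<equiv> monom_weight (\<lambda>(i, j). c i + c j)"
  assumes "f \<in> plucker_ideal n"
  shows "part (\<lambda>m. deg m = r) f \<in> plucker_ideal n"
proof -
  let ?R = "ppoly_ring n" and ?I = "plucker_ideal n"
  interpret R: cring ?R by (rule cring_ppoly_ring)
  interpret I: ideal ?I ?R by (rule ideal_plucker_ideal)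
  have I0: "0 \<in> ?I"
    using additive_subgroup.zero_closed[OF I.is_additive_subgroup] by simp
  have Iadd: "a + b \<in> ?I" if "a \<in> ?I" "b \<in> ?I" for a b
    using additive_subgroup.a_closed[OF I.is_additive_subgroup that] by simp
  define J where "J = {f \<in> carrier ?R. \<forall>r. part (\<lambda>m. deg m = r) f \<in> ?I}"
  have neg: "- f \<in> ?I" if "f \<in> ?I" for f
  proof -
    have "f + (\<ominus>\<^bsub>?R\<^esub> f) = 0" using R.r_neg[of f] I.Icarr[OF that] by simp
    then have "- f = \<ominus>\<^bsub>?R\<^esub> f" by (simp add: eq_neg_iff_add_eq_0 add.commute neg_eq_iff_add_eq_0)
    then show ?thesis using I.a_inv_closed[OF that] by simp
  qed
  have mult: "x * f \<in> J" if "x \<in> carrier ?R" "f \<in> J" for x f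
  proof -
    have "part (\<lambda>m. deg m = r) (x * f) \<in> ?I" for r
    proof -
      \<comment> \<open>Multiplication by a monomial with exponent \<open>k\<close> carries the
        component of degree \<open>r - deg k\<close> to the one of degree \<open>r\<close>.\<close>
      have "x * f = (\<Sum>k\<in>Poly_Mapping.keys x. Poly_Mapping.single k (Poly_Mapping.lookup x k) * f)"
        by (simp flip: sum_distrib_right add: sum_singles)
      then have "part (\<lambda>m. deg m = r) (x * f) =
          (\<Sum>k\<in>Poly_Mapping.keys x. Poly_Mapping.single k (Poly_Mapping.lookup x k) * part (\<lambda>m. deg m = r - deg k) f)"
        by (simp add: part_sum part_single_mult deg_def monom_weight_add eq_diff_eq add.commute)
      also have "\<dots> \<in> ?I"
      proof (rule ideal_ppoly_sum[OF ideal_plucker_ideal])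
        fix k assume "k \<in> Poly_Mapping.keys x"
        then have "Poly_Mapping.single k (Poly_Mapping.lookup x k) \<in> carrier ?R"
          using that(1) by (intro single_in_ppoly_ring) (auto simp: ppoly_ring_def)
        then show "Poly_Mapping.single k (Poly_Mapping.lookup x k) * part (\<lambda>m. deg m = r - deg k) f \<in> ?I"
          using I.I_l_closed that(2) by (simp add: J_def)
      qed
      finally show ?thesis .
    qed
    moreover have "x * f \<in> carrier ?R" using R.m_closed[of x f] that by (simp add: J_def)
    ultimately show ?thesis by (simp add: J_def)
  qed
  have idealJ: "ideal J ?R"
  proof (rule idealI)
    show "ring ?R" by (rule R.ring_axioms)
    show "subgroup J (add_monoid ?R)"
    proof (rule group.subgroupI)
      show "group (add_monoid ?R)" by (rule R.a_group)
      show "J \<subseteq> carrier (add_monoid ?R)" by (auto simp: J_def)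
      have "part P (0::ppoly) = 0" for P by (rule part_eq_0) simp
      then have "0 \<in> J" using R.zero_closed I0 by (simp add: J_def)
      then show "J \<noteq> {}" by blast
      fix a assume "a \<in> J"
      have a: "a \<in> carrier ?R" using \<open>a \<in> J\<close> by (simp add: J_def)
      have "a + (\<ominus>\<^bsub>?R\<^esub> a) = 0" using R.r_neg[OF a] by simp
      then have eq: "\<ominus>\<^bsub>?R\<^esub> a = - a" by (simp add: eq_neg_iff_add_eq_0 add.commute neg_eq_iff_add_eq_0)
      have "- a \<in> J"
        using \<open>a \<in> J\<close> neg R.a_inv_closed[OF a] by (simp add: J_def part_uminus eq)
      then show "inv\<^bsub>add_monoid ?R\<^esub> a \<in> J" using eq by (simp add: a_inv_def)
      fix b assume "b \<in> J"
      then show "a \<otimes>\<^bsub>add_monoid ?R\<^esub> b \<in> J"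
        using \<open>a \<in> J\<close> R.a_closed[of a b] by (simp add: J_def part_add Iadd)
    qed
    show "x \<otimes>\<^bsub>?R\<^esub> a \<in> J" if "a \<in> J" "x \<in> carrier ?R" for a x using mult that by simp
    show "a \<otimes>\<^bsub>?R\<^esub> x \<in> J" if "a \<in> J" "x \<in> carrier ?R" for a x using mult[of x a] that by (simp add: mult.commute)
  qed
  have "plucker_relations n \<subseteq> J"
  proof
    fix g assume g: "g \<in> plucker_relations n"
    then obtain i j k l where ijkl: "1 \<le> i" "i < j" "j < k" "k < l" "l \<le> n"
      and g_eq: "g = pvar i j * pvar k l - pvar i k * pvar j l + pvar i l * pvar j k" by blast
    have hom: "deg m = c i + c j + c k + c l" if "m \<in> Poly_Mapping.keys g" for m
    proof -
      have "m \<in> {Poly_Mapping.single (i,j) 1 + Poly_Mapping.single (k,l) 1,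
                 Poly_Mapping.single (i,k) 1 + Poly_Mapping.single (j,l) 1,
                 Poly_Mapping.single (i,l) 1 + Poly_Mapping.single (j,k) 1}"
      proof -
        let ?s = "\<lambda>i j k l. Poly_Mapping.single (Poly_Mapping.single (i, j) (1::nat) + Poly_Mapping.single (k, l) 1) (1::complex)"
        have "m \<in> Poly_Mapping.keys (?s i j k l - ?s i k j l + ?s i l j k)"
          using that by (simp add: g_eq pvar_def mult_single)
        then have "m \<in> Poly_Mapping.keys (?s i j k l) \<union> Poly_Mapping.keys (?s i k j l) \<union> Poly_Mapping.keys (?s i l j k)"
          using Poly_Mapping.keys_add[of "?s i j k l - ?s i k j l" "?s i l j k"]
            keys_diff[of "?s i j k l" "?s i k j l"] by blast
        then show ?thesis by (simp, blast)
      qed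
      then show ?thesis by (auto simp: deg_def monom_weight_add monom_weight_single)
    qed
    have gI: "g \<in> ?I"
      unfolding plucker_ideal_def
      by (rule subsetD[OF ring.genideal_self[OF R.ring_axioms plucker_relations_subset] g])
    have "part (\<lambda>m. deg m = r) g \<in> ?I" for r
    proof (cases "r = c i + c j + c k + c l")
      case True
      then show ?thesis using hom gI by (simp add: part_eq_self)
    next
      case False
      then have "part (\<lambda>m. deg m = r) g = 0" using hom by (intro part_eq_0) auto
      then show ?thesis using I0 by simp
    qed
    then show "g \<in> J" using I.Icarr[OF gI] by (simp add: J_def)
  qed
  then have "?I \<subseteq> J"
    unfolding plucker_ideal_def by (rule ring.genideal_minimal[OF R.ring_axioms idealJ])
  then show ?thesis using assms(2) by (auto simp: J_def)
qed

section \<open>Initial forms and homogeneous components\<close>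

lemma initial_form_eq_part:
  "initial_form w f = part (\<lambda>m. \<forall>m' \<in> Poly_Mapping.keys f. monom_weight w m \<le> monom_weight w m') f"
  by (simp add: initial_form_def part_def)

text \<open>The grading by \<open>c i + c j\<close> splits every \<open>f\<close> in the ideal into parts that again lie in the ideal,
  and on each part \<open>w\<close> and \<open>w'\<close> order the monomials in the same way.\<close>

lemma initial_ideal_subset:
  fixes c :: "nat \<Rightarrow> real"
  assumes "s > 0" and w: "\<And>i j. (i, j) \<in> pairs n \<Longrightarrow> w (i, j) = s * w' (i, j) + c i + c j"
  shows "initial_ideal n w (plucker_ideal n) \<subseteq> initial_ideal n w' (plucker_ideal n)"
proof -
  let ?R = "ppoly_ring n" and ?I = "plucker_ideal n"
  interpret R: cring ?R by (rule cring_ppoly_ring)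
  interpret I: ideal ?I ?R by (rule ideal_plucker_ideal)
  define deg where "deg = monom_weight (\<lambda>(i, j). c i + c j)"
  have weight: "monom_weight w m = s * monom_weight w' m + deg m" if "Poly_Mapping.keys m \<subseteq> pairs n" for m
  proof -
    have "w v = s * w' v + (case v of (i, j) \<Rightarrow> c i + c j)" if "v \<in> pairs n" for v
      using w[of "fst v" "snd v"] that by (cases v) simp
    then have "monom_weight w m = (\<Sum>v\<in>Poly_Mapping.keys m. (s * w' v + (case v of (i, j) \<Rightarrow> c i + c j)) * real (Poly_Mapping.lookup m v))"
      unfolding monom_weight_def using that by (intro sum.cong) auto
    then show ?thesis
      by (simp add: monom_weight_def deg_def algebra_simps sum.distrib sum_distrib_left)
  qed
  \<comment> \<open>The generated ideal is the intersection of all ideals \<open>J\<close> that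
    contain the \<open>w'\<close>-initial forms, so membership is shown in an arbitrary such
    \<open>J\<close>.\<close>
  have "initial_form w f \<in> J" if f: "f \<in> ?I" and J: "ideal J ?R" "initial_form w' ` ?I \<subseteq> J" for f J
  proof -
    define P where "P m \<longleftrightarrow> (\<forall>m' \<in> Poly_Mapping.keys f. monom_weight w m \<le> monom_weight w m')" for m
    define fr where "fr r = part (\<lambda>m. deg m = r) f" for r
    have frI: "fr r \<in> ?I" for r
      using homogeneous_part_plucker_ideal[OF f] by (simp add: fr_def deg_def)
    have keys_f: "Poly_Mapping.keys m \<subseteq> pairs n" if "m \<in> Poly_Mapping.keys f" for m
      using I.Icarr[OF f] that by (auto simp: ppoly_ring_def)
    have "initial_form w f = part P (\<Sum>r\<in>deg ` Poly_Mapping.keys f. fr r)"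
      unfolding fr_def by (subst sum_graded_parts) (auto simp: initial_form_eq_part P_def[abs_def])
    also have "\<dots> = (\<Sum>r\<in>deg ` Poly_Mapping.keys f. part P (fr r))" by (rule part_sum)
    also have "\<dots> \<in> J"
    proof (rule ideal_ppoly_sum[OF J(1)])
      fix r
      show "part P (fr r) \<in> J"
      \<comment> \<open>Inside one component \<open>deg\<close> is constant, so \<open>w\<close> and
        \<open>w'\<close> have the same minimal monomials there. The component contributes to
        \<open>initial_form w f\<close> only if its \<open>w\<close>-minimum is that of
        \<open>f\<close>, and then with its entire \<open>w'\<close>-initial form.\<close>
      proof (cases "\<exists>m0 \<in> Poly_Mapping.keys (fr r). P m0")
        case True
        then obtain m0 where m0: "m0 \<in> Poly_Mapping.keys (fr r)" "P m0" by blast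
        have "P m \<longleftrightarrow> (\<forall>m' \<in> Poly_Mapping.keys (fr r). monom_weight w' m \<le> monom_weight w' m')"
          if m: "m \<in> Poly_Mapping.keys (fr r)" for m
        proof -
          have le: "monom_weight w a \<le> monom_weight w b \<longleftrightarrow> monom_weight w' a \<le> monom_weight w' b"
            if "a \<in> Poly_Mapping.keys (fr r)" "b \<in> Poly_Mapping.keys (fr r)" for a b
            using that keys_f \<open>s > 0\<close> by (auto simp: fr_def keys_part weight)
          have "P m \<longleftrightarrow> (\<forall>m' \<in> Poly_Mapping.keys (fr r). monom_weight w m \<le> monom_weight w m')"
          proof
            show "P m" if "\<forall>m' \<in> Poly_Mapping.keys (fr r). monom_weight w m \<le> monom_weight w m'"
              using that m0 order_trans unfolding P_def by blast
          qed (simp add: P_def fr_def keys_part)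
          then show ?thesis using le m by blast
        qed
        then have "part P (fr r) = initial_form w' (fr r)"
          unfolding initial_form_eq_part
          by (intro poly_mapping_eqI) (auto simp: lookup_part in_keys_iff)
        then show ?thesis using J(2) frI by auto
      next
        case False
        then have "part P (fr r) = 0" by (intro part_eq_0) blast
        then show ?thesis
          using additive_subgroup.zero_closed[OF ideal.axioms(1)[OF J(1)]] by simp
      qed
    qed
    finally show ?thesis .
  qed
  then have "initial_form w ` ?I \<subseteq> J" if "ideal J ?R" "initial_form w' ` ?I \<subseteq> J" for J
    using that by blast
  then show ?thesis unfolding initial_ideal_def genideal_def by blast
qed

lemma initial_ideal_eq:
  fixes c :: "nat \<Rightarrow> real"
  assumes "s > 0" and w: "\<And>i j. (i, j) \<in> pairs n \<Longrightarrow> w (i, j) = s * w' (i, j) + c i + c j"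
  shows "initial_ideal n w (plucker_ideal n) = initial_ideal n w' (plucker_ideal n)"
proof (rule antisym)
  show "initial_ideal n w (plucker_ideal n) \<subseteq> initial_ideal n w' (plucker_ideal n)"
    using assms by (rule initial_ideal_subset)
  show "initial_ideal n w' (plucker_ideal n) \<subseteq> initial_ideal n w (plucker_ideal n)"
    using assms
    by (intro initial_ideal_subset[where s = "1 / s" and c = "\<lambda>i. - c i / s"]) (auto simp: field_simps)
qed

section \<open>Maximal families of non-crossing chords\<close>

text \<open>A triangulation as a family of intervals on the points 2, ..., N, used with N = n + 1.
  The sides and the chord \<open>(2, N)\<close> belong to it by maximality. \<open>D_nc\<close>
  excludes both kinds of crossing, since the two chords may be exchanged in it.\<close>

locale chords =
  fixes N :: nat and D :: "(nat \<times> nat) set"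
  assumes N_ge: "5 \<le> N"
    and D_range: "(a, b) \<in> D \<Longrightarrow> 2 \<le> a \<and> a < b \<and> b \<le> N"
    and D_nc: "(a, b) \<in> D \<Longrightarrow> (c, d) \<in> D \<Longrightarrow> a < c \<Longrightarrow> c < b \<Longrightarrow> d \<le> b"
    and D_max: "2 \<le> a \<Longrightarrow> a < b \<Longrightarrow> b \<le> N \<Longrightarrow>
      (\<And>c d. (c, d) \<in> D \<Longrightarrow> \<not> (a < c \<and> c < b \<and> b < d) \<and> \<not> (c < a \<and> a < d \<and> d < b)) \<Longrightarrow> (a, b) \<in> D"
begin

lemma side_in_D: "2 \<le> a \<Longrightarrow> a < N \<Longrightarrow> (a, Suc a) \<in> D"
  by (rule D_max) auto

lemma root_in_D: "(2, N) \<in> D"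
  by (rule D_max) (use N_ge in \<open>auto dest: D_range\<close>)

lemma finite_D: "finite D"
  by (rule finite_subset[of _ "{..N} \<times> {..N}"]) (auto dest: D_range)

text \<open>\<open>c\<close> is the largest neighbour of \<open>l\<close> before \<open>r\<close>. A
  chord that crosses \<open>(c, r)\<close> and ends before \<open>r\<close> is trapped between
  \<open>(l, c)\<close> and \<open>(l, r)\<close>, hence starts at \<open>l\<close>, against the
  choice of \<open>c\<close>; one that ends after \<open>r\<close> would cross
  \<open>(l, r)\<close>.\<close>

lemma apex_ex:
  assumes "(l, r) \<in> D" "Suc l < r"
  obtains c where "l < c" "c < r" "(l, c) \<in> D" "(c, r) \<in> D"
proof -
  have rng: "2 \<le> l" "r \<le> N" using D_range[OF assms(1)] by auto
  define C where "C = {c. l < c \<and> c < r \<and> (l, c) \<in> D}"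
  have "Suc l \<in> C" using assms rng by (auto simp: C_def intro!: side_in_D)
  moreover have fin: "finite C" by (rule finite_subset[of _ "{..r}"]) (auto simp: C_def)
  ultimately have cC: "Max C \<in> C" by (intro Max_in) auto
  define c where "c = Max C"
  have c: "l < c" "c < r" "(l, c) \<in> D" using cC by (auto simp: c_def C_def)
  have c_max: "x \<le> c" if "l < x" "x < r" "(l, x) \<in> D" for x
    using Max_ge[OF fin, of x] that by (auto simp: c_def C_def)
  have "(c, r) \<in> D"
  proof (rule D_max)
    fix x y assume xy: "(x, y) \<in> D"
    have "\<not> (c < x \<and> x < r \<and> r < y)" using D_nc[OF assms(1) xy] c by auto
    moreover have "\<not> (x < c \<and> c < y \<and> y < r)"
    proof
      assume A: "x < c \<and> c < y \<and> y < r"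
      have "l \<le> x" using D_nc[OF xy assms(1)] A c by force
      moreover have "\<not> l < x" using D_nc[OF c(3) xy] A by auto
      ultimately have "x = l" by simp
      then show False using c_max[of y] xy A c by auto
    qed
    ultimately show "\<not> (c < x \<and> x < r \<and> r < y) \<and> \<not> (x < c \<and> c < y \<and> y < r)" by blast
  qed (use c rng in auto)
  with c that show ?thesis by blast
qed

text \<open>The shortest chord passing strictly over \<open>m\<close> has its apex at
  \<open>m\<close>, since otherwise one of the two sides below it would still pass over
  \<open>m\<close>.\<close>

lemma base_ex:
  assumes "2 < m" "m < N"
  shows "\<exists>p. p \<in> D \<and> (fst p, m) \<in> D \<and> (m, snd p) \<in> D"
proof -
  define P where "P p \<longleftrightarrow> p \<in> D \<and> fst p < m \<and> m < snd p" for p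
  have "P (2, N)" using assms root_in_D by (simp add: P_def)
  then obtain p where p: "P p" and least: "\<And>q. P q \<Longrightarrow> snd p - fst p \<le> snd q - fst q"
    using ex_has_least_nat[of P _ "\<lambda>p. snd p - fst p"] by blast
  obtain l r where lr: "p = (l, r)" by (cases p)
  have *: "(l, r) \<in> D" "l < m" "m < r" using p by (auto simp: P_def lr)
  then obtain c where c: "l < c" "c < r" "(l, c) \<in> D" "(c, r) \<in> D" using apex_ex[of l r] by auto
  have "\<not> m < c" using least[of "(l, c)"] c * by (auto simp: P_def lr)
  moreover have "\<not> c < m" using least[of "(c, r)"] c * by (auto simp: P_def lr)
  ultimately have "c = m" by simp
  then show ?thesis using c * by (intro exI[of _ "(l, r)"]) auto
qed

text \<open>The side opposite to \<open>m\<close> in the triangle whose middle corner is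
  \<open>m\<close>; by \<open>base_eqI\<close> the choice is unique. Every point strictly between
  \<open>2\<close> and \<open>N\<close> is the apex of exactly one triangle, so triangles can be
  indexed by points.\<close>

definition base :: "nat \<Rightarrow> nat \<times> nat" where
  "base m = (SOME p. p \<in> D \<and> (fst p, m) \<in> D \<and> (m, snd p) \<in> D)"

definition lft :: "nat \<Rightarrow> nat" where "lft m = fst (base m)"
definition rgt :: "nat \<Rightarrow> nat" where "rgt m = snd (base m)"

lemma base:
  assumes "2 < m" "m < N"
  shows "(lft m, rgt m) \<in> D" "(lft m, m) \<in> D" "(m, rgt m) \<in> D"
  using someI_ex[OF base_ex[OF assms]] by (simp_all add: lft_def rgt_def base_def)

lemma base_bounds:
  assumes "2 < m" "m < N"
  shows "2 \<le> lft m" "lft m < m" "m < rgt m" "rgt m \<le> N"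
  using base[OF assms] by (auto dest: D_range)

lemma base_eqI:
  assumes "(l, r) \<in> D" "(l, m) \<in> D" "(m, r) \<in> D"
  shows "lft m = l \<and> rgt m = r"
proof -
  have "2 < m" "m < N" "l < m" "m < r" using assms by (auto dest!: D_range)
  note b = base[OF this(1,2)] base_bounds[OF this(1,2)]
  have "\<not> l < lft m" using D_nc[OF assms(2) b(1)] b \<open>l < m\<close> by auto
  moreover have "\<not> lft m < l" using D_nc[OF b(2) assms(1)] \<open>l < m\<close> \<open>m < r\<close> by auto
  moreover have "\<not> r < rgt m" using D_nc[OF assms(1) b(3)] b \<open>l < m\<close> \<open>m < r\<close> by auto
  moreover have "\<not> rgt m < r" using D_nc[OF b(1) assms(3)] b \<open>m < r\<close> by auto
  ultimately show ?thesis by simp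
qed

lemma apex_base:
  assumes "(l, r) \<in> D" "Suc l < r"
  obtains c where "2 < c" "c < N" "lft c = l" "rgt c = r"
proof -
  obtain c where c: "l < c" "c < r" "(l, c) \<in> D" "(c, r) \<in> D" using apex_ex assms by blast
  show ?thesis
    using that[of c] base_eqI[OF assms(1) c(3,4)] D_range[OF c(3)] D_range[OF c(4)] by auto
qed

text \<open>For c < c' on the same base, the chords \<open>(lft c', c')\<close> and
  \<open>(c, rgt c)\<close> would cross.\<close>

lemma base_inj:
  assumes "2 < c" "c < N" "2 < c'" "c' < N" "lft c = lft c'" "rgt c = rgt c'"
  shows "c = c'"
proof (rule ccontr)
  assume "c \<noteq> c'"
  then consider "c < c'" | "c' < c" by linarith
  then show False
    by cases (use D_nc[of "lft c'" c' c "rgt c"] D_nc[of "lft c" c c' "rgt c'"]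
      base[of c] base[of c'] base_bounds[of c] base_bounds[of c'] assms in auto)
qed

text \<open>Take the shortest chord that properly contains \<open>(a, b)\<close>. Its apex cannot
  lie strictly between \<open>a\<close> and \<open>b\<close>, and minimality makes
  \<open>(a, b)\<close> one of the two sides below it. The alternatives tell whether
  \<open>a\<close> or \<open>b\<close> is the apex of the triangle above
  \<open>(a, b)\<close>.\<close>

lemma upper_ex:
  assumes "(a, b) \<in> D" "(a, b) \<noteq> (2, N)"
  shows "(2 < a \<and> rgt a = b) \<or> (b < N \<and> lft b = a)"
proof -
  have ab: "2 \<le> a" "a < b" "b \<le> N" using D_range[OF assms(1)] by auto
  define P where "P p \<longleftrightarrow> p \<in> D \<and> fst p \<le> a \<and> b \<le> snd p \<and> p \<noteq> (a, b)" for p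
  have "P (2, N)" using root_in_D ab assms(2) by (auto simp: P_def)
  then obtain p where p: "P p" and least: "\<And>q. P q \<Longrightarrow> snd p - fst p \<le> snd q - fst q"
    using ex_has_least_nat[of P _ "\<lambda>p. snd p - fst p"] by blast
  obtain l r where lr: "p = (l, r)" by (cases p)
  have *: "(l, r) \<in> D" "l \<le> a" "b \<le> r" "l < a \<or> b < r" using p by (auto simp: P_def lr)
  then have "Suc l < r" using ab by auto
  then obtain c where c: "l < c" "c < r" "(l, c) \<in> D" "(c, r) \<in> D" using apex_ex[of l r] * by auto
  have "c \<le> a \<or> b \<le> c"
  proof (rule ccontr)
    assume "\<not> (c \<le> a \<or> b \<le> c)"
    then show False using D_nc[OF c(3) assms(1)] D_nc[OF assms(1) c(4)] * by auto
  qed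
  then show ?thesis
  proof
    assume "c \<le> a"
    then have "(c, r) = (a, b)" using least[of "(c, r)"] c * by (force simp: P_def lr)
    then show ?thesis using base_eqI[OF *(1) c(3,4)] c ab D_range[OF *(1)] by auto
  next
    assume "b \<le> c"
    then have "(l, c) = (a, b)" using least[of "(l, c)"] c * by (force simp: P_def lr)
    then show ?thesis using base_eqI[OF *(1) c(3,4)] c ab D_range[OF *(1)] by auto
  qed
qed

text \<open>Otherwise \<open>(lft a, b)\<close> and \<open>(a, rgt b)\<close> would be crossing
  chords.\<close>

lemma upper_not_both:
  assumes "2 < a" "a < N" "2 < b" "b < N" "rgt a = b" "lft b = a"
  shows False
  using D_nc[of "lft a" "rgt a" a "rgt b"] base[of a] base[of b] base_bounds[of a] base_bounds[of b] assms
  by auto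

section \<open>Nesting of the bases of triangles\<close>

lemma base_mono_rgt:
  assumes "2 < c" "c < N" "2 < m" "m < N" "c = rgt m"
  shows "lft c \<le> lft m" "rgt m < rgt c"
proof -
  show "lft c \<le> lft m"
    using D_nc[of "lft m" c "lft c" "rgt c"] base[of m] base[of c] base_bounds[of c] assms by force
  show "rgt m < rgt c" using base_bounds[of c] assms by auto
qed

lemma base_mono_lft:
  assumes "2 < c" "c < N" "2 < m" "m < N" "c = lft m"
  shows "lft c < lft m" "rgt m \<le> rgt c"
proof -
  show "lft c < lft m" using base_bounds[of c] assms by auto
  show "rgt m \<le> rgt c"
    using D_nc[of "lft c" "rgt c" c "rgt m"] base[of m] base[of c] base_bounds[of c] assms by force
qed

text \<open>The triangle with apex \<open>c\<close> need not share a side with the triangle over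
  whose base end it sits, only the point \<open>c\<close>; still its base spans strictly more. A
  directed path leaves a triangle through its apex and enters one that has this point as an end of
  its base, so bases shrink along the path.\<close>

lemma base_mono:
  assumes "2 < c" "c < N" "2 < m" "m < N" "c = lft m \<or> c = rgt m"
  shows "lft c \<le> lft m" "rgt m \<le> rgt c" "rgt m - lft m < rgt c - lft c"
  using base_mono_lft[of c m] base_mono_rgt[of c m] assms base_bounds[of m] by auto

lemma base_below:
  assumes "(a, b) \<in> D" "a < c" "c < b"
  shows "a \<le> lft c" "rgt c \<le> b"
proof -
  have c: "2 < c" "c < N" using D_range[OF assms(1)] assms by auto
  show "a \<le> lft c"
    using D_nc[of "lft c" c a b] base[OF c] base_bounds[OF c] assms by force
  show "rgt c \<le> b"
    using D_nc[of a b c "rgt c"] base[OF c] assms by auto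
qed

lemma below_side:
  assumes c: "2 < c" "c < N" and e: "(a, b) \<in> D" "lft c \<le> a" "b \<le> rgt c" "(a, b) \<noteq> (lft c, rgt c)"
  shows "b \<le> c \<or> c \<le> a"
proof (rule ccontr)
  assume "\<not> (b \<le> c \<or> c \<le> a)"
  then show False
    using base_below[OF e(1), of c] e by auto
qed

end

section \<open>Paths through the triangles\<close>

context chords
begin

text \<open>The value \<open>N\<close> outside the apexes exceeds every difference
  \<open>rgt c - lft c\<close>, so the sources \<open>2\<close> and \<open>N\<close> count as wider
  than all triangles and \<open>width_parent\<close> covers them.\<close>

definition width :: "nat \<Rightarrow> nat" where "width c = (if 2 < c \<and> c < N then rgt c - lft c else N)"

lemma width_parent:
  assumes "2 < m" "m < N" "x = lft m \<or> x = rgt m"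
  shows "width m < width x"
proof (cases "2 < x \<and> x < N")
  case True
  then show ?thesis using base_mono(3)[of x m] assms by (simp add: width_def)
next
  case False
  then show ?thesis using base_bounds[of m] assms by (auto simp: width_def)
qed

lemma width_le: "width x \<le> N"
  by (cases "2 < x \<and> x < N") (use base_bounds[of x] in \<open>auto simp: width_def\<close>)

text \<open>Widths grow towards the sources and are bounded by \<open>N\<close>, so the induction
  proceeds from the sources downwards.\<close>

lemma up_induct [consumes 2, case_names up]:
  assumes "2 < m" "m < N"
    and step: "\<And>m. 2 < m \<Longrightarrow> m < N \<Longrightarrow>
      (\<And>x. 2 < x \<Longrightarrow> x < N \<Longrightarrow> x = lft m \<or> x = rgt m \<Longrightarrow> P x) \<Longrightarrow> P m"
  shows "P m"
  using assms(1,2)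
proof (induction "N - width m" arbitrary: m rule: less_induct)
  case less
  show ?case
  proof (rule step[OF less.prems])
    fix x assume x: "2 < x" "x < N" "x = lft m \<or> x = rgt m"
    have "width m < width x" using width_parent less.prems x(3) .
    then show "P x" using less.hyps[of x] x width_le[of x] by simp
  qed
qed

end

text \<open>\<open>V\<close> is the set of apexes of the triangles that a directed path from \<open>s\<close> to \<open>j\<close> visits, and \<open>L\<close> a
  set of chords to the left of that path.\<close>

locale visited = chords +
  fixes V :: "nat set" and s j :: nat
  assumes V: "V \<subseteq> {2<..<N}" and s: "s = 2 \<or> s = N" and jV: "j \<in> V"
    and pred: "c \<in> V \<Longrightarrow> lft c \<in> insert s V \<or> rgt c \<in> insert s V"
    and succ: "c \<in> V \<Longrightarrow> c \<noteq> j \<Longrightarrow> \<exists>c' \<in> V. c = lft c' \<or> c = rgt c'"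
begin

lemma V_bounds: "c \<in> V \<Longrightarrow> 2 < c" "c \<in> V \<Longrightarrow> c < N"
  using V by auto

text \<open>Bases shrink along the path, and the last visited triangle has its apex at
  \<open>j\<close>.\<close>

lemma target_between: "c \<in> V \<Longrightarrow> lft c < j \<and> j < rgt c"
proof (induction "width c" arbitrary: c rule: less_induct)
  case less
  note b = base_bounds[OF V_bounds[OF less.prems]]
  show ?case
  proof (cases "c = j")
    case False
    then obtain c' where c': "c' \<in> V" "c = lft c' \<or> c = rgt c'" using succ less.prems by blast
    have "lft c' < j \<and> j < rgt c'"
      using less.hyps[of c'] c' width_parent V_bounds by blast
    then show ?thesis using base_mono(1,2)[of c c'] c' V_bounds less.prems by fastforce
  qed (use b in auto)
qed

text \<open>Followed back from \<open>m\<close>, the path stays in the interval from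
  \<open>l\<close> to \<open>r\<close> until it meets an end of the chord, and the source is never
  strictly inside.\<close>

lemma exit:
  assumes "(l, r) \<in> D" "l < m" "m < r" "m \<in> V"
  shows "l \<in> insert s V \<or> r \<in> insert s V"
proof -
  have "2 < m" "m < N" using V_bounds assms(4) by auto
  then show ?thesis
    using assms(2-4)
  proof (induction m rule: up_induct)
    case (up m)
    obtain x where x: "x = lft m \<or> x = rgt m" "x \<in> insert s V" using pred up.prems by blast
    have "l \<le> x" "x \<le> r" using base_below[OF assms(1), of m] base_bounds[OF up.hyps(1,2)] up.prems x by auto
    then consider "x = l" | "x = r" | "l < x" "x < r" by linarith
    then show ?case
    proof cases
      case 3
      then have "x \<noteq> s" using s D_range[OF assms(1)] by auto
      then show ?thesis using up.IH[of x] x 3 V_bounds[of x] by auto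
    qed (use x in auto)
  qed
qed

lemma source_triangle: "\<exists>c \<in> V. s = lft c \<or> s = rgt c"
proof -
  have "\<exists>c \<in> V. s = lft c \<or> s = rgt c" if "2 < m" "m < N" "m \<in> V" for m
    using that
  proof (induction m rule: up_induct)
    case (up m)
    obtain x where "x = lft m \<or> x = rgt m" "x \<in> insert s V" using pred up.prems by blast
    then show ?case using up.IH[of x] up.prems V_bounds[of x] by auto
  qed
  then show ?thesis using jV V_bounds by blast
qed

end

text \<open>The path has \<open>(c, rgt c)\<close> on its left when it leaves a triangle through the
  apex \<open>c\<close>; a path from \<open>2\<close> has the arc between the sources on its left;
  the sides of a triangle that is not visited lie on one side of the path, which is recorded from
  the base downwards.\<close>

locale left_of_visited = visited +
  fixes L :: "(nat \<times> nat) set"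
  assumes L_apex: "c \<in> V \<Longrightarrow> (c, rgt c) \<in> L"
    and L_root: "s = 2 \<Longrightarrow> (2, N) \<in> L"
    and L_down: "2 < c \<Longrightarrow> c < N \<Longrightarrow> c \<notin> V \<Longrightarrow> (lft c, rgt c) \<in> L \<Longrightarrow> (lft c, c) \<in> L \<and> (c, rgt c) \<in> L"
begin

abbreviation above :: "nat \<Rightarrow> nat \<Rightarrow> nat \<Rightarrow> bool" where
  "above c a b \<equiv> c \<in> V \<and> lft c \<le> a \<and> b \<le> rgt c \<and> (a, b) \<noteq> (lft c, rgt c)"

text \<open>By the last assumption no triangle between \<open>(A, B)\<close> and
  \<open>(a, b)\<close> is visited, so membership in \<open>L\<close> is handed from each base to
  the side that covers \<open>(a, b)\<close>.\<close>

lemma descend: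
  assumes "(A, B) \<in> D" "(A, B) \<in> L" "(a, b) \<in> D" "A \<le> a" "b \<le> B"
    "\<And>c. above c a b \<Longrightarrow> A \<le> lft c \<Longrightarrow> rgt c \<le> B \<Longrightarrow> False"
  shows "(a, b) \<in> L"
  using assms
proof (induction "B - A" arbitrary: A B rule: less_induct)
  case less
  show ?case
  proof (cases "(A, B) = (a, b)")
    case False
    have ab: "a < b" using D_range[OF less.prems(3)] by simp
    then have "Suc A < B" using False less.prems by auto
    then obtain c where c: "2 < c" "c < N" "lft c = A" "rgt c = B" using apex_base less.prems(1) by blast
    note b = base[OF c(1,2)] base_bounds[OF c(1,2)]
    have "c \<notin> V" using less.prems(4,5) less.prems(6)[of c] c False by auto
    then have L: "(A, c) \<in> L" "(c, B) \<in> L" using L_down[of c] c less.prems by auto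
    have "b \<le> c \<or> c \<le> a" using below_side[OF c(1,2) less.prems(3)] c less.prems False by auto
    then show ?thesis
    proof
      assume "b \<le> c"
      show ?thesis
      proof (rule less.hyps[OF _ _ L(1) less.prems(3,4) \<open>b \<le> c\<close>])
        show "c - A < B - A" "(A, c) \<in> D" using b c by auto
        show False if "above c' a b" "A \<le> lft c'" "rgt c' \<le> c" for c'
          using less.prems(6)[OF that(1,2)] that(3) b c by simp
      qed
    next
      assume "c \<le> a"
      show ?thesis
      proof (rule less.hyps[OF _ _ L(2) less.prems(3) \<open>c \<le> a\<close> less.prems(5)])
        show "B - c < B - A" "(c, B) \<in> D" using b c by auto
        show False if "above c' a b" "c \<le> lft c'" "rgt c' \<le> B" for c'
          using less.prems(6)[OF that(1) _ that(3)] that(2) b c by simp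
      qed
    qed
  qed (use less.prems in simp)
qed

text \<open>The narrowest visited triangle above \<open>(a, b)\<close> decides. If the chord lies
  below \<open>(c, rgt c)\<close>, then \<open>L_apex\<close> and \<open>descend\<close> put it into
  \<open>L\<close>; otherwise it lies below \<open>(lft c, c)\<close>.\<close>

lemma left_or_right:
  assumes e: "(a, b) \<in> D" and s_j: "s = 2 \<or> j \<le> a"
  shows "(a, b) \<in> L \<or> (\<exists>c \<in> V. a < j \<and> lft c \<le> a \<and> b \<le> c)"
proof (cases "\<exists>c. above c a b")
  case False
  \<comment> \<open>A path from \<open>N\<close> is impossible here: its first triangle has right
    end \<open>N\<close> and a left end before \<open>j\<close>, so it would lie above
    \<open>(a, b)\<close>.\<close>
  have "s = 2"
  proof (rule ccontr)
    assume "s \<noteq> 2"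
    then have "s = N" "j \<le> a" using s s_j by auto
    obtain c where c: "c \<in> V" "N = lft c \<or> N = rgt c" using source_triangle \<open>s = N\<close> by blast
    then have "rgt c = N" using base_bounds[of c] V_bounds[of c] by auto
    then have "above c a b" using c \<open>j \<le> a\<close> target_between[of c] D_range[OF e] by auto
    then show False using False by blast
  qed
  then have "(a, b) \<in> L"
    using descend[OF root_in_D L_root e] False D_range[OF e] by blast
  then show ?thesis by simp
next
  case True
  then obtain c where c: "above c a b" and least: "\<And>c'. above c' a b \<Longrightarrow> width c \<le> width c'"
    using ex_has_least_nat[of "\<lambda>c. above c a b" _ width] by blast
  have cb: "2 < c" "c < N" using c V_bounds by auto
  note b = base[OF cb] base_bounds[OF cb]
  have wd: "width c' = rgt c' - lft c'" if "c' \<in> V" for c' using V_bounds[OF that] by (simp add: width_def)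
  have "b \<le> c \<or> c \<le> a" using below_side[OF cb e] c by auto
  then show ?thesis
  proof
    assume "c \<le> a"
    have "(a, b) \<in> L"
    proof (rule descend[OF b(3) L_apex e \<open>c \<le> a\<close>])
      show False if "above c' a b" "c \<le> lft c'" "rgt c' \<le> rgt c" for c'
        using least[OF that(1)] that b c wd by force
    qed (use c in auto)
    then show ?thesis ..
  next
    assume "b \<le> c"
    \<comment> \<open>If j \<le> a, the path has to turn back from \<open>c\<close> to
      \<open>j\<close>, and the next visited triangle is a narrower one above
      \<open>(a, b)\<close>.\<close>
    have "a < j"
    proof (rule ccontr)
      assume "\<not> a < j"
      then have "c \<noteq> j" "j < c" using D_range[OF e] \<open>b \<le> c\<close> by auto
      then obtain c' where c': "c' \<in> V" "c = lft c' \<or> c = rgt c'" using succ c by blast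
      have t: "lft c' < j" "j < rgt c'" using target_between[OF c'(1)] by auto
      then have "c = rgt c'" using c' \<open>j < c\<close> by auto
      then have "above c' a b" using c' t \<open>\<not> a < j\<close> \<open>b \<le> c\<close> by auto
      then show False using least[of c'] width_parent[of c' c] c' V_bounds[OF c'(1)] by force
    qed
    then show ?thesis using c \<open>b \<le> c\<close> by blast
  qed
qed

end

section \<open>Two disjoint paths from the two sources\<close>

locale two_paths = P: visited N D Vp 2 i + Q: visited N D Vq N j
  for N D Vp Vq i j +
  assumes disjoint: "Vp \<inter> Vq = {}"
begin

text \<open>The apex of the triangle above \<open>(l, r)\<close> is \<open>l\<close> or
  \<open>r\<close>. The path through it cannot come from the other end, which belongs to the other
  path, nor from its own source, which lies on the wrong side. So it comes from the third corner,
  and this gives a longer chord of the same kind.\<close>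

lemma no_crossing:
  assumes "(l, r) \<in> D" "l \<in> Vq" "r \<in> Vp"
  shows False
  using assms
proof (induction "N - (r - l)" arbitrary: l r rule: less_induct)
  case less
  have l: "2 < l" "l < N" using Q.V_bounds less.prems by auto
  have r: "2 < r" "r < N" using P.V_bounds less.prems by auto
  note bl = P.base[OF l] P.base_bounds[OF l] and br = P.base[OF r] P.base_bounds[OF r]
  from P.upper_ex[OF less.prems(1)] l have "P.rgt l = r \<or> P.lft r = l" by auto
  then show False
  proof
    assume *: "P.rgt l = r"
    then have "P.rgt l \<notin> insert N Vq" using r less.prems disjoint by auto
    then have "P.lft l \<in> Vq" using Q.pred[OF less.prems(2)] bl l by auto
    moreover have "N - (r - P.lft l) < N - (r - l)" using bl(5,6) * r by linarith
    ultimately show False using less.hyps[of r "P.lft l"] less.prems(3) bl(1) * by blast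
  next
    assume *: "P.lft r = l"
    then have "P.lft r \<notin> insert 2 Vp" using l less.prems disjoint by auto
    then have "P.rgt r \<in> Vp" using P.pred[OF less.prems(3)] br r by auto
    moreover have "N - (P.rgt r - l) < N - (r - l)" using br(5,6,7) * l by linarith
    ultimately show False using less.hyps[of "P.rgt r" l] less.prems(2) br(1) * by blast
  qed
qed

text \<open>If j < i, take the shortest chord over both, with apex \<open>c\<close>. By
  \<open>exit\<close>, the path to \<open>j\<close> passes \<open>l\<close> or \<open>c\<close>, and
  the path to \<open>i\<close> passes \<open>c\<close> or \<open>r\<close>. They cannot share
  \<open>c\<close>, so \<open>no_crossing\<close> applies to \<open>(l, r)\<close>,
  \<open>(l, c)\<close> or \<open>(c, r)\<close>.\<close>

lemma targets_ordered: "i < j"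
proof (rule ccontr)
  assume "\<not> i < j"
  moreover have "i \<noteq> j" using P.jV Q.jV disjoint by auto
  ultimately have ji: "j < i" by simp
  have b: "2 < j" "j < N" "2 < i" "i < N" using P.V_bounds[OF P.jV] Q.V_bounds[OF Q.jV] by auto
  define R where "R p \<longleftrightarrow> p \<in> D \<and> fst p \<le> j \<and> i \<le> snd p" for p
  have "R (2, N)" using P.root_in_D b by (simp add: R_def)
  then obtain p where p: "R p" and least: "\<And>q. R q \<Longrightarrow> snd p - fst p \<le> snd q - fst q"
    using ex_has_least_nat[of R _ "\<lambda>p. snd p - fst p"] by blast
  obtain l r where lr: "p = (l, r)" by (cases p)
  have *: "(l, r) \<in> D" "l \<le> j" "i \<le> r" using p by (auto simp: R_def lr)
  show False
  proof (cases "r = Suc l")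
    case True
    then have "l = j" "r = i" using * ji by auto
    then show False using no_crossing[OF *(1)] P.jV Q.jV by simp
  next
    case False
    then have "Suc l < r" using * ji by simp
    then obtain c where c: "l < c" "c < r" "(l, c) \<in> D" "(c, r) \<in> D" using P.apex_ex *(1) by blast
    have "j < c" using least[of "(c, r)"] c * by (force simp: R_def lr)
    moreover have "c < i" using least[of "(l, c)"] c * by (force simp: R_def lr)
    ultimately have q: "l \<in> Vq \<or> c \<in> Vq" and p: "c \<in> Vp \<or> r \<in> Vp"
      using Q.exit[OF c(3), of j] P.exit[OF c(4), of i] P.jV Q.jV * c P.D_range[OF c(3)] P.D_range[OF c(4)]
      by (cases "l = j"; cases "r = i"; auto)+
    then show False using no_crossing[OF *(1)] no_crossing[OF c(3)] no_crossing[OF c(4)] disjoint by blast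
  qed
qed

end

section \<open>Greedy paths\<close>

text \<open>\<open>k\<close> is an exclusive bound for the points on the path. It will be the second
  target for the path from \<open>2\<close> in a pair, \<open>N\<close> for a path from
  \<open>2\<close> alone, and \<open>N + 1\<close> for a path from \<open>N\<close>.\<close>

locale greedy = chords +
  fixes i k :: nat
  assumes i: "2 < i" "i < N" and k: "i < k" "k \<le> Suc N"
begin

text \<open>Read backwards from \<open>i\<close>, the path to \<open>i\<close> that keeps left as long as it stays below \<open>k\<close>. For
  \<open>k = N + 1\<close> nothing stops it before \<open>N\<close>, otherwise it has to come from \<open>2\<close>.\<close>

definition nxt :: "nat \<Rightarrow> nat" where "nxt y = (if rgt y < k then rgt y else lft y)"

definition src :: nat where "src = (if k \<le> N then 2 else N)"

inductive_set up :: "nat \<Rightarrow> nat set" for m where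
  self: "m \<in> up m"
| nxt: "y \<in> up m \<Longrightarrow> 2 < y \<Longrightarrow> y < N \<Longrightarrow> nxt y \<in> up m"

lemma nxt_cases: "nxt y = lft y \<or> nxt y = rgt y"
  by (simp add: nxt_def)

lemma nxt_bounds:
  assumes "2 < y" "y < N" "y < k"
  shows "nxt y < k" "nxt y = src \<or> 2 < nxt y \<and> nxt y < N"
  using base_bounds[OF assms(1,2)] assms k i by (auto simp: nxt_def src_def)

lemma up_src: "up src = {src}"
proof -
  have "y = src" if "y \<in> up src" for y
    using that by induction (auto simp: src_def split: if_splits)
  then show ?thesis using up.self by blast
qed

lemma up_eq: "2 < m \<Longrightarrow> m < N \<Longrightarrow> up m = insert m (up (nxt m))"
proof -
  assume m: "2 < m" "m < N"
  have "y \<in> insert m (up (nxt m))" if "y \<in> up m" for y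
    using that by induction (use up.intros in auto)
  moreover have "y \<in> up m" if "y \<in> up (nxt m)" for y
    using that by induction (use up.intros m in auto)
  ultimately show ?thesis using up.self by blast
qed

lemma greedy_induct [consumes 3, case_names src step]:
  assumes "2 < m" "m < N" "m < k"
    and src: "\<And>m. 2 < m \<Longrightarrow> m < N \<Longrightarrow> m < k \<Longrightarrow> nxt m = src \<Longrightarrow> P m"
    and step: "\<And>m. 2 < m \<Longrightarrow> m < N \<Longrightarrow> m < k \<Longrightarrow> 2 < nxt m \<Longrightarrow> nxt m < N \<Longrightarrow> nxt m < k \<Longrightarrow> P (nxt m) \<Longrightarrow> P m"
  shows "P m"
  using assms(1-3)
proof (induction m rule: up_induct)
  case (up m)
  show ?case
  proof (cases "nxt m = src")
    case False
    then show ?thesis using nxt_bounds[OF up.hyps(1,2) up.prems] up.IH[of "nxt m"] nxt_cases[of m] step up by auto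
  qed (use src up in auto)
qed

text \<open>The last claim puts \<open>(y, rgt y)\<close> to the left of the path: a step to the
  right increases the point, and a step to the left occurs only when the base already reaches
  \<open>k\<close>, which persists because bases widen backwards.\<close>

lemma up_props:
  assumes "2 < m" "m < N" "m < k" "y \<in> up m"
  shows "y < k" "y = src \<or> 2 < y \<and> y < N"
    "y \<noteq> src \<Longrightarrow> lft y \<le> lft m \<and> rgt m \<le> rgt y \<and> (y = m \<or> width m < width y)"
    "y \<noteq> src \<Longrightarrow> m \<le> y \<or> k \<le> rgt y"
proof -
  have "y < k \<and> (y = src \<or> 2 < y \<and> y < N) \<and> (y \<noteq> src \<longrightarrow> lft y \<le> lft m \<and> rgt m \<le> rgt y \<and>
      (y = m \<or> width m < width y) \<and> (m \<le> y \<or> k \<le> rgt y))"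
    using assms
  proof (induction m rule: greedy_induct)
    case (src m)
    then have "y = m \<or> y = src" using up_eq[of m] up_src by auto
    then show ?case using src nxt_bounds(1)[of m] by auto
  next
    case (step m)
    have "y = m \<or> y \<in> up (nxt m)" using up_eq[of m] step by auto
    then show ?case
    proof
      assume y: "y \<in> up (nxt m)"
      note mono = base_mono(1,2)[OF step.hyps(4,5,1,2) nxt_cases]
      have w: "width m < width (nxt m)" using width_parent[OF step.hyps(1,2) nxt_cases] .
      have "m \<le> nxt m \<or> k \<le> rgt m" using base_bounds[OF step.hyps(1,2)] by (auto simp: nxt_def)
      then show ?case using step.IH[OF y] mono w by auto
    qed (use step in auto)
  qed
  then show "y < k" "y = src \<or> 2 < y \<and> y < N"
    "y \<noteq> src \<Longrightarrow> lft y \<le> lft m \<and> rgt m \<le> rgt y \<and> (y = m \<or> width m < width y)"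
    "y \<noteq> src \<Longrightarrow> m \<le> y \<or> k \<le> rgt y" by blast+
qed

lemma src_ne: "2 < m \<Longrightarrow> m < N \<Longrightarrow> m \<noteq> src"
  by (auto simp: src_def)

text \<open>Below \<open>(l, c)\<close> with c < k, every step back goes to the right and never
  beyond \<open>c\<close>.\<close>

lemma up_exit_right:
  assumes "2 < m" "m < N" "m < k" "(l, c) \<in> D" "l < m" "m < c" "c < k"
  shows "c \<in> up m"
  using assms
proof (induction m rule: greedy_induct)
  case (src m)
  have "rgt m \<le> c" using base_below[OF src(5)] src by auto
  then have *: "nxt m = rgt m" using src by (simp add: nxt_def)
  then have "rgt m = c" using src base_bounds[OF src(1,2)] \<open>rgt m \<le> c\<close> D_range[OF src(5)] i k by (auto simp: src_def split: if_splits)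
  then show ?case using up_eq[of m] src * up_src by auto
next
  case (step m)
  have "rgt m \<le> c" using base_below[OF step.prems(1)] step.prems by auto
  then have *: "nxt m = rgt m" using step.prems by (simp add: nxt_def)
  show ?case
  proof (cases "rgt m = c")
    case True
    then show ?thesis using up_eq[of m] step.hyps * up.self[of c] by auto
  next
    case False
    then have "c \<in> up (nxt m)" using step.IH step.prems * \<open>rgt m \<le> c\<close> base_bounds[OF step.hyps(1,2)] by auto
    then show ?thesis using up_eq[of m] step.hyps by auto
  qed
qed

text \<open>The points of the path stay below \<open>k\<close>, hence before \<open>r\<close>, and
  the source is \<open>2\<close>; the interval can only be left at \<open>c\<close>.\<close>

lemma up_exit_left:
  assumes "2 < m" "m < N" "m < k" "(c, r) \<in> D" "c < m" "m < r" "k \<le> r"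
  shows "c \<in> up m"
  using assms
proof (induction m rule: greedy_induct)
  case (src m)
  note bb = base_below[OF src(5-7)] base_bounds[OF src(1,2)] D_range[OF src(5)]
  have "src = 2" using src bb by (auto simp: src_def)
  then have "nxt m = lft m" using src(4) bb by (auto simp: nxt_def split: if_splits)
  then have "c = src" using bb \<open>src = 2\<close> src(4) by auto
  then show ?case using up_eq[of m] src up_src by auto
next
  case (step m)
  note bb = base_below[OF step.prems(1-3)] base_bounds[OF step.hyps(1,2)]
  show ?case
  proof (cases "nxt m = c")
    case True
    then show ?thesis using up_eq[of m] step.hyps up.self[of c] by auto
  next
    case False
    then have "c < nxt m" "nxt m < r" using bb step.prems by (auto simp: nxt_def split: if_splits)
    then have "c \<in> up (nxt m)" using step.IH step.prems by auto
    then show ?thesis using up_eq[of m] step.hyps by auto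
  qed
qed

text \<open>The chords to the left of the greedy path from \<open>src\<close> to \<open>i\<close>.\<close>

definition S :: "nat \<times> nat \<Rightarrow> bool" where "S e \<longleftrightarrow> i \<le> fst e \<or> k \<le> snd e"

text \<open>A difference in \<open>S\<close> between two sides means lft c < i \<le> c < k, or c
  \<le> i with k \<le> rgt c. The exit lemmas for \<open>(lft c, c)\<close> and
  \<open>(c, rgt c)\<close> then put \<open>c\<close> on the path.\<close>

lemma S_cross:
  assumes c: "2 < c" "c < N"
  shows "S (lft c, c) \<noteq> S (lft c, rgt c) \<Longrightarrow> c \<in> up i \<and> nxt c = lft c"
    and "S (lft c, rgt c) \<noteq> S (c, rgt c) \<Longrightarrow> c \<in> up i \<and> nxt c = rgt c"
    and "S (lft c, c) \<noteq> S (c, rgt c) \<Longrightarrow> c \<in> up i"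
proof -
  note b = base[OF c] base_bounds[OF c]
  have right: "c \<in> up i" if "lft c < i" "i \<le> c" "c < k"
    using that up_exit_right[OF i k(1) b(2)] up.self[of i] by (cases "i = c") auto
  have left: "c \<in> up i" if "c \<le> i" "k \<le> rgt c"
    using that up_exit_left[OF i k(1) b(3)] up.self[of i] k by (cases "i = c") auto
  show "c \<in> up i \<and> nxt c = lft c" if "S (lft c, c) \<noteq> S (lft c, rgt c)"
    using that left right b by (cases "c \<le> i") (auto simp: S_def nxt_def)
  show "c \<in> up i \<and> nxt c = rgt c" if "S (lft c, rgt c) \<noteq> S (c, rgt c)"
    using that left right b by (auto simp: S_def nxt_def)
  show "c \<in> up i" if "S (lft c, c) \<noteq> S (c, rgt c)"
    using that left right b by (cases "c \<le> i") (auto simp: S_def)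
qed

lemma S_up:
  assumes "c \<in> up i" "c \<noteq> src"
  shows "S (c, rgt c)" "nxt c = lft c \<Longrightarrow> S (lft c, rgt c)"
proof -
  have c: "2 < c" "c < N" using up_props(2)[OF i k(1) assms(1)] assms(2) by auto
  show "S (c, rgt c)" using up_props(4)[OF i k(1) assms] by (auto simp: S_def)
  show "nxt c = lft c \<Longrightarrow> S (lft c, rgt c)"
    using base_bounds[OF c] by (auto simp: S_def nxt_def split: if_splits)
qed

end

section \<open>Triangulations as families of chords\<close>

lemma ccw_corner_eq:
  assumes "ccw a b c"
  shows "ccw_corner {a, b, c} a = b"
  unfolding ccw_corner_def
proof (rule the_equality)
  show "\<exists>d. {a, b, c} = {a, b, d} \<and> ccw a b d" using assms by blast
  fix x assume "\<exists>d. {a, b, c} = {a, x, d} \<and> ccw a x d"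
  then obtain d where d: "{a, b, c} = {a, x, d}" "ccw a x d" by blast
  then have "x \<in> {a, b, c}" "b \<in> {a, x, d}" by auto
  then show "x = b" using d(2) assms by (auto simp: ccw_def)
qed

lemma cw_corner_eq:
  assumes "ccw a b c"
  shows "cw_corner {a, b, c} a = c"
  unfolding cw_corner_def
proof (rule the_equality)
  show "\<exists>d. {a, b, c} = {a, c, d} \<and> ccw a d c" using assms by (auto intro!: exI[of _ b])
  fix x assume "\<exists>d. {a, b, c} = {a, x, d} \<and> ccw a d x"
  then obtain d where d: "{a, b, c} = {a, x, d}" "ccw a d x" by blast
  then have "x \<in> {a, b, c}" "c \<in> {a, x, d}" by auto
  then show "x = c" using d(2) assms by (auto simp: ccw_def)
qed

lemma ccw_rotate: "ccw a b c \<Longrightarrow> ccw b c a"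
  by (auto simp: ccw_def)

lemma ccw_corners:
  assumes t: "t = {a, b, c}" and "ccw a b c"
  shows "ccw_corner t a = b" "ccw_corner t b = c" "ccw_corner t c = a"
    "cw_corner t a = c" "cw_corner t b = a" "cw_corner t c = b"
proof -
  have t': "t = {b, c, a}" "t = {c, a, b}" using t by auto
  note o = assms(2) ccw_rotate[OF assms(2)] ccw_rotate[OF ccw_rotate[OF assms(2)]]
  show "ccw_corner t a = b" "cw_corner t a = c" unfolding t using o by (simp_all add: ccw_corner_eq cw_corner_eq)
  show "ccw_corner t b = c" "cw_corner t b = a" unfolding t' using o by (simp_all add: ccw_corner_eq cw_corner_eq)
  show "ccw_corner t c = a" "cw_corner t c = b" unfolding t'(2) using o by (simp_all add: ccw_corner_eq cw_corner_eq)
qed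

section \<open>Relabelled arcs and triangles\<close>

locale disk =
  fixes n :: nat and \<Delta> :: "nat set set"
  assumes n_ge: "4 \<le> n" and tri_\<Delta>: "triangulation n \<Delta>"
begin

definition old :: "nat \<Rightarrow> nat" where "old v = (if v = Suc n then 1 else v)"

definition D :: "(nat \<times> nat) set" where
  "D = {(a, b). 2 \<le> a \<and> a < b \<and> b \<le> Suc n \<and> {old a, old b} \<in> \<Delta>}"

lemma \<Delta>_arcs: "\<Delta> \<subseteq> arcs n"
  using tri_\<Delta> by (simp add: triangulation_def noncrossing_def)

lemma \<Delta>_nc: "a \<in> \<Delta> \<Longrightarrow> b \<in> \<Delta> \<Longrightarrow> \<not> crossing a b"
  using tri_\<Delta> by (simp add: triangulation_def noncrossing_def)

lemma crossing_sym: "crossing a b \<longleftrightarrow> crossing b a"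
  unfolding crossing_def by blast

lemma \<Delta>_max:
  assumes "e \<in> arcs n" "\<And>b. b \<in> \<Delta> \<Longrightarrow> \<not> crossing e b"
  shows "e \<in> \<Delta>"
proof -
  have "\<not> crossing e e" by (auto simp: crossing_def doubleton_eq_iff)
  then have "noncrossing n (insert e \<Delta>)"
    using assms \<Delta>_arcs \<Delta>_nc crossing_sym by (auto simp: noncrossing_def)
  then show ?thesis using tri_\<Delta> by (auto simp: triangulation_def)
qed

lemma old_inj: "2 \<le> a \<Longrightarrow> 2 \<le> b \<Longrightarrow> old a = old b \<longleftrightarrow> a = b"
  using n_ge by (auto simp: old_def)

lemma old_range: "2 \<le> a \<Longrightarrow> a \<le> Suc n \<Longrightarrow> 1 \<le> old a \<and> old a \<le> n"
  using n_ge by (auto simp: old_def)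

lemma old_surj: "1 \<le> m \<Longrightarrow> m \<le> n \<Longrightarrow> \<exists>a. 2 \<le> a \<and> a \<le> Suc n \<and> m = old a"
  using n_ge by (intro exI[of _ "if m = 1 then Suc n else m"]) (auto simp: old_def)

text \<open>\<open>old\<close> only rotates the labels. For d = n + 1 the label of \<open>d\<close>
  is 1, and the four end points are met in the order 1, a, c, b; crossing is symmetric in the two
  arcs.\<close>

lemma crossing_old:
  assumes "2 \<le> a" "a < c" "c < b" "b < d" "d \<le> Suc n"
  shows "crossing {old a, old b} {old c, old d}"
proof (cases "d = Suc n")
  case True
  then show ?thesis using assms unfolding crossing_def
    by (intro exI[of _ 1] exI[of _ a] exI[of _ c] exI[of _ b]) (auto simp: old_def)
next
  case False
  then show ?thesis using assms unfolding crossing_def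
    by (intro exI[of _ a] exI[of _ c] exI[of _ b] exI[of _ d]) (auto simp: old_def)
qed

lemma crossing_oldD:
  assumes "crossing {old a, old b} {old c, old d}"
    "2 \<le> a" "a < b" "b \<le> Suc n" "2 \<le> c" "c < d" "d \<le> Suc n"
  shows "(a < c \<and> c < b \<and> b < d) \<or> (c < a \<and> a < d \<and> d < b)"
  using assms unfolding crossing_def old_def doubleton_eq_iff
  by (elim exE conjE disjE) (auto split: if_splits)

lemma arcs_old: "e \<in> arcs n \<Longrightarrow> \<exists>a b. 2 \<le> a \<and> a < b \<and> b \<le> Suc n \<and> e = {old a, old b}"
proof -
  assume "e \<in> arcs n"
  then obtain i j where ij: "1 \<le> i" "i < j" "j \<le> n" "e = {i, j}" by (auto simp: arcs_def)
  show ?thesis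
  proof (cases "i = 1")
    case True
    then show ?thesis using ij by (intro exI[of _ j] exI[of _ "Suc n"]) (auto simp: old_def)
  next
    case False
    then show ?thesis using ij by (intro exI[of _ i] exI[of _ j]) (auto simp: old_def)
  qed
qed

lemma old_arcs: "2 \<le> a \<Longrightarrow> a < b \<Longrightarrow> b \<le> Suc n \<Longrightarrow> {old a, old b} \<in> arcs n"
proof -
  assume ab: "2 \<le> a" "a < b" "b \<le> Suc n"
  show ?thesis
  proof (cases "b = Suc n")
    case True
    then have "{old a, old b} = {1, a}" using ab by (auto simp: old_def)
    then show ?thesis using ab True unfolding arcs_def by force
  next
    case False
    then show ?thesis using ab unfolding arcs_def old_def by force
  qed
qed

sublocale chords "Suc n" D
proof
  show "5 \<le> Suc n" using n_ge by simp
  show "2 \<le> a \<and> a < b \<and> b \<le> Suc n" if "(a, b) \<in> D" for a b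
    using that by (auto simp: D_def)
  show "d \<le> b" if "(a, b) \<in> D" "(c, d) \<in> D" "a < c" "c < b" for a b c d
    using that crossing_old[of a c b d] \<Delta>_nc by (force simp: D_def)
  show "(a, b) \<in> D" if ab: "2 \<le> a" "a < b" "b \<le> Suc n"
    and nc: "\<And>c d. (c, d) \<in> D \<Longrightarrow> \<not> (a < c \<and> c < b \<and> b < d) \<and> \<not> (c < a \<and> a < d \<and> d < b)" for a b
  proof -
    have "{old a, old b} \<in> \<Delta>"
    proof (rule \<Delta>_max[OF old_arcs[OF ab]])
      fix e assume e: "e \<in> \<Delta>"
      then obtain c d where cd: "2 \<le> c" "c < d" "d \<le> Suc n" "e = {old c, old d}"
        using arcs_old \<Delta>_arcs by blast
      then show "\<not> crossing {old a, old b} e"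
        using crossing_oldD[of a b c d] ab nc[of c d] e by (auto simp: D_def)
    qed
    then show ?thesis using ab by (simp add: D_def)
  qed
qed

lemma D_iff: "2 \<le> a \<Longrightarrow> a < b \<Longrightarrow> b \<le> Suc n \<Longrightarrow> (a, b) \<in> D \<longleftrightarrow> {old a, old b} \<in> \<Delta>"
  by (simp add: D_def)

definition arc :: "nat \<times> nat \<Rightarrow> nat set" where "arc p = {old (fst p), old (snd p)}"

lemma arc_inj: "inj_on arc D"
  by (rule inj_onI) (auto simp: arc_def doubleton_eq_iff old_inj dest!: D_range)

lemma arc_image: "arc ` D = \<Delta>"
proof
  show "arc ` D \<subseteq> \<Delta>" by (auto simp: arc_def D_def)
  show "\<Delta> \<subseteq> arc ` D"
  proof
    fix e assume e: "e \<in> \<Delta>"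
    then obtain a b where "2 \<le> a" "a < b" "b \<le> Suc n" "e = {old a, old b}"
      using arcs_old \<Delta>_arcs by blast
    then show "e \<in> arc ` D" using e by (intro image_eqI[of _ _ "(a, b)"]) (auto simp: arc_def D_def)
  qed
qed

definition tri :: "nat \<Rightarrow> nat set" where
  "tri c = {old (lft c), old c, old (rgt c)}"

text \<open>A triangle containing 1 has the relabelled corners j < k < n + 1, so its apex is its
  largest old label; for all others it is the middle one.\<close>

lemma triangles_eq: "triangles \<Delta> = tri ` {2<..<Suc n}"
proof
  show "triangles \<Delta> \<subseteq> tri ` {2<..<Suc n}"
  proof
    fix t assume "t \<in> triangles \<Delta>"
    then obtain i j k where ijk: "i < j" "j < k" "{i, j} \<in> \<Delta>" "{j, k} \<in> \<Delta>" "{i, k} \<in> \<Delta>" "t = {i, j, k}"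
      by (auto simp: triangles_def)
    have rng: "1 \<le> i" "k \<le> n" using ijk \<Delta>_arcs by (force simp: arcs_def doubleton_eq_iff)+
    show "t \<in> tri ` {2<..<Suc n}"
    proof (cases "i = 1")
      case True
      have "(j, Suc n) \<in> D" "(j, k) \<in> D" "(k, Suc n) \<in> D"
        using True ijk rng by (auto simp: D_def old_def insert_commute)
      from base_eqI[OF this] show ?thesis using True ijk rng
        by (intro image_eqI[of _ _ k]) (auto simp: tri_def old_def)
    next
      case False
      have "(i, k) \<in> D" "(i, j) \<in> D" "(j, k) \<in> D"
        using False ijk rng by (auto simp: D_def old_def)
      from base_eqI[OF this] show ?thesis using False ijk rng
        by (intro image_eqI[of _ _ j]) (auto simp: tri_def old_def)
    qed
  qed
  show "tri ` {2<..<Suc n} \<subseteq> triangles \<Delta>"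
  proof
    fix t assume "t \<in> tri ` {2<..<Suc n}"
    then obtain c where c: "2 < c" "c < Suc n" "t = tri c" by auto
    note b = base[OF c(1,2)] base_bounds[OF c(1,2)]
    then have \<Delta>: "{old (lft c), old (rgt c)} \<in> \<Delta>" "{old (lft c), old c} \<in> \<Delta>" "{old c, old (rgt c)} \<in> \<Delta>"
      by (auto simp: D_def)
    show "t \<in> triangles \<Delta>"
    proof (cases "rgt c = Suc n")
      case True
      have "t = {1, lft c, c}" using c b True by (auto simp: tri_def old_def)
      then show ?thesis using \<Delta> b c True unfolding triangles_def
        by (intro CollectI exI[of _ 1] exI[of _ "lft c"] exI[of _ c]) (auto simp: old_def insert_commute)
    next
      case False
      have "t = {lft c, c, rgt c}" using c b False by (auto simp: tri_def old_def)
      then show ?thesis using \<Delta> b c False unfolding triangles_def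
        by (intro CollectI exI[of _ "lft c"] exI[of _ c] exI[of _ "rgt c"]) (auto simp: old_def)
    qed
  qed
qed

lemma ccw_old: "2 \<le> a \<Longrightarrow> a < b \<Longrightarrow> b < c \<Longrightarrow> c \<le> Suc n \<Longrightarrow> ccw (old a) (old b) (old c)"
  by (auto simp: ccw_def old_def)

lemma tri_ccw: "2 < c \<Longrightarrow> c < Suc n \<Longrightarrow> ccw (old (lft c)) (old c) (old (rgt c))"
  using base_bounds[of c] by (intro ccw_old) auto

lemma tri_corners:
  assumes "2 < c" "c < Suc n"
  shows "ccw_corner (tri c) (old (lft c)) = old c" "ccw_corner (tri c) (old c) = old (rgt c)"
    "ccw_corner (tri c) (old (rgt c)) = old (lft c)"
    "cw_corner (tri c) (old (lft c)) = old (rgt c)" "cw_corner (tri c) (old c) = old (lft c)"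
    "cw_corner (tri c) (old (rgt c)) = old c"
  using ccw_corners[OF tri_def tri_ccw[OF assms]] by simp_all

lemma trianglesE:
  assumes "t \<in> triangles \<Delta>"
  obtains c where "2 < c" "c < Suc n" "t = tri c"
  using assms by (auto simp: triangles_eq)

lemma triangle_corners:
  assumes "t \<in> triangles \<Delta>" "x \<in> t"
  shows "t = {x, ccw_corner t x, cw_corner t x}" "ccw x (ccw_corner t x) (cw_corner t x)"
    "ccw_corner t x \<in> t" "cw_corner t x \<in> t"
    "cw_corner t (ccw_corner t x) = x" "ccw_corner t (cw_corner t x) = x"
    "cw_corner t (cw_corner t x) = ccw_corner t x" "ccw_corner t (ccw_corner t x) = cw_corner t x"
    "{x, ccw_corner t x} \<in> \<Delta>" "{x, cw_corner t x} \<in> \<Delta>" "1 \<le> x" "x \<le> n"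
proof -
  obtain c where c: "2 < c" "c < Suc n" "t = tri c" using trianglesE[OF assms(1)] .
  note b = base[OF c(1,2)] base_bounds[OF c(1,2)]
  note o = tri_ccw[OF c(1,2)] ccw_rotate[OF tri_ccw[OF c(1,2)]] ccw_rotate[OF ccw_rotate[OF tri_ccw[OF c(1,2)]]]
  have "\<exists>y z. t = {x, y, z} \<and> ccw x y z \<and> {x, y} \<in> \<Delta> \<and> {x, z} \<in> \<Delta> \<and> 1 \<le> x \<and> x \<le> n"
  proof -
    from b have \<Delta>: "{old (lft c), old (rgt c)} \<in> \<Delta>" "{old (lft c), old c} \<in> \<Delta>" "{old c, old (rgt c)} \<in> \<Delta>"
      by (auto simp: D_def)
    from assms(2) consider "x = old (lft c)" | "x = old c" | "x = old (rgt c)" by (auto simp: c tri_def)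
    then show ?thesis
    proof cases
      case 1
      then show ?thesis using o(1) \<Delta> b old_range[of "lft c"]
        by (intro exI[of _ "old c"] exI[of _ "old (rgt c)"]) (auto simp: c tri_def)
    next
      case 2
      then show ?thesis using o(2) \<Delta> b old_range[of c]
        by (intro exI[of _ "old (rgt c)"] exI[of _ "old (lft c)"]) (auto simp: c tri_def insert_commute)
    next
      case 3
      then show ?thesis using o(3) \<Delta> b old_range[of "rgt c"]
        by (intro exI[of _ "old (lft c)"] exI[of _ "old c"]) (auto simp: c tri_def insert_commute)
    qed
  qed
  then obtain y z where yz: "t = {x, y, z}" "ccw x y z" "{x, y} \<in> \<Delta>" "{x, z} \<in> \<Delta>" "1 \<le> x" "x \<le> n" by blast
  note cs = ccw_corners[OF yz(1,2)]
  show "t = {x, ccw_corner t x, cw_corner t x}" "ccw x (ccw_corner t x) (cw_corner t x)"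
    "ccw_corner t x \<in> t" "cw_corner t x \<in> t"
    "cw_corner t (ccw_corner t x) = x" "ccw_corner t (cw_corner t x) = x"
    "cw_corner t (cw_corner t x) = ccw_corner t x" "ccw_corner t (ccw_corner t x) = cw_corner t x"
    "{x, ccw_corner t x} \<in> \<Delta>" "{x, cw_corner t x} \<in> \<Delta>" "1 \<le> x" "x \<le> n"
    unfolding cs using yz by simp_all
qed

text \<open>The apex is the middle one of three ordered corners, hence determined by the set of
  corners.\<close>

lemma tri_inj: "inj_on tri {2<..<Suc n}"
proof (rule inj_onI)
  fix c c' assume c: "c \<in> {2<..<Suc n}" "c' \<in> {2<..<Suc n}" and eq: "tri c = tri c'"
  have b: "2 \<le> lft c" "lft c < c" "c < rgt c" "2 \<le> lft c'" "lft c' < c'" "c' < rgt c'"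
    using base_bounds[of c] base_bounds[of c'] c by auto
  have rng: "2 \<le> lft c" "2 \<le> c" "2 \<le> rgt c" "2 \<le> lft c'" "2 \<le> c'" "2 \<le> rgt c'" using b by auto
  have mem: "x \<in> {lft c, c, rgt c}" if "old x \<in> tri c" "2 \<le> x" for x
    using that rng by (auto simp: tri_def old_inj)
  have "lft c' \<in> {lft c, c, rgt c}" "c' \<in> {lft c, c, rgt c}" "rgt c' \<in> {lft c, c, rgt c}"
    by (rule mem, simp add: eq, simp add: tri_def, simp add: rng)+
  then have "lft c' = lft c \<or> lft c' = c \<or> lft c' = rgt c" "c' = lft c \<or> c' = c \<or> c' = rgt c"
    "rgt c' = lft c \<or> rgt c' = c \<or> rgt c' = rgt c" by simp_all
  then show "c = c'" using b by linarith
qed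

lemma tri_eq_iff: "2 < c \<Longrightarrow> c < Suc n \<Longrightarrow> 2 < d \<Longrightarrow> d < Suc n \<Longrightarrow> tri c = tri d \<longleftrightarrow> c = d"
  using tri_inj by (auto simp: inj_on_def)

section \<open>Boundary arcs, the triangle on the right of an arc, and ears\<close>

lemma csucc_old: "2 \<le> v \<Longrightarrow> v \<le> Suc n \<Longrightarrow> csucc n (old v) = old (if v = Suc n then 2 else Suc v)"
  using n_ge by (auto simp: csucc_def old_def)

lemma cpred_old: "2 \<le> v \<Longrightarrow> v \<le> Suc n \<Longrightarrow> cpred n (old v) = old (if v = 2 then Suc n else v - 1)"
  using n_ge by (auto simp: cpred_def old_def)

lemma csucc_cpred: "1 \<le> m \<Longrightarrow> m \<le> n \<Longrightarrow> csucc n (cpred n m) = m" "1 \<le> m \<Longrightarrow> m \<le> n \<Longrightarrow> cpred n (csucc n m) = m"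
  "1 \<le> m \<Longrightarrow> m \<le> n \<Longrightarrow> 1 \<le> csucc n m \<and> csucc n m \<le> n" "1 \<le> m \<Longrightarrow> m \<le> n \<Longrightarrow> 1 \<le> cpred n m \<and> cpred n m \<le> n"
  "1 \<le> m \<Longrightarrow> m \<le> n \<Longrightarrow> csucc n m \<noteq> cpred n m" "1 \<le> m \<Longrightarrow> m \<le> n \<Longrightarrow> csucc n m \<noteq> m"
  "1 \<le> m \<Longrightarrow> m \<le> n \<Longrightarrow> cpred n m \<noteq> m"
  using n_ge by (auto simp: csucc_def cpred_def)

lemma boundary_arcsI: "1 \<le> m \<Longrightarrow> m \<le> n \<Longrightarrow> {m, csucc n m} \<in> boundary_arcs n"
  by (auto simp: boundary_arcs_def)

lemma boundary_arc_old:
  assumes "2 \<le> a" "a < b" "b \<le> Suc n"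
  shows "{old a, old b} \<in> boundary_arcs n \<longleftrightarrow> b = Suc a \<or> (a, b) = (2, Suc n)"
proof
  assume "{old a, old b} \<in> boundary_arcs n"
  then obtain i where i: "1 \<le> i" "i \<le> n" "{old a, old b} = {i, csucc n i}" by (auto simp: boundary_arcs_def)
  obtain v where v: "2 \<le> v" "v \<le> Suc n" "i = old v" using old_surj i by blast
  show "b = Suc a \<or> (a, b) = (2, Suc n)"
    using i(3) v assms by (auto simp: csucc_old doubleton_eq_iff old_inj split: if_splits)
next
  assume "b = Suc a \<or> (a, b) = (2, Suc n)"
  then show "{old a, old b} \<in> boundary_arcs n"
  proof
    assume "b = Suc a"
    then have "{old a, old b} = {old a, csucc n (old a)}" using assms by (simp add: csucc_old)
    then show ?thesis using boundary_arcsI[of "old a"] old_range[of a] assms by simp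
  next
    assume "(a, b) = (2, Suc n)"
    then have "{old a, old b} = {old (Suc n), csucc n (old (Suc n))}" using n_ge by (auto simp: csucc_old)
    then show ?thesis using boundary_arcsI[of "old (Suc n)"] old_range[of "Suc n"] n_ge by simp
  qed
qed

lemma boundary_arcs_\<Delta>: "1 \<le> m \<Longrightarrow> m \<le> n \<Longrightarrow> {m, csucc n m} \<in> \<Delta>" "1 \<le> m \<Longrightarrow> m \<le> n \<Longrightarrow> {cpred n m, m} \<in> \<Delta>"
proof -
  show *: "{m, csucc n m} \<in> \<Delta>" if m: "1 \<le> m" "m \<le> n" for m
  proof -
    obtain v where v: "2 \<le> v" "v \<le> Suc n" "m = old v" using old_surj m by blast
    show ?thesis
      using side_in_D[of v] root_in_D v by (cases "v = Suc n") (auto simp: csucc_old D_def insert_commute)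
  qed
  show "{cpred n m, m} \<in> \<Delta>" if "1 \<le> m" "m \<le> n"
    using *[of "cpred n m"] csucc_cpred[of m] that by simp
qed

text \<open>\<open>cw_corner t x = y\<close> says that \<open>t\<close> lies to the right of the chord from \<open>x\<close> to \<open>y\<close>.\<close>

lemma right_triangle_ex1:
  assumes e: "{x, y} \<in> \<Delta>" and y: "y \<noteq> csucc n x"
  shows "\<exists>!t. t \<in> triangles \<Delta> \<and> x \<in> t \<and> cw_corner t x = y"
proof -
  obtain a b where ab: "2 \<le> a" "a \<le> Suc n" "2 \<le> b" "b \<le> Suc n" "x = old a" "y = old b" "a \<noteq> b"
  proof -
    obtain p where p: "p \<in> D" "{x, y} = arc p" using e arc_image by blast
    obtain a b where "p = (a, b)" by (cases p)
    then show thesis using that[of a b] that[of b a] p D_range[of a b] by (auto simp: arc_def doubleton_eq_iff)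
  qed
  have mem: "old c \<in> tri d \<longleftrightarrow> c = lft d \<or> c = d \<or> c = rgt d" if "2 \<le> c" "2 < d" "d < Suc n" for c d
    using that base_bounds[of d] by (auto simp: tri_def old_inj)
  have cw: "old a \<in> tri d \<and> cw_corner (tri d) (old a) = old b \<longleftrightarrow>
      (a = lft d \<and> b = rgt d) \<or> (a = d \<and> b = lft d) \<or> (a = rgt d \<and> b = d)" if d: "2 < d" "d < Suc n" for d
    using base_bounds[OF d] ab tri_corners[OF d] d mem[of a d] by (auto simp: old_inj)
  \<comment> \<open>To the right of a chord traversed upwards lies the triangle below it, given by
    \<open>apex_base\<close>; traversed downwards, the triangle above it, given by
    \<open>upper_ex\<close>. The assumption on \<open>csucc\<close> excludes the sides in the first
    case and the chord \<open>(2, Suc n)\<close> in the second.\<close>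
  have "\<exists>!d. 2 < d \<and> d < Suc n \<and> ((a = lft d \<and> b = rgt d) \<or> (a = d \<and> b = lft d) \<or> (a = rgt d \<and> b = d))"
  proof (cases "a < b")
    case True
    then have D: "(a, b) \<in> D" using e ab by (simp add: D_iff)
    have "b \<noteq> Suc a" using y ab by (auto simp: csucc_old)
    then obtain c where c: "2 < c" "c < Suc n" "lft c = a" "rgt c = b" using apex_base[OF D] True by auto
    show ?thesis
    proof (rule ex1I[of _ c])
      fix d assume "2 < d \<and> d < Suc n \<and> ((a = lft d \<and> b = rgt d) \<or> (a = d \<and> b = lft d) \<or> (a = rgt d \<and> b = d))"
      then show "d = c" using base_inj[of c d] base_bounds[of d] c True by auto
    qed (use c in auto)
  next
    case False
    then have D: "(b, a) \<in> D" using e ab by (simp add: D_iff insert_commute)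
    have "(b, a) \<noteq> (2, Suc n)" using y ab by (auto simp: csucc_old)
    then have u: "(2 < b \<and> rgt b = a) \<or> (a < Suc n \<and> lft a = b)" using upper_ex[OF D] by auto
    have lt: "b < a" using False ab by simp
    obtain c where c: "2 < c" "c < Suc n" "(a = c \<and> b = lft c) \<or> (a = rgt c \<and> b = c)"
    proof (cases "2 < b \<and> rgt b = a")
      case True
      then show ?thesis using that[of b] lt ab by auto
    next
      case False
      then have "a < Suc n" "lft a = b" using u by blast+
      then show ?thesis using that[of a] lt ab by simp
    qed
    show ?thesis
    proof (rule ex1I[of _ c])
      fix d assume "2 < d \<and> d < Suc n \<and> ((a = lft d \<and> b = rgt d) \<or> (a = d \<and> b = lft d) \<or> (a = rgt d \<and> b = d))"
      then have d: "2 < d" "d < Suc n" "(a = lft d \<and> b = rgt d) \<or> (a = d \<and> b = lft d) \<or> (a = rgt d \<and> b = d)" by simp_all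
      with base_bounds[OF d(1,2)] lt have "(a = d \<and> b = lft d) \<or> (a = rgt d \<and> b = d)" by linarith
      moreover have "\<not> (a = d \<and> b = lft d \<and> a = rgt c \<and> b = c)"
        using upper_not_both[of b a] c(1,2) d(1,2) by auto
      moreover have "\<not> (a = c \<and> b = lft c \<and> a = rgt d \<and> b = d)"
        using upper_not_both[of b a] c(1,2) d(1,2) by auto
      ultimately show "d = c" using c(3) by blast
    qed (use c in auto)
  qed
  then obtain d where d0: "2 < d \<and> d < Suc n \<and> ((a = lft d \<and> b = rgt d) \<or> (a = d \<and> b = lft d) \<or> (a = rgt d \<and> b = d))"
    and uniq0: "\<And>d'. 2 < d' \<and> d' < Suc n \<and> ((a = lft d' \<and> b = rgt d') \<or> (a = d' \<and> b = lft d') \<or> (a = rgt d' \<and> b = d')) \<Longrightarrow> d' = d"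
    by (elim ex1E) blast
  have d: "2 < d" "d < Suc n" "old a \<in> tri d \<and> cw_corner (tri d) (old a) = old b"
    using d0 cw[of d] by blast+
  have uniq: "d' = d" if "2 < d'" "d' < Suc n" "old a \<in> tri d' \<and> cw_corner (tri d') (old a) = old b" for d'
    using uniq0[of d'] cw[of d'] that by blast
  show ?thesis
    unfolding ab(5,6) triangles_eq
  proof (rule ex1I[of _ "tri d"])
    show "tri d \<in> tri ` {2<..<Suc n} \<and> old a \<in> tri d \<and> cw_corner (tri d) (old a) = old b"
      using d by simp
    fix t assume t: "t \<in> tri ` {2<..<Suc n} \<and> old a \<in> t \<and> cw_corner t (old a) = old b"
    then obtain d' where "2 < d'" "d' < Suc n" "t = tri d'" by (auto simp del: mem)
    then show "t = tri d" using t uniq[of d'] by simp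
  qed
qed

lemma two_corners:
  assumes "t \<in> triangles \<Delta>" "x \<in> t" "y \<in> t" "x \<noteq> y"
  shows "cw_corner t x = y \<or> cw_corner t y = x"
proof -
  have "y \<in> {x, ccw_corner t x, cw_corner t x}"
    using triangle_corners(1)[OF assms(1,2)] assms(3) by blast
  then show ?thesis using assms(4) triangle_corners(5)[OF assms(1,2)] by auto
qed

text \<open>In counterclockwise order the third corner would have to lie between \<open>x\<close>
  and its neighbour.\<close>

lemma no_right_triangle:
  assumes "t \<in> triangles \<Delta>" "x \<in> t"
  shows "cw_corner t x \<noteq> csucc n x"
proof
  assume "cw_corner t x = csucc n x"
  moreover have "ccw_corner t x \<in> t" using triangle_corners[OF assms] by simp
  then have "1 \<le> ccw_corner t x \<and> ccw_corner t x \<le> n" using triangle_corners(11,12)[OF assms(1)] by auto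
  ultimately show False
    using triangle_corners(2)[OF assms] triangle_corners(11,12)[OF assms] by (auto simp: ccw_def csucc_def split: if_splits)
qed

lemma boundary_arc_neighbour:
  assumes "{m, y} \<in> boundary_arcs n"
  shows "y = csucc n m \<or> y = cpred n m"
proof -
  obtain i where i: "1 \<le> i" "i \<le> n" "{m, y} = {i, csucc n i}"
    using assms by (auto simp: boundary_arcs_def)
  then show ?thesis using csucc_cpred(2)[of i] by (auto simp: doubleton_eq_iff)
qed

text \<open>The ears of the triangulation, that is, the marked points coloured black.\<close>

definition tip :: "nat \<Rightarrow> bool" where
  "tip m \<longleftrightarrow> 1 \<le> m \<and> m \<le> n \<and> (\<forall>e \<in> \<Delta> - boundary_arcs n. m \<notin> e)"

lemma tip_corners:
  assumes "tip m" "t \<in> triangles \<Delta>" "m \<in> t"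
  shows "ccw_corner t m = csucc n m" "cw_corner t m = cpred n m"
proof -
  have m: "1 \<le> m" "m \<le> n" using assms(1) by (auto simp: tip_def)
  note tc = triangle_corners[OF assms(2,3)]
  have "{m, ccw_corner t m} \<in> boundary_arcs n" "{m, cw_corner t m} \<in> boundary_arcs n"
    using tc(9,10) assms(1) by (auto simp: tip_def)
  then have *: "ccw_corner t m = csucc n m \<or> ccw_corner t m = cpred n m" "cw_corner t m = csucc n m \<or> cw_corner t m = cpred n m"
    by (auto dest: boundary_arc_neighbour)
  then show "cw_corner t m = cpred n m" using no_right_triangle[OF assms(2,3)] by auto
  then show "ccw_corner t m = csucc n m" using * tc(2) by (auto simp: ccw_def)
qed

lemma triangle_at: "1 \<le> m \<Longrightarrow> m \<le> n \<Longrightarrow> \<exists>!t. t \<in> triangles \<Delta> \<and> m \<in> t \<and> cw_corner t m = cpred n m"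
  using boundary_arcs_\<Delta>(2)[of m] csucc_cpred(5)[of m]
  by (intro right_triangle_ex1) (auto simp: insert_commute)

lemma tip_unique: "tip m \<Longrightarrow> t \<in> triangles \<Delta> \<Longrightarrow> m \<in> t \<Longrightarrow> t' \<in> triangles \<Delta> \<Longrightarrow> m \<in> t' \<Longrightarrow> t = t'"
  using triangle_at[of m] tip_corners by (metis tip_def)

text \<open>Two ears in one triangle would put all its sides on the boundary and force n = 3. So a
  triangle is merged with at most one marked point.\<close>

lemma tip_one:
  assumes "tip m" "t \<in> triangles \<Delta>" "m \<in> t" "tip m'" "m' \<in> t"
  shows "m = m'"
proof (rule ccontr)
  assume "m \<noteq> m'"
  have m: "1 \<le> m" "m \<le> n" using assms(1) by (auto simp: tip_def)
  have c: "ccw_corner t m = csucc n m" "cw_corner t m = cpred n m" using tip_corners[OF assms(1-3)] by simp_all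
  have c': "ccw_corner t m' = csucc n m'" "cw_corner t m' = cpred n m'" using tip_corners[OF assms(4,2,5)] by simp_all
  have "m' = csucc n m \<or> m' = cpred n m"
    using two_corners[OF assms(2,3,5) \<open>m \<noteq> m'\<close>] c c' triangle_corners(5,6)[OF assms(2,5)] by auto
  then show False
  proof
    assume "m' = csucc n m"
    then show False using triangle_corners(8)[OF assms(2,3)] c c' m n_ge
      by (auto simp: csucc_def cpred_def split: if_splits)
  next
    assume "m' = cpred n m"
    then show False using triangle_corners(7)[OF assms(2,3)] c c' m n_ge
      by (auto simp: csucc_def cpred_def split: if_splits)
  qed
qed

definition Diag :: "(nat \<times> nat) set" where
  "Diag = {e \<in> D. snd e \<noteq> Suc (fst e) \<and> e \<noteq> (2, Suc n)}"

lemma finite_Diag: "finite Diag"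
  using finite_D by (simp add: Diag_def)

end

section \<open>Vertices and faces of the plabic graph\<close>

lemma orbit_eq_if_mem:
  assumes "c \<in> orbit f c" "d \<in> orbit f c"
  shows "orbit f d = orbit f c"
proof -
  have "c \<in> orbit f d" using orbit_swap[OF assms] .
  then show ?thesis using assms(2) orbit_trans by fast
qed

context disk
begin

abbreviation U :: "(vertex \<times> vertex, vertex) disk_graph" where "U \<equiv> uncontracted_graph n \<Delta>"
abbreviation G :: "(vertex \<times> vertex, vertex set) disk_graph" where "G \<equiv> plabic_graph n \<Delta>"

lemma U_simps [simp]:
  "opp U = prod.swap" "org U = fst" "rot U = triangulation_rot n \<Delta>" "col U = vertex_colour n \<Delta>"
  "bdry U = Boundary" "dest U d = snd d"
  by (simp_all add: uncontracted_graph_def dest_def Let_def)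

lemma darts_U: "d \<in> darts U \<longleftrightarrow>
    (\<exists>t m. t \<in> triangles \<Delta> \<and> m \<in> t \<and> (d = (Centre t, Marked m) \<or> d = (Marked m, Centre t))) \<or>
    (\<exists>m. 1 \<le> m \<and> m \<le> n \<and> (d = (Marked m, Boundary m) \<or> d = (Boundary m, Marked m)))"
  by (auto simp: uncontracted_graph_def Let_def)

lemma rim_U: "d \<in> rim U \<longleftrightarrow> (\<exists>m. 1 \<le> m \<and> m \<le> n \<and>
    (d = (Boundary m, Boundary (csucc n m)) \<or> d = (Boundary (csucc n m), Boundary m)))"
  by (auto simp: uncontracted_graph_def Let_def)

lemma vertex_colour_Marked: "1 \<le> m \<Longrightarrow> m \<le> n \<Longrightarrow> vertex_colour n \<Delta> (Marked m) = Some (if tip m then Black else White)"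
  by (auto simp: tip_def)

lemma triangle_range: "t \<in> triangles \<Delta> \<Longrightarrow> m \<in> t \<Longrightarrow> 1 \<le> m \<and> m \<le> n"
  using triangle_corners(11,12) by blast

lemma mono_U: "d \<in> mono_darts U \<longleftrightarrow>
    (\<exists>t m. t \<in> triangles \<Delta> \<and> m \<in> t \<and> tip m \<and> (d = (Centre t, Marked m) \<or> d = (Marked m, Centre t)))"
proof -
  have c: "vertex_colour n \<Delta> (Marked m) = Some (if tip m then Black else White)" if "t \<in> triangles \<Delta>" "m \<in> t" for t m
    using vertex_colour_Marked triangle_range[OF that] by blast
  show ?thesis
    unfolding mono_darts_def mem_Collect_eq darts_U
    by (auto simp: c simp del: vertex_colour.simps(2) split: if_splits)
qed

text \<open>The tips are the black marked points; each is merged with its only triangle. So \<open>kap\<close> picks a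
  representative of every merged vertex.\<close>

definition kap :: "vertex \<Rightarrow> vertex" where
  "kap v = (case v of Marked m \<Rightarrow> (if tip m then Centre (THE t. t \<in> triangles \<Delta> \<and> m \<in> t) else v) | _ \<Rightarrow> v)"

lemma kap_simps [simp]: "kap (Centre t) = Centre t" "kap (Boundary m) = Boundary m"
  "\<not> tip m \<Longrightarrow> kap (Marked m) = Marked m"
  by (simp_all add: kap_def)

lemma kap_tip:
  assumes "tip m" "t \<in> triangles \<Delta>" "m \<in> t"
  shows "kap (Marked m) = Centre t"
proof -
  have "(THE t. t \<in> triangles \<Delta> \<and> m \<in> t) = t"
    by (rule the_equality) (use assms tip_unique in blast)+
  then show ?thesis using assms by (simp add: kap_def)
qed

lemma tip_triangle: "tip m \<Longrightarrow> \<exists>t. t \<in> triangles \<Delta> \<and> m \<in> t"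
  using triangle_at[of m] by (auto simp: tip_def)

text \<open>Contracted darts join an ear to its only triangle and nothing else, so the classes are
  the fibres of \<open>kap\<close>.\<close>

lemma merge_class_U: "merge_class U v = {u. kap v = kap u}"
proof -
  define R where "R = {(org U d, dest U d) | d. d \<in> mono_darts U}"
  have R: "R = {(fst d, snd d) | d. d \<in> mono_darts U}" by (simp add: R_def)
  have kapR: "kap a = kap b" if "(a, b) \<in> R\<^sup>*" for a b
    using that
  proof induction
    case (step y z)
    then obtain d where "d \<in> mono_darts U" "y = fst d" "z = snd d" by (auto simp: R)
    then have "kap y = kap z" by (auto simp: mono_U kap_tip)
    then show ?case using step by simp
  qed simp
  have toR: "(a, kap a) \<in> R\<^sup>* \<and> (kap a, a) \<in> R\<^sup>*" for a
  proof (cases "\<exists>m. a = Marked m \<and> tip m")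
    case True
    then obtain m t where m: "a = Marked m" "tip m" "t \<in> triangles \<Delta>" "m \<in> t" using tip_triangle by blast
    then have "(Marked m, Centre t) \<in> mono_darts U" "(Centre t, Marked m) \<in> mono_darts U" by (auto simp: mono_U)
    then have "(Marked m, Centre t) \<in> R" "(Centre t, Marked m) \<in> R" unfolding R by force+
    then show ?thesis using m kap_tip by auto
  next
    case False
    then have "kap a = a" by (auto simp: kap_def split: vertex.splits)
    then show ?thesis by simp
  qed
  have "(a, b) \<in> R\<^sup>* \<longleftrightarrow> kap a = kap b" for a b
    using kapR toR[of a] toR[of b] by (metis rtrancl_trans)
  then show ?thesis unfolding merge_class_def R_def[symmetric] by simp
qed

lemma merge_iff: "merge_class U u = merge_class U v \<longleftrightarrow> kap u = kap v"
  by (auto simp: merge_class_U)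

lemma vertex_colour_kap: "kap u = kap v \<Longrightarrow> vertex_colour n \<Delta> u = vertex_colour n \<Delta> v"
proof -
  have "vertex_colour n \<Delta> w = vertex_colour n \<Delta> (kap w)" for w
    by (auto simp: kap_def tip_def split: vertex.splits)
  then show "kap u = kap v \<Longrightarrow> vertex_colour n \<Delta> u = vertex_colour n \<Delta> v" by metis
qed

lemma G_simps [simp]:
  "opp G = prod.swap" "org G d = merge_class U (fst d)" "dest G d = merge_class U (snd d)"
  "bdry G m = merge_class U (Boundary m)" "rim G = rim U"
  by (simp_all add: plabic_graph_def contract_mono_def dest_def)

lemma col_G: "col G (merge_class U v) = vertex_colour n \<Delta> v"
proof -
  have "kap v = kap (SOME u. kap v = kap u)" by (rule someI[of "\<lambda>u. kap v = kap u" v]) simp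
  from vertex_colour_kap[OF this] show ?thesis
    by (simp add: plabic_graph_def contract_mono_def merge_class_U)
qed

lemma darts_G: "d \<in> darts G \<longleftrightarrow>
    (\<exists>t m. t \<in> triangles \<Delta> \<and> m \<in> t \<and> \<not> tip m \<and> (d = (Centre t, Marked m) \<or> d = (Marked m, Centre t))) \<or>
    (\<exists>m. 1 \<le> m \<and> m \<le> n \<and> (d = (Marked m, Boundary m) \<or> d = (Boundary m, Marked m)))"
proof -
  have "d \<in> darts G \<longleftrightarrow> d \<in> darts U \<and> d \<notin> mono_darts U"
    by (simp add: plabic_graph_def contract_mono_def)
  moreover obtain a b where "d = (a, b)" by (cases d)
  ultimately show ?thesis
    unfolding darts_U mono_U by (cases a; cases b) (simp_all, blast+)
qed

section \<open>Walks around faces before and after the contraction\<close>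

definition stepU :: "vertex \<times> vertex \<Rightarrow> vertex \<times> vertex" where
  "stepU e = triangulation_rot n \<Delta> (prod.swap e)"

definition stepG :: "vertex \<times> vertex \<Rightarrow> vertex \<times> vertex" where
  "stepG e = rot G (opp G e)"

lemma left_face_G: "left_face G d = orbit stepG d"
  by (simp add: left_face_def stepG_def[abs_def])

lemma stepG_eq: "stepG e = (stepU ^^ (LEAST k. (stepU ^^ k) (stepU e) \<notin> mono_darts U)) (stepU e)"
  by (simp add: stepG_def stepU_def[abs_def] plabic_graph_def contract_mono_def Let_def)

lemma stepG_0: "stepU e \<notin> mono_darts U \<Longrightarrow> stepG e = stepU e"
proof -
  assume "stepU e \<notin> mono_darts U"
  then have "(LEAST k. (stepU ^^ k) (stepU e) \<notin> mono_darts U) = 0" by (intro Least_eq_0) simp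
  then show ?thesis by (simp add: stepG_eq)
qed

text \<open>Contracted darts never follow each other in a face walk, so the \<open>LEAST\<close> is
  0 or 1: after a contracted dart into an ear comes the dart to the boundary vertex, and after one
  out of an ear a dart to a corner that is no ear by \<open>tip_one\<close>.\<close>

lemma stepG_1: "stepU e \<in> mono_darts U \<Longrightarrow> stepU (stepU e) \<notin> mono_darts U \<Longrightarrow> stepG e = stepU (stepU e)"
proof -
  assume a: "stepU e \<in> mono_darts U" "stepU (stepU e) \<notin> mono_darts U"
  have "(LEAST k. (stepU ^^ k) (stepU e) \<notin> mono_darts U) = 1"
  proof (rule Least_equality)
    show "1 \<le> k" if "(stepU ^^ k) (stepU e) \<notin> mono_darts U" for k
      using that a by (cases k) auto
  qed (use a in simp)
  then show ?thesis by (simp add: stepG_eq)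
qed

definition rtri :: "nat \<Rightarrow> nat \<Rightarrow> nat set" where
  "rtri x y = (THE t. t \<in> triangles \<Delta> \<and> x \<in> t \<and> cw_corner t x = y)"

lemma rtri:
  assumes "{x, y} \<in> \<Delta>" "y \<noteq> csucc n x"
  shows "rtri x y \<in> triangles \<Delta>" "x \<in> rtri x y" "cw_corner (rtri x y) x = y"
    "y \<in> rtri x y" "ccw_corner (rtri x y) y = x"
proof -
  have *: "rtri x y \<in> triangles \<Delta> \<and> x \<in> rtri x y \<and> cw_corner (rtri x y) x = y"
    unfolding rtri_def by (rule theI'[OF right_triangle_ex1[OF assms]])
  then show "rtri x y \<in> triangles \<Delta>" "x \<in> rtri x y" "cw_corner (rtri x y) x = y" by blast+
  with triangle_corners(4,6)[of "rtri x y" x] show "y \<in> rtri x y" "ccw_corner (rtri x y) y = x" by auto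
qed

lemma rtri_eqI:
  assumes "t \<in> triangles \<Delta>" "x \<in> t" "cw_corner t x = y"
  shows "t = rtri x y"
proof -
  have "{x, y} \<in> \<Delta>" "y \<noteq> csucc n x"
    using triangle_corners(10)[OF assms(1,2)] no_right_triangle[OF assms(1,2)] assms(3) by auto
  from theI'[OF right_triangle_ex1[OF this]] right_triangle_ex1[OF this] show ?thesis
    using assms unfolding rtri_def by blast
qed

lemma stepU_1: "stepU (Marked x, Centre t) = (Centre t, Marked (cw_corner t x))"
  by (simp add: stepU_def)

lemma stepU_2:
  assumes "t \<in> triangles \<Delta>" "y \<in> t"
  shows "stepU (Centre t, Marked y) =
    (Marked y, if ccw_corner t y = csucc n y then Boundary y else Centre (rtri y (ccw_corner t y)))"
proof -
  define a where "a = ccw_corner t y"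
  note tc = triangle_corners[OF assms]
  have "(THE t'. t' \<in> triangles \<Delta> \<and> t' \<noteq> t \<and> {y, a} \<subseteq> t') = rtri y a" if a: "a \<noteq> csucc n y"
  proof (rule the_equality)
    note r = rtri[OF tc(9)[folded a_def] a]
    have "cw_corner t y \<noteq> a" using tc(2) by (auto simp: a_def ccw_def)
    then show "rtri y a \<in> triangles \<Delta> \<and> rtri y a \<noteq> t \<and> {y, a} \<subseteq> rtri y a" using r by auto
    fix t' assume t': "t' \<in> triangles \<Delta> \<and> t' \<noteq> t \<and> {y, a} \<subseteq> t'"
    have "y \<noteq> a" using tc(2) by (auto simp: a_def ccw_def)
    then consider "cw_corner t' y = a" | "cw_corner t' a = y" using two_corners[of t' y a] t' by auto
    then show "t' = rtri y a"
    proof cases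
      case 1
      then show ?thesis using t' rtri_eqI[of t' y a] by simp
    next
      case 2
      then have "t' = rtri a y" using t' rtri_eqI[of t' a y] by simp
      moreover have "t = rtri a y" using tc(3,5) assms(1) rtri_eqI[of t a y] by (simp add: a_def)
      ultimately show ?thesis using t' by simp
    qed
  qed
  then show ?thesis by (simp add: stepU_def Let_def a_def[symmetric])
qed

lemma stepU_3: "stepU (Marked y, Boundary y) = (Boundary y, Boundary (csucc n y))"
  by (simp add: stepU_def)

lemma stepU_4: "1 \<le> y \<Longrightarrow> y \<le> n \<Longrightarrow> stepU (Boundary y, Boundary (csucc n y)) = (Boundary (csucc n y), Marked (csucc n y))"
  using n_ge by (auto simp: stepU_def csucc_def)

lemma stepU_4': "stepU (Boundary (csucc n y), Boundary y) = (Boundary y, Boundary (cpred n y))"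
  by (simp add: stepU_def)

lemma stepU_5:
  assumes "1 \<le> z" "z \<le> n"
  shows "stepU (Boundary z, Marked z) = (Marked z, Centre (rtri z (cpred n z)))"
proof -
  have \<Delta>: "{z, cpred n z} \<in> \<Delta>" "cpred n z \<noteq> csucc n z"
    using boundary_arcs_\<Delta>(2)[OF assms] csucc_cpred(5)[OF assms] by (auto simp: insert_commute)
  note r = rtri[OF this]
  have "(THE t. t \<in> triangles \<Delta> \<and> {cpred n z, z} \<subseteq> t) = rtri z (cpred n z)"
  proof (rule the_equality)
    show "rtri z (cpred n z) \<in> triangles \<Delta> \<and> {cpred n z, z} \<subseteq> rtri z (cpred n z)" using r by simp
    fix t assume t: "t \<in> triangles \<Delta> \<and> {cpred n z, z} \<subseteq> t"
    have "cw_corner t (cpred n z) \<noteq> z"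
      using no_right_triangle[of t "cpred n z"] t csucc_cpred(1)[OF assms] by auto
    then have "cw_corner t z = cpred n z"
      using two_corners[of t z "cpred n z"] t csucc_cpred(7)[OF assms] by auto
    then show "t = rtri z (cpred n z)" using t rtri_eqI[of t z] by simp
  qed
  then show ?thesis by (simp add: stepU_def)
qed

lemma not_mono [simp]: "(Boundary y, v) \<notin> mono_darts U" "(v, Boundary y) \<notin> mono_darts U"
  "\<not> tip y \<Longrightarrow> (Marked y, v) \<notin> mono_darts U" "\<not> tip y \<Longrightarrow> (v, Marked y) \<notin> mono_darts U"
  by (auto simp: mono_U)

lemma stepG_MC:
  assumes "t \<in> triangles \<Delta>" "x \<in> t"
  shows "stepG (Marked x, Centre t) =
    (if tip (cw_corner t x) then (Marked (cw_corner t x), Boundary (cw_corner t x)) else (Centre t, Marked (cw_corner t x)))"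
proof (cases "tip (cw_corner t x)")
  case True
  let ?y = "cw_corner t x"
  have y: "?y \<in> t" using triangle_corners[OF assms] by simp
  have "stepU (stepU (Marked x, Centre t)) = (Marked ?y, Boundary ?y)"
    using stepU_2[OF assms(1) y] tip_corners[OF True assms(1) y] by (simp add: stepU_1)
  moreover have "stepU (Marked x, Centre t) \<in> mono_darts U" using True assms(1) y by (auto simp: stepU_1 mono_U)
  ultimately show ?thesis using True stepG_1[of "(Marked x, Centre t)"] by simp
qed (use stepG_0[of "(Marked x, Centre t)"] stepU_1 in simp)

lemma stepG_CM:
  assumes "t \<in> triangles \<Delta>" "y \<in> t" "\<not> tip y"
  shows "stepG (Centre t, Marked y) =
    (Marked y, if ccw_corner t y = csucc n y then Boundary y else Centre (rtri y (ccw_corner t y)))"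
  using stepG_0[of "(Centre t, Marked y)"] stepU_2[OF assms(1,2)] assms(3) by simp

lemma stepG_MB: "stepG (Marked y, Boundary y) = (Boundary y, Boundary (csucc n y))"
  using stepG_0[of "(Marked y, Boundary y)"] stepU_3 by simp

lemma stepG_BB: "1 \<le> y \<Longrightarrow> y \<le> n \<Longrightarrow> stepG (Boundary y, Boundary (csucc n y)) = (Boundary (csucc n y), Marked (csucc n y))"
  using stepG_0[of "(Boundary y, Boundary (csucc n y))"] stepU_4 by simp

lemma stepG_BB': "stepG (Boundary (csucc n y), Boundary y) = (Boundary y, Boundary (cpred n y))"
  using stepG_0[of "(Boundary (csucc n y), Boundary y)"] stepU_4' by simp

lemma stepG_BM:
  assumes "1 \<le> z" "z \<le> n"
  defines "t \<equiv> rtri z (cpred n z)"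
  shows "stepG (Boundary z, Marked z) = (if tip z then (Centre t, Marked (cpred n z)) else (Marked z, Centre t))"
proof (cases "tip z")
  case True
  have \<Delta>: "{z, cpred n z} \<in> \<Delta>" "cpred n z \<noteq> csucc n z"
    using boundary_arcs_\<Delta>(2)[OF assms(1,2)] csucc_cpred(5)[OF assms(1,2)] by (auto simp: insert_commute)
  note r = rtri[OF this, folded t_def]
  have nt: "\<not> tip (cpred n z)" using tip_one[OF True r(1,2) _ r(4)] csucc_cpred(7)[OF assms(1,2)] by auto
  have s: "stepU (Boundary z, Marked z) = (Marked z, Centre t)" using stepU_5[OF assms(1,2)] by (simp add: t_def)
  then have "stepU (Boundary z, Marked z) \<in> mono_darts U" using True r by (auto simp: mono_U)
  then show ?thesis using True s nt r(3) stepG_1[of "(Boundary z, Marked z)"] by (simp add: stepU_1)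
qed (use stepG_0[of "(Boundary z, Marked z)"] stepU_5[OF assms(1,2)] t_def in simp)

text \<open>Each face inside the disk contains one arc of the triangulation; the clauses name the
  arc in the face to the left of a dart. The clause for two boundary vertices extends this to the
  rim darts that have the interior on their left.\<close>

fun dart_arc :: "vertex \<times> vertex \<Rightarrow> nat set" where
  "dart_arc (Centre t, Marked b) = {b, ccw_corner t b}"
| "dart_arc (Marked a, Centre t) = {a, cw_corner t a}"
| "dart_arc (Marked m, Boundary _) = {m, csucc n m}"
| "dart_arc (Boundary m, Marked _) = {cpred n m, m}"
| "dart_arc (Boundary m, Boundary k) = {m, k}"
| "dart_arc _ = {}"

lemma dart_arc_in_\<Delta>: "d \<in> darts G \<Longrightarrow> dart_arc d \<in> \<Delta>"
  unfolding darts_G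
  by (elim disjE exE conjE) (simp_all add: triangle_corners boundary_arcs_\<Delta>[unfolded One_nat_def])

text \<open>The left face of a dart is determined by the arc of the triangulation that it contains:
  four darts run around an arc inside the disk, and at most five around an arc on the boundary.\<close>

lemma face_internal:
  assumes e: "{x, y} \<in> \<Delta> - boundary_arcs n"
  defines "t \<equiv> rtri x y" and "t' \<equiv> rtri y x"
  defines "F \<equiv> {(Marked x, Centre t), (Centre t, Marked y), (Marked y, Centre t'), (Centre t', Marked x)}"
  shows "d \<in> F \<Longrightarrow> orbit stepG d = F"
    and "d \<in> darts G \<Longrightarrow> dart_arc d = {x, y} \<Longrightarrow> d \<in> F"
    and "(Marked x, Centre t) \<in> darts G \<and> dart_arc (Marked x, Centre t) = {x, y}"
proof -
  have "{x, y} \<in> arcs n" using e \<Delta>_arcs by auto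
  then have xy: "1 \<le> x" "x \<le> n" "1 \<le> y" "y \<le> n" "x \<noteq> y"
    by (auto simp: arcs_def doubleton_eq_iff)
  have sx: "y \<noteq> csucc n x" using e boundary_arcsI[of x] xy by auto
  have sy: "x \<noteq> csucc n y" using e boundary_arcsI[of y] xy by (auto simp: insert_commute)
  have \<Delta>: "{x, y} \<in> \<Delta>" "{y, x} \<in> \<Delta>" using e by (auto simp: insert_commute)
  note r = rtri[OF \<Delta>(1) sx, folded t_def] and r' = rtri[OF \<Delta>(2) sy, folded t'_def]
  have nt: "\<not> tip x" "\<not> tip y" using e by (auto simp: tip_def)
  let ?a = "(Marked x, Centre t)" and ?b = "(Centre t, Marked y)" and ?c = "(Marked y, Centre t')" and ?d = "(Centre t', Marked x)"
  have s: "stepG ?a = ?b" "stepG ?b = ?c" "stepG ?c = ?d" "stepG ?d = ?a"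
    using stepG_MC[OF r(1,2)] stepG_CM[OF r(1,4) nt(2)] stepG_MC[OF r'(1,2)] stepG_CM[OF r'(1,4) nt(1)] nt r r' sx sy
    by (simp_all add: t_def t'_def)
  have mem: "?b \<in> orbit stepG ?a" "?c \<in> orbit stepG ?a" "?d \<in> orbit stepG ?a" "?a \<in> orbit stepG ?a"
    using orbit.base[of stepG ?a] orbit.step[of _ stepG ?a] s by metis+
  have "d \<in> F" if "d \<in> orbit stepG ?a" for d
    using that by induction (auto simp: F_def s)
  then have "orbit stepG ?a = F" using mem by (auto simp: F_def)
  then show "d \<in> F \<Longrightarrow> orbit stepG d = F" using orbit_eq_if_mem[of ?a stepG d] mem(4) by simp
  show "(Marked x, Centre t) \<in> darts G \<and> dart_arc (Marked x, Centre t) = {x, y}"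
    using r nt by (auto simp: darts_G)
  assume d: "d \<in> darts G" "dart_arc d = {x, y}"
  have nb: "{x, y} \<noteq> {m, csucc n m}" "{x, y} \<noteq> {cpred n m, m}" if "1 \<le> m" "m \<le> n" for m
  proof -
    have "{m, csucc n m} \<in> boundary_arcs n" "{cpred n m, m} \<in> boundary_arcs n"
      using boundary_arcsI[OF that] boundary_arcsI[of "cpred n m"] csucc_cpred(1,4)[OF that] by simp_all
    then show "{x, y} \<noteq> {m, csucc n m}" "{x, y} \<noteq> {cpred n m, m}" using e by (metis DiffD2)+
  qed
  have MC: "(Marked a, Centre s) \<in> F" if "s \<in> triangles \<Delta>" "a \<in> s" "{a, cw_corner s a} = {x, y}" for s a
  proof -
    have "(a = x \<and> cw_corner s a = y) \<or> (a = y \<and> cw_corner s a = x)" using that(3) by (auto simp: doubleton_eq_iff)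
    then show ?thesis using rtri_eqI[OF that(1,2)] by (auto simp: F_def t_def t'_def)
  qed
  have CM: "(Centre s, Marked a) \<in> F" if "s \<in> triangles \<Delta>" "a \<in> s" "{a, ccw_corner s a} = {x, y}" for s a
  proof -
    have "(a = x \<and> ccw_corner s a = y) \<or> (a = y \<and> ccw_corner s a = x)" using that(3) by (auto simp: doubleton_eq_iff)
    then show ?thesis using rtri_eqI[OF that(1), of "ccw_corner s a" a] triangle_corners(3,5)[OF that(1,2)]
      by (auto simp: F_def t_def t'_def)
  qed
  show "d \<in> F"
    using d(1) unfolding darts_G
  proof (elim disjE exE conjE)
    show "d \<in> F" if "1 \<le> m" "m \<le> n" "d = (Marked m, Boundary m)" for m using nb[OF that(1,2)] that(3) d(2) by simp
    show "d \<in> F" if "1 \<le> m" "m \<le> n" "d = (Boundary m, Marked m)" for m using nb[OF that(1,2)] that(3) d(2) by simp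
  qed (use d(2) MC CM in simp_all)
qed

lemma face_boundary:
  assumes x: "1 \<le> x" "x \<le> n"
  defines "y \<equiv> csucc n x"
  defines "c \<equiv> (Boundary x, Boundary y)"
  shows "c \<in> orbit stepG c"
    and "d \<in> darts G \<Longrightarrow> dart_arc d = {x, y} \<Longrightarrow> d \<in> orbit stepG c"
proof -
  have y: "1 \<le> y" "y \<le> n" "cpred n y = x" "x \<noteq> y" "x \<noteq> csucc n y"
    using csucc_cpred[OF x] csucc_cpred[of y] n_ge by (auto simp: y_def csucc_def split: if_splits)
  have \<Delta>: "{y, x} \<in> \<Delta>" using boundary_arcs_\<Delta>(1)[OF x] by (simp add: y_def insert_commute)
  define t where "t = rtri y x"
  note r = rtri[OF \<Delta> y(5), folded t_def]
  let ?O = "orbit stepG c"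
  have 1: "(Boundary y, Marked y) \<in> ?O"
    using orbit.base[of stepG c] stepG_BB[OF x] by (simp add: c_def y_def)
  have sBM: "stepG (Boundary y, Marked y) = (if tip y then (Centre t, Marked x) else (Marked y, Centre t))"
    using stepG_BM[OF y(1,2)] by (simp add: y(3) t_def)
  have sMC: "stepG (Marked y, Centre t) = (if tip x then (Marked x, Boundary x) else (Centre t, Marked x))"
    using stepG_MC[OF r(1,2)] r(3) by simp
  have 2: "(Marked y, Centre t) \<in> ?O" if "\<not> tip y"
    using orbit.step[OF 1] sBM that by simp
  have 3: "(Centre t, Marked x) \<in> ?O" if "\<not> tip x"
    using orbit.step[OF 1] sBM orbit.step[OF 2] sMC that by (cases "tip y") simp_all
  have 4: "(Marked x, Boundary x) \<in> ?O"
  proof (cases "tip x")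
    case True
    then have "\<not> tip y" using tip_one[OF _ r(1,4) _ r(2)] y(4) by blast
    then show ?thesis using orbit.step[OF 2] sMC True by simp
  next
    case False
    then show ?thesis using orbit.step[OF 3[OF False]] stepG_CM[OF r(1,4) False] r(5) by (simp add: y_def)
  qed
  show 5: "c \<in> ?O" using orbit.step[OF 4] stepG_MB[of x] by (simp add: c_def y_def)
  assume d: "d \<in> darts G" "dart_arc d = {x, y}"
  have MC: "(Marked a, Centre s) \<in> ?O" if "s \<in> triangles \<Delta>" "a \<in> s" "{a, cw_corner s a} = {x, y}" "\<not> tip a" for s a
  proof -
    have "a = y \<and> cw_corner s a = x"
      using that(3) no_right_triangle[OF that(1,2)] by (auto simp: doubleton_eq_iff y_def)
    then show ?thesis using rtri_eqI[OF that(1,2)] 2 that(4) by (auto simp: t_def)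
  qed
  have CM: "(Centre s, Marked a) \<in> ?O" if "s \<in> triangles \<Delta>" "a \<in> s" "{a, ccw_corner s a} = {x, y}" "\<not> tip a" for s a
  proof -
    note tc = triangle_corners(3,5)[OF that(1,2)]
    have "a = x \<and> ccw_corner s a = y"
      using that(3) no_right_triangle[OF that(1) tc(1)] tc(2) by (auto simp: doubleton_eq_iff y_def)
    then show ?thesis using rtri_eqI[OF that(1), of "ccw_corner s a" a] tc 3 that(4) by (auto simp: t_def)
  qed
  have MB: "(Marked m, Boundary m) \<in> ?O" if "1 \<le> m" "m \<le> n" "{m, csucc n m} = {x, y}" for m
  proof -
    have "m = x" using that(3) y(5) by (auto simp: doubleton_eq_iff)
    then show ?thesis using 4 by simp
  qed
  have BM: "(Boundary m, Marked m) \<in> ?O" if "1 \<le> m" "m \<le> n" "{cpred n m, m} = {x, y}" for m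
  proof -
    have "m = y" using that y(3) csucc_cpred(1)[of m] y(5) by (auto simp: doubleton_eq_iff)
    then show ?thesis using 1 by simp
  qed
  show "d \<in> ?O"
    using d MC CM MB BM unfolding darts_G by (elim disjE exE conjE) simp_all
qed

lemma left_face_cong:
  assumes "d \<in> darts G" "d' \<in> darts G" "dart_arc d = dart_arc d'"
  shows "left_face G d = left_face G d'"
proof (cases "dart_arc d \<in> boundary_arcs n")
  case True
  then obtain x where x: "1 \<le> x" "x \<le> n" "dart_arc d = {x, csucc n x}" by (auto simp: boundary_arcs_def)
  from face_boundary[OF x(1,2)] x assms orbit_eq_if_mem show ?thesis
    unfolding left_face_G by metis
next
  case False
  have "dart_arc d \<in> arcs n" using dart_arc_in_\<Delta>[OF assms(1)] \<Delta>_arcs by blast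
  then obtain x y where "dart_arc d = {x, y}" by (auto simp: arcs_def)
  with False face_internal[of x y] dart_arc_in_\<Delta>[OF assms(1)] assms show ?thesis
    unfolding left_face_G by (metis Diff_iff)
qed

end

section \<open>Faces correspond to arcs\<close>

context disk
begin

definition face_of :: "nat set \<Rightarrow> (vertex \<times> vertex) set" where
  "face_of e = left_face G (SOME d. d \<in> darts G \<and> dart_arc d = e)"

lemma left_face_eq: "d \<in> darts G \<Longrightarrow> left_face G d = face_of (dart_arc d)"
proof -
  assume d: "d \<in> darts G"
  then have "(SOME e. e \<in> darts G \<and> dart_arc e = dart_arc d) \<in> darts G \<and>
      dart_arc (SOME e. e \<in> darts G \<and> dart_arc e = dart_arc d) = dart_arc d"
    by (intro someI[of "\<lambda>e. e \<in> darts G \<and> dart_arc e = dart_arc d" d]) simp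
  with d show ?thesis unfolding face_of_def by (intro left_face_cong) simp_all
qed

lemma face_of_internal:
  assumes e: "{x, y} \<in> \<Delta> - boundary_arcs n"
  shows "face_of {x, y} = {(Marked x, Centre (rtri x y)), (Centre (rtri x y), Marked y),
    (Marked y, Centre (rtri y x)), (Centre (rtri y x), Marked x)}"
  using face_internal[OF e] left_face_eq[of "(Marked x, Centre (rtri x y))"] by (simp add: left_face_G)

lemma \<Delta>_endpoints: "e \<in> \<Delta> \<Longrightarrow> \<exists>x y. e = {x, y}"
  using subsetD[OF \<Delta>_arcs, of e] unfolding arcs_def by blast

lemma dart_of_arc:
  assumes "e \<in> \<Delta>"
  obtains d where "d \<in> darts G" "dart_arc d = e"
proof (cases "e \<in> boundary_arcs n")
  case True
  then obtain x where x: "1 \<le> x" "x \<le> n" "e = {x, csucc n x}" by (auto simp: boundary_arcs_def)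
  then have "(Marked x, Boundary x) \<in> darts G" unfolding darts_G by blast
  then show ?thesis using that[of "(Marked x, Boundary x)"] x by simp
next
  case False
  obtain x y where "e = {x, y}" using \<Delta>_endpoints assms by blast
  then show ?thesis using that face_internal(3)[of x y] False assms by auto
qed

text \<open>Counterclockwise rim darts have the interior on their left. The reversed ones run around
  the outer face, along which \<open>dart_arc\<close> is not constant.\<close>

definition inner_dart :: "vertex \<times> vertex \<Rightarrow> bool" where
  "inner_dart d \<longleftrightarrow> d \<in> darts G \<or> (\<exists>m. 1 \<le> m \<and> m \<le> n \<and> d = (Boundary m, Boundary (csucc n m)))"

text \<open>The arc is an invariant of the face walk, and this distinguishes the faces of different
  arcs.\<close>

lemma stepG_dart_arc:
  assumes "inner_dart d"
  shows "inner_dart (stepG d) \<and> dart_arc (stepG d) = dart_arc d"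
proof -
  have MC: "inner_dart (Marked m, Centre t)" "inner_dart (Centre t, Marked m)" if "t \<in> triangles \<Delta>" "m \<in> t" "\<not> tip m" for m t
    using that unfolding inner_dart_def darts_G by blast+
  have MB: "inner_dart (Marked m, Boundary m)" "inner_dart (Boundary m, Marked m)" "inner_dart (Boundary m, Boundary (csucc n m))"
    if "1 \<le> m" "m \<le> n" for m
    using that unfolding inner_dart_def darts_G by blast+
  note inner = MC MB
  consider (CM) t m where "t \<in> triangles \<Delta>" "m \<in> t" "\<not> tip m" "d = (Centre t, Marked m)"
    | (MC) t m where "t \<in> triangles \<Delta>" "m \<in> t" "\<not> tip m" "d = (Marked m, Centre t)"
    | (MB) m where "1 \<le> m" "m \<le> n" "d = (Marked m, Boundary m)"
    | (BM) m where "1 \<le> m" "m \<le> n" "d = (Boundary m, Marked m)"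
    | (BB) m where "1 \<le> m" "m \<le> n" "d = (Boundary m, Boundary (csucc n m))"
    using assms unfolding inner_dart_def darts_G by blast
  then show ?thesis
  proof cases
    case CM
    note tc = triangle_corners[OF CM(1,2)]
    show ?thesis
    proof (cases "ccw_corner t m = csucc n m")
      case True
      then show ?thesis using stepG_CM[OF CM(1-3)] CM(4) inner(3)[OF tc(11,12)] by simp
    next
      case False
      note r = rtri[OF tc(9) False]
      show ?thesis using stepG_CM[OF CM(1-3)] CM(4) False inner(1)[OF r(1,2) CM(3)] r(3) by simp
    qed
  next
    case MC
    note tc = triangle_corners[OF MC(1,2)]
    define y where "y = cw_corner t m"
    show ?thesis
    proof (cases "tip y")
      case True
      have y: "1 \<le> y" "y \<le> n" using True by (auto simp: tip_def)
      have "csucc n y = m" using tip_corners(1)[OF True MC(1)] tc(4,6) by (simp add: y_def)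
      then show ?thesis using stepG_MC[OF MC(1,2)] MC(4) inner(3)[OF y] True by (simp add: y_def[symmetric] insert_commute)
    next
      case False
      then show ?thesis using stepG_MC[OF MC(1,2)] MC(4) inner(2)[of t y] MC(1) tc(4,6)
        by (simp add: y_def[symmetric] insert_commute)
    qed
  next
    case MB
    then show ?thesis using stepG_MB[of m] inner(5)[of m] by simp
  next
    case BM
    have \<Delta>: "{m, cpred n m} \<in> \<Delta>" "cpred n m \<noteq> csucc n m"
      using boundary_arcs_\<Delta>(2)[OF BM(1,2)] csucc_cpred(5)[OF BM(1,2)] by (auto simp: insert_commute)
    note r = rtri[OF this]
    have nt: "\<not> tip (cpred n m)" if "tip m" using tip_one[OF that r(1,2) _ r(4)] csucc_cpred(7)[OF BM(1,2)] by auto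
    show ?thesis using stepG_BM[OF BM(1,2)] BM(3) inner(1)[OF r(1,2)] inner(2)[OF r(1,4)] r(3,5) nt
      by (auto simp: insert_commute)
  next
    case BB
    then show ?thesis using stepG_BB[OF BB(1,2)] inner(4)[of "csucc n m"] csucc_cpred[OF BB(1,2)] by simp
  qed
qed

lemma face_of_inj: "inj_on face_of \<Delta>"
proof (rule inj_onI)
  fix e e' assume e: "e \<in> \<Delta>" "e' \<in> \<Delta>" and eq: "face_of e = face_of e'"
  have inv: "inner_dart x \<and> dart_arc x = dart_arc d" if "x \<in> orbit stepG d" "inner_dart d" for x d
    using that stepG_dart_arc by induction auto
  obtain d where d: "d \<in> darts G" "dart_arc d = e" using dart_of_arc e by blast
  obtain d' where d': "d' \<in> darts G" "dart_arc d' = e'" using dart_of_arc e by blast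
  have "stepG d \<in> orbit stepG d" by (rule orbit.base)
  also have "\<dots> = orbit stepG d'" using left_face_eq[OF d(1)] left_face_eq[OF d'(1)] d d' eq by (simp add: left_face_G)
  finally have "stepG d \<in> orbit stepG d'" .
  then show "e = e'" using inv[of _ d'] stepG_dart_arc[of d] d d' by (simp add: inner_dart_def)
qed

text \<open>The walk around an internal arc visits only coloured vertices, while rim darts and walks
  around a boundary arc meet a boundary vertex.\<close>

lemma internal_faces_G: "internal_faces G = face_of ` (\<Delta> - boundary_arcs n)"
proof
  have None: "col G (org G d) = None \<longleftrightarrow> (\<exists>m. fst d = Boundary m)" for d
    by (cases "fst d") (auto simp: col_G)
  show "face_of ` (\<Delta> - boundary_arcs n) \<subseteq> internal_faces G"
  proof
    fix F assume "F \<in> face_of ` (\<Delta> - boundary_arcs n)"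
    then obtain e where e: "e \<in> \<Delta> - boundary_arcs n" "F = face_of e" by blast
    obtain x y where xy: "e = {x, y}" using \<Delta>_endpoints e by blast
    note e' = e(1)[unfolded xy]
    have "F = left_face G (Marked x, Centre (rtri x y))" "(Marked x, Centre (rtri x y)) \<in> darts G"
      using face_internal(3)[OF e'] left_face_eq e xy by auto
    moreover have "\<forall>d \<in> F. col G (org G d) \<noteq> None"
      unfolding None using face_of_internal[OF e'] e xy by auto
    ultimately show "F \<in> internal_faces G" unfolding internal_faces_def by blast
  qed
  show "internal_faces G \<subseteq> face_of ` (\<Delta> - boundary_arcs n)"
  proof
    fix F assume "F \<in> internal_faces G"
    then obtain d where d: "d \<in> darts G \<union> rim G" "F = left_face G d"
      and int: "\<And>d. d \<in> F \<Longrightarrow> \<not> (\<exists>m. fst d = Boundary m)"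
      unfolding internal_faces_def None by blast
    have "d \<notin> rim G"
    proof
      assume "d \<in> rim G"
      then obtain m where m: "1 \<le> m" "m \<le> n" "d = (Boundary m, Boundary (csucc n m)) \<or> d = (Boundary (csucc n m), Boundary m)"
        by (auto simp: rim_U)
      have "stepG d \<in> F" using d orbit.base[of stepG d] by (simp add: left_face_G)
      then show False using int m stepG_BB[OF m(1,2)] stepG_BB'[of m] by fastforce
    qed
    then have dG: "d \<in> darts G" using d by simp
    have "dart_arc d \<notin> boundary_arcs n"
    proof
      assume "dart_arc d \<in> boundary_arcs n"
      then obtain x where x: "1 \<le> x" "x \<le> n" "dart_arc d = {x, csucc n x}" by (auto simp: boundary_arcs_def)
      note fb = face_boundary[OF x(1,2)]
      have "F = orbit stepG (Boundary x, Boundary (csucc n x))"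
        using orbit_eq_if_mem[OF fb(1) fb(2)[OF dG x(3)]] d by (simp add: left_face_G)
      then show False using int fb(1) by fastforce
    qed
    then show "F \<in> face_of ` (\<Delta> - boundary_arcs n)"
      using left_face_eq[OF dG] dart_arc_in_\<Delta>[OF dG] d by blast
  qed
qed

end

section \<open>The perfect orientation\<close>

locale oriented_disk = disk +
  fixes ori :: "(vertex \<times> vertex) set"
  assumes po: "perfect_orientation G ori" and sources: "source_set G ori = {1, 2}"
begin

lemma ori_darts: "d \<in> ori \<Longrightarrow> d \<in> darts G"
  using po by (auto simp: perfect_orientation_def)

lemma ori_swap: "d \<in> darts G \<Longrightarrow> d \<in> ori \<longleftrightarrow> prod.swap d \<notin> ori"
  using po by (simp add: perfect_orientation_def)

lemma po_black: "v \<in> org G ` darts G \<Longrightarrow> col G v = Some Black \<Longrightarrow> \<exists>!d. d \<in> ori \<and> org G d = v"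
  and po_white: "v \<in> org G ` darts G \<Longrightarrow> col G v = Some White \<Longrightarrow> \<exists>!d. d \<in> ori \<and> dest G d = v"
proof -
  have "\<forall>v \<in> org G ` darts G. (col G v = Some White \<longrightarrow> (\<exists>!d. d \<in> ori \<and> dest G d = v)) \<and>
      (col G v = Some Black \<longrightarrow> (\<exists>!d. d \<in> ori \<and> org G d = v))"
    using po unfolding perfect_orientation_def by (elim conjE)
  note * = bspec[OF this]
  show "\<exists>!d. d \<in> ori \<and> org G d = v" if "v \<in> org G ` darts G" "col G v = Some Black"
    by (rule mp[OF conjunct2[OF *[OF that(1)]] that(2)])
  show "\<exists>!d. d \<in> ori \<and> dest G d = v" if "v \<in> org G ` darts G" "col G v = Some White"
    by (rule mp[OF conjunct1[OF *[OF that(1)]] that(2)])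
qed

lemma apex_range: "2 < c \<Longrightarrow> c < Suc n \<Longrightarrow> tri c \<in> triangles \<Delta>"
  by (simp add: triangles_eq)

lemma kap_Boundary_iff: "kap v = Boundary m \<longleftrightarrow> v = Boundary m"
  by (auto simp: kap_def split: vertex.splits)

lemma kap_Marked_iff: "kap v = Marked m \<longleftrightarrow> v = Marked m \<and> \<not> tip m"
  by (auto simp: kap_def split: vertex.splits)

lemma kap_Marked_Centre:
  assumes "kap (Marked m) = Centre t"
  shows "tip m \<and> t \<in> triangles \<Delta> \<and> m \<in> t"
proof -
  have "tip m" using assms by (auto simp: kap_def split: if_splits)
  moreover obtain t' where "t' \<in> triangles \<Delta>" "m \<in> t'" using tip_triangle \<open>tip m\<close> by blast
  ultimately show ?thesis using kap_tip[of m t'] assms by auto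
qed

lemma darts_G_cases:
  assumes "d \<in> darts G"
  obtains (CM) c x where "2 < c" "c < Suc n" "x = lft c \<or> x = c \<or> x = rgt c" "\<not> tip (old x)" "d = (Centre (tri c), Marked (old x))"
    | (MC) c x where "2 < c" "c < Suc n" "x = lft c \<or> x = c \<or> x = rgt c" "\<not> tip (old x)" "d = (Marked (old x), Centre (tri c))"
    | (MB) x where "2 \<le> x" "x \<le> Suc n" "d = (Marked (old x), Boundary (old x))"
    | (BM) x where "2 \<le> x" "x \<le> Suc n" "d = (Boundary (old x), Marked (old x))"
proof -
  have corner: "\<exists>c x. 2 < c \<and> c < Suc n \<and> t = tri c \<and> (x = lft c \<or> x = c \<or> x = rgt c) \<and> m = old x"
    if t: "t \<in> triangles \<Delta>" and m: "m \<in> t" for t m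
  proof -
    obtain c where c: "2 < c" "c < Suc n" "t = tri c" using trianglesE[OF t] .
    then have "m = old (lft c) \<or> m = old c \<or> m = old (rgt c)" using m by (auto simp: tri_def)
    then show ?thesis using c by blast
  qed
  show thesis
    using assms unfolding darts_G
  proof (elim disjE exE conjE)
    fix t m assume *: "t \<in> triangles \<Delta>" "m \<in> t" "\<not> tip m" "d = (Centre t, Marked m)"
    then show thesis using corner[OF *(1,2)] CM by blast
  next
    fix t m assume *: "t \<in> triangles \<Delta>" "m \<in> t" "\<not> tip m" "d = (Marked m, Centre t)"
    then show thesis using corner[OF *(1,2)] MC by blast
  next
    fix m assume *: "1 \<le> m" "m \<le> n" "d = (Marked m, Boundary m)"
    then show thesis using old_surj[OF *(1,2)] MB by blast
  next
    fix m assume *: "1 \<le> m" "m \<le> n" "d = (Boundary m, Marked m)"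
    then show thesis using old_surj[OF *(1,2)] BM by blast
  qed
qed

lemma corner_range: "2 < c \<Longrightarrow> c < Suc n \<Longrightarrow> x = lft c \<or> x = c \<or> x = rgt c \<Longrightarrow> 2 \<le> x \<and> x \<le> Suc n"
  using base_bounds[of c] by auto

lemma corner_mem: "x = lft c \<or> x = c \<or> x = rgt c \<Longrightarrow> old x \<in> tri c"
  by (auto simp: tri_def)

lemma corner_iff: "2 \<le> x \<Longrightarrow> 2 < c \<Longrightarrow> c < Suc n \<Longrightarrow> old x \<in> tri c \<longleftrightarrow> x = lft c \<or> x = c \<or> x = rgt c"
  using base_bounds[of c] by (auto simp: tri_def old_inj)

lemma out_unique:
  assumes "d \<in> ori" "d' \<in> ori" "kap (fst d) = Centre t" "kap (fst d') = Centre t"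
  shows "d = d'"
proof -
  have "org G d \<in> org G ` darts G" using ori_darts assms(1) by blast
  moreover have "col G (org G d) = Some Black"
    using col_G[of "fst d"] vertex_colour_kap[of "fst d" "Centre t"] assms(3) by simp
  ultimately have "\<exists>!e. e \<in> ori \<and> org G e = org G d"
    by (rule po_black)
  moreover have "org G d' = org G d" using assms by (simp add: merge_iff)
  ultimately show ?thesis using assms(1,2) by blast
qed

lemma in_unique:
  assumes "d \<in> ori" "d' \<in> ori" "snd d = Marked m" "snd d' = Marked m" "\<not> tip m" "1 \<le> m" "m \<le> n"
  shows "d = d'"
proof -
  have "prod.swap d \<in> darts G" using ori_darts[OF assms(1)] unfolding darts_G by (cases d) auto
  then have "org G (prod.swap d) \<in> org G ` darts G" by blast
  then have "merge_class U (Marked m) \<in> org G ` darts G" using assms(3) by simp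
  moreover have "col G (merge_class U (Marked m)) = Some White"
    using assms(5-7) vertex_colour_Marked[of m] by (simp add: col_G del: vertex_colour.simps)
  ultimately have "\<exists>!e. e \<in> ori \<and> dest G e = merge_class U (Marked m)"
    by (rule po_white)
  moreover have "dest G d = merge_class U (Marked m)" "dest G d' = merge_class U (Marked m)"
    using assms(3,4) by simp_all
  ultimately show ?thesis using assms(1,2) by blast
qed

text \<open>At most one corner is an ear, so the merged vertex keeps some dart and the condition on
  black vertices applies to it.\<close>

lemma out_exists:
  assumes "t \<in> triangles \<Delta>"
  shows "\<exists>d \<in> ori. kap (fst d) = Centre t"
proof -
  obtain c where c: "2 < c" "c < Suc n" "t = tri c" using trianglesE[OF assms] .
  have "old c \<noteq> old (lft c)" using base_bounds[OF c(1,2)] c by (simp add: old_inj)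
  then obtain m where m: "m \<in> t" "\<not> tip m"
    using tip_one[of "old c" t "old (lft c)"] corner_mem[of c c] corner_mem[of "lft c" c] c assms by blast
  then have "(Centre t, Marked m) \<in> darts G" using assms unfolding darts_G by blast
  then have "org G (Centre t, Marked m) \<in> org G ` darts G" by blast
  then have "merge_class U (Centre t) \<in> org G ` darts G" by simp
  moreover have "col G (merge_class U (Centre t)) = Some Black" by (simp add: col_G)
  ultimately have "\<exists>!e. e \<in> ori \<and> org G e = merge_class U (Centre t)"
    by (rule po_black)
  then show ?thesis by (auto simp: merge_iff)
qed

lemma source_iff:
  assumes "1 \<le> m" "m \<le> n"
  shows "(Boundary m, Marked m) \<in> ori \<longleftrightarrow> m = 1 \<or> m = 2"
proof
  assume "(Boundary m, Marked m) \<in> ori"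
  then have "m \<in> source_set G ori" unfolding source_set_def by force
  then show "m = 1 \<or> m = 2" using sources by simp
next
  assume "m = 1 \<or> m = 2"
  then have "m \<in> source_set G ori" using sources by auto
  then obtain d where d: "d \<in> ori" "kap (fst d) = Boundary m" by (auto simp: source_set_def merge_iff)
  then have "fst d = Boundary m" by (simp add: kap_Boundary_iff)
  then have "d = (Boundary m, Marked m)" using ori_darts[OF d(1)] unfolding darts_G by auto
  then show "(Boundary m, Marked m) \<in> ori" using d by simp
qed

lemma old_source: "2 \<le> x \<Longrightarrow> x \<le> Suc n \<Longrightarrow> old x = 1 \<or> old x = 2 \<longleftrightarrow> x = 2 \<or> x = Suc n"
  by (auto simp: old_def)

lemma ori_BM: "2 \<le> x \<Longrightarrow> x \<le> Suc n \<Longrightarrow> (Boundary (old x), Marked (old x)) \<in> ori \<longleftrightarrow> x = 2 \<or> x = Suc n"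
  using source_iff[of "old x"] old_range[of x] old_source[of x] by auto

lemma ori_MB: "2 \<le> x \<Longrightarrow> x \<le> Suc n \<Longrightarrow> (Marked (old x), Boundary (old x)) \<in> ori \<longleftrightarrow> x \<noteq> 2 \<and> x \<noteq> Suc n"
  using ori_swap[of "(Marked (old x), Boundary (old x))"] old_range[of x] ori_BM[of x]
  by (simp add: darts_G)

text \<open>At an ear the edge from the triangle to its apex is contracted, and the edge from the
  ear to the boundary takes its place.\<close>

definition out_dart :: "nat \<Rightarrow> vertex \<times> vertex" where
  "out_dart c = (if tip (old c) then (Marked (old c), Boundary (old c)) else (Centre (tri c), Marked (old c)))"

lemma kap_out_dart: "2 < c \<Longrightarrow> c < Suc n \<Longrightarrow> kap (fst (out_dart c)) = Centre (tri c)"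
  using kap_tip[OF _ apex_range corner_mem[of c c]] by (simp add: out_dart_def)

text \<open>The two sources force the orientation from the triangle at the arc \<open>{1, 2}\<close> downwards.\<close>

lemma out_dart_ori: "2 < c \<Longrightarrow> c < Suc n \<Longrightarrow> out_dart c \<in> ori"
proof (induction c rule: up_induct)
  case (up c)
  have t: "tri c \<in> triangles \<Delta>" using apex_range up.hyps by blast
  obtain d where d: "d \<in> ori" "kap (fst d) = Centre (tri c)" using out_exists[OF t] by blast
  have "\<exists>x. (x = lft c \<or> x = c \<or> x = rgt c) \<and>
      d = (if tip (old x) then (Marked (old x), Boundary (old x)) else (Centre (tri c), Marked (old x)))"
    using ori_darts[OF d(1)]
  proof (cases rule: darts_G_cases)
    case (CM c' x)
    then have "c = c'" using d up.hyps tri_eq_iff by simp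
    then show ?thesis using CM by (intro exI[of _ x]) simp
  next
    case (MB x)
    then have "tip (old x)" "old x \<in> tri c" using d kap_Marked_Centre by auto
    then show ?thesis using MB corner_iff[of x c] up.hyps by (intro exI[of _ x]) simp
  qed (use d in simp_all)
  then obtain x where x: "x = lft c \<or> x = c \<or> x = rgt c"
    and dx: "d = (if tip (old x) then (Marked (old x), Boundary (old x)) else (Centre (tri c), Marked (old x)))" by blast
  have xr: "2 \<le> x" "x \<le> Suc n" using corner_range[OF up.hyps x] by auto
  \<comment> \<open>An end \<open>x\<close> of the base already has its incoming edge: from the
    boundary if it is a source, otherwise by induction from the triangle with apex \<open>x\<close>.
    In the second case \<open>x\<close> lies in two triangles, so it is white.\<close>
  have "x = c"
  proof (rule ccontr)
    assume "x \<noteq> c"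
    then have x': "x = lft c \<or> x = rgt c" using x by simp
    show False
    proof (cases "x = 2 \<or> x = Suc n")
      case True
      then have B: "(Boundary (old x), Marked (old x)) \<in> ori" using ori_BM xr by blast
      have "\<not> tip (old x)"
      proof
        assume "tip (old x)"
        then have "(Marked (old x), Boundary (old x)) \<in> ori" using dx d(1) by simp
        then show False using ori_MB[OF xr] True by blast
      qed
      then show False using in_unique[OF d(1) B] dx old_range[OF xr] by auto
    next
      case False
      then have xr': "2 < x" "x < Suc n" using xr by auto
      then have IH: "out_dart x \<in> ori" using up.IH[of x] x' by blast
      have ne: "tri x \<noteq> tri c" using tri_eq_iff xr' up.hyps \<open>x \<noteq> c\<close> by simp
      have "\<not> tip (old x)"
        using tip_unique[OF _ t corner_mem[OF x] apex_range[OF xr'] corner_mem[of x x]] ne by auto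
      then show False using in_unique[OF d(1) IH] dx ne old_range[OF xr] by (auto simp: out_dart_def)
    qed
  qed
  then have "d = out_dart c" using dx by (simp add: out_dart_def)
  then show ?case using d by simp
qed

lemma ori_out: "d \<in> ori \<Longrightarrow> 2 < c \<Longrightarrow> c < Suc n \<Longrightarrow> kap (fst d) = Centre (tri c) \<Longrightarrow> d = out_dart c"
  using out_unique[OF _ out_dart_ori] kap_out_dart by blast

lemma ori_CM:
  assumes "(Centre (tri c), Marked (old x)) \<in> ori" "2 < c" "c < Suc n" "2 \<le> x"
  shows "x = c"
  using ori_out[OF assms(1-3)] assms by (auto simp: out_dart_def old_inj split: if_splits)

lemma ori_MC:
  assumes "2 < c" "c < Suc n" "x = lft c \<or> x = c \<or> x = rgt c" "\<not> tip (old x)"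
  shows "(Marked (old x), Centre (tri c)) \<in> ori \<longleftrightarrow> x \<noteq> c"
proof -
  have "(Marked (old x), Centre (tri c)) \<in> darts G"
    using assms apex_range corner_mem[OF assms(3)] unfolding darts_G by blast
  then have "(Marked (old x), Centre (tri c)) \<in> ori \<longleftrightarrow> (Centre (tri c), Marked (old x)) \<notin> ori"
    using ori_swap by simp
  moreover have "(Centre (tri c), Marked (old x)) \<in> ori \<longleftrightarrow> x = c"
    using ori_CM[of c x] out_dart_ori[OF assms(1,2)] assms corner_range[OF assms(1-3)] by (auto simp: out_dart_def)
  ultimately show ?thesis by blast
qed

section \<open>Crossing the edges at the corners of a triangle\<close>

definition corner_dart :: "nat \<Rightarrow> nat \<Rightarrow> vertex \<times> vertex" where
  "corner_dart c x = (if tip (old x) then (Marked (old x), Boundary (old x)) else (Centre (tri c), Marked (old x)))"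

lemma corner_dart:
  assumes "2 < c" "c < Suc n" "x = lft c \<or> x = c \<or> x = rgt c"
  shows "corner_dart c x \<in> darts G" "prod.swap (corner_dart c x) \<in> darts G"
    "kap (fst (corner_dart c x)) = Centre (tri c)"
    "dart_arc (corner_dart c x) = {old x, ccw_corner (tri c) (old x)}"
    "dart_arc (prod.swap (corner_dart c x)) = {old x, cw_corner (tri c) (old x)}"
proof -
  note t = apex_range[OF assms(1,2)] and m = corner_mem[OF assms(3)]
  have r: "1 \<le> old x" "old x \<le> n" using old_range corner_range[OF assms] by auto
  show "corner_dart c x \<in> darts G" "prod.swap (corner_dart c x) \<in> darts G"
    using t m r unfolding darts_G corner_dart_def by auto
  show "kap (fst (corner_dart c x)) = Centre (tri c)"
    using kap_tip[OF _ t m] by (simp add: corner_dart_def)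
  show "dart_arc (corner_dart c x) = {old x, ccw_corner (tri c) (old x)}"
    "dart_arc (prod.swap (corner_dart c x)) = {old x, cw_corner (tri c) (old x)}"
    using tip_corners[OF _ t m] by (auto simp: corner_dart_def)
qed

lemma off_path_step:
  assumes "face_of e \<in> faces_left_of G p" "d \<in> darts G" "d \<notin> set p" "prod.swap d \<notin> set p"
    "{e, e'} = {dart_arc d, dart_arc (prod.swap d)}"
  shows "face_of e' \<in> faces_left_of G p"
proof -
  have d': "prod.swap d \<in> darts G" using assms(2) unfolding darts_G by auto
  have adj: "(left_face G x, left_face G (prod.swap x)) \<in> off_path_adj G p"
    if x: "x \<in> darts G" "x \<notin> set p" "prod.swap x \<notin> set p" for x
  proof -
    have "x \<notin> prod.swap ` set p" using x(3) by auto
    then have "x \<in> darts G - (set p \<union> opp G ` set p)" using x by simp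
    then have "(left_face G x, left_face G (opp G x)) \<in> off_path_adj G p" unfolding off_path_adj_def by blast
    then show ?thesis by simp
  qed
  have "(left_face G d, left_face G (prod.swap d)) \<in> off_path_adj G p"
    "(left_face G (prod.swap d), left_face G (prod.swap (prod.swap d))) \<in> off_path_adj G p"
    using adj[of d] adj[of "prod.swap d"] assms(2-4) d' by simp_all
  then have "(face_of (dart_arc d), face_of (dart_arc (prod.swap d))) \<in> off_path_adj G p"
    "(face_of (dart_arc (prod.swap d)), face_of (dart_arc d)) \<in> off_path_adj G p"
    using left_face_eq assms(2) d' by simp_all
  moreover have "(e = dart_arc d \<and> e' = dart_arc (prod.swap d)) \<or> (e = dart_arc (prod.swap d) \<and> e' = dart_arc d)"
    using assms(5) by (auto simp: doubleton_eq_iff)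
  ultimately have "(face_of e, face_of e') \<in> off_path_adj G p" by auto
  then show ?thesis using assms(1) unfolding faces_left_of_def by (meson Image_iff rtrancl.rtrancl_into_rtrancl)
qed

end

lemma successively_pred:
  assumes "successively R p" "d \<in> set p" "d \<noteq> hd p"
  shows "\<exists>e \<in> set p. R e d"
  using assms
proof (induction p rule: rev_induct)
  case (snoc x p)
  then show ?case by (cases "p = []") (auto simp: successively_append_iff)
qed simp

lemma successively_succ:
  assumes "successively R p" "d \<in> set p" "d \<noteq> last p"
  shows "\<exists>e \<in> set p. R d e"
  using assms
proof (induction p)
  case (Cons x p)
  then show ?case by (cases p) auto
qed simp

section \<open>Directed paths\<close>

locale oriented_path = oriented_disk +
  fixes p :: "(vertex \<times> vertex) list" and s j :: nat
  assumes path: "directed_path G ori p"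
    and start: "org G (hd p) = bdry G (old s)" and target: "dest G (last p) = bdry G (old j)"
    and s: "s = 2 \<or> s = Suc n" and j: "2 < j" "j < Suc n"
begin

definition X :: "vertex set" where "X = kap ` set (map fst p @ [snd (last p)])"

definition V :: "nat set" where "V = {c. 2 < c \<and> c < Suc n \<and> Centre (tri c) \<in> X}"

lemma p_ne: "p \<noteq> []" and p_ori: "d \<in> set p \<Longrightarrow> d \<in> ori"
  using path by (auto simp: directed_path_def)

lemma p_succ: "d \<in> set p \<Longrightarrow> d \<noteq> last p \<Longrightarrow> \<exists>e \<in> set p. kap (snd d) = kap (fst e)"
proof -
  have "successively (\<lambda>d e. kap (snd d) = kap (fst e)) p"
    using path by (simp add: directed_path_def merge_iff)
  then show "d \<in> set p \<Longrightarrow> d \<noteq> last p \<Longrightarrow> \<exists>e \<in> set p. kap (snd d) = kap (fst e)"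
    by (rule successively_succ)
qed

lemma p_pred: "d \<in> set p \<Longrightarrow> d \<noteq> hd p \<Longrightarrow> \<exists>e \<in> set p. kap (snd e) = kap (fst d)"
proof -
  have "successively (\<lambda>d e. kap (snd d) = kap (fst e)) p"
    using path by (simp add: directed_path_def merge_iff)
  then show "d \<in> set p \<Longrightarrow> d \<noteq> hd p \<Longrightarrow> \<exists>e \<in> set p. kap (snd e) = kap (fst d)"
    by (rule successively_pred)
qed

lemma X_fst: "d \<in> set p \<Longrightarrow> kap (fst d) \<in> X"
  by (auto simp: X_def)

lemma X_snd: "d \<in> set p \<Longrightarrow> kap (snd d) \<in> X"
proof (cases "d = last p")
  case False
  then show "d \<in> set p \<Longrightarrow> kap (snd d) \<in> X" using p_succ X_fst by metis
qed (auto simp: X_def)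

lemma j_range: "2 \<le> j" "j \<le> Suc n" and s_range: "2 \<le> s" "s \<le> Suc n" and s_ne_j: "s \<noteq> j"
  using j s n_ge by auto

lemma hd_p: "hd p = (Boundary (old s), Marked (old s))"
proof -
  have "fst (hd p) = Boundary (old s)" using start by (simp add: merge_iff kap_Boundary_iff)
  moreover have "hd p \<in> darts G" using p_ne p_ori ori_darts hd_in_set by blast
  ultimately show ?thesis unfolding darts_G by auto
qed

lemma last_p: "last p = (Marked (old j), Boundary (old j))"
proof -
  have "snd (last p) = Boundary (old j)" using target by (simp add: merge_iff kap_Boundary_iff)
  moreover have "last p \<in> darts G" using p_ne p_ori ori_darts last_in_set by blast
  ultimately show ?thesis unfolding darts_G by auto
qed

lemma hd_mem: "(Boundary (old s), Marked (old s)) \<in> set p" and last_mem: "(Marked (old j), Boundary (old j)) \<in> set p"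
  using p_ne hd_p last_p hd_in_set last_in_set by metis+

text \<open>A boundary vertex has a single edge, so a dart out of it can only come first: its
  predecessor would be the same edge in the opposite direction.\<close>

lemma BM_mem:
  assumes "2 \<le> x" "x \<le> Suc n" "(Boundary (old x), Marked (old x)) \<in> set p"
  shows "x = s"
proof (rule ccontr)
  assume "x \<noteq> s"
  then have "(Boundary (old x), Marked (old x)) \<noteq> hd p" using hd_p old_inj assms s_range by simp
  then obtain e where e: "e \<in> set p" "kap (snd e) = Boundary (old x)" using p_pred assms(3) by force
  then have "snd e = Boundary (old x)" by (simp add: kap_Boundary_iff)
  then have "e = (Marked (old x), Boundary (old x))" using ori_darts[OF p_ori[OF e(1)]] unfolding darts_G by auto
  then show False using ori_MB[OF assms(1,2)] ori_BM[OF assms(1,2)] p_ori e(1) assms(3) by metis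
qed

lemma MB_mem:
  assumes "2 \<le> x" "x \<le> Suc n" "(Marked (old x), Boundary (old x)) \<in> set p"
  shows "x = j"
proof (rule ccontr)
  assume "x \<noteq> j"
  then have "(Marked (old x), Boundary (old x)) \<noteq> last p" using last_p old_inj assms j_range by simp
  then obtain e where e: "e \<in> set p" "kap (fst e) = Boundary (old x)" using p_succ assms(3) by force
  then have "fst e = Boundary (old x)" by (simp add: kap_Boundary_iff)
  then have "e = (Boundary (old x), Marked (old x))" using ori_darts[OF p_ori[OF e(1)]] unfolding darts_G by auto
  then show False using ori_MB[OF assms(1,2)] ori_BM[OF assms(1,2)] p_ori e(1) assms(3) by metis
qed

lemma V_bounds: "c \<in> V \<Longrightarrow> 2 < c" "c \<in> V \<Longrightarrow> c < Suc n" "c \<in> V \<Longrightarrow> Centre (tri c) \<in> X"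
  by (auto simp: V_def)

lemma out_dart_mem:
  assumes "c \<in> V"
  shows "out_dart c \<in> set p"
proof -
  have "Centre (tri c) \<in> X" using assms by (simp add: V_def)
  then obtain d where "d \<in> set p" "kap (fst d) = Centre (tri c)" using last_p by (auto simp: X_def)
  then show ?thesis using ori_out[OF p_ori] V_bounds[OF assms] by metis
qed

lemma V_of_fst: "d \<in> set p \<Longrightarrow> kap (fst d) = Centre (tri c) \<Longrightarrow> 2 < c \<Longrightarrow> c < Suc n \<Longrightarrow> c \<in> V"
  using X_fst[of d] by (simp add: V_def)

text \<open>The only dart into a white point comes from the triangle of which it is the apex or, at
  a source, from the boundary.\<close>

lemma marked_pred:
  assumes "e \<in> set p" "fst e = Marked (old x)" "\<not> tip (old x)" "2 \<le> x" "x \<le> Suc n"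
  shows "x \<in> insert s V"
proof -
  have "e \<noteq> hd p" using hd_p assms(2) by auto
  then obtain e' where e': "e' \<in> set p" "kap (snd e') = Marked (old x)" using p_pred[OF assms(1)] assms(2,3) by auto
  then have sn: "snd e' = Marked (old x)" by (simp add: kap_Marked_iff)
  show ?thesis
    using ori_darts[OF p_ori[OF e'(1)]]
  proof (cases rule: darts_G_cases)
    case (CM c y)
    have y: "2 \<le> y" using corner_range[OF CM(1-3)] by simp
    then have "x = y" using CM sn assms old_inj by simp
    then have "x = c" using ori_CM[of c y] p_ori[OF e'(1)] CM y by simp
    then show ?thesis using V_of_fst[OF e'(1)] CM by simp
  next
    case (BM y)
    then have "x = y" using sn assms old_inj by simp
    then show ?thesis using BM_mem[of x] BM e'(1) by simp
  qed (use sn in simp_all)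
qed

lemma V_pred:
  assumes "c \<in> V"
  shows "lft c \<in> insert s V \<or> rgt c \<in> insert s V"
proof -
  note cb = V_bounds(1,2)[OF assms]
  have "out_dart c \<noteq> hd p" using hd_p by (simp add: out_dart_def)
  then obtain e where e: "e \<in> set p" "kap (snd e) = Centre (tri c)"
    using p_pred[OF out_dart_mem[OF assms]] kap_out_dart[OF cb] by metis
  show ?thesis
    using ori_darts[OF p_ori[OF e(1)]]
  proof (cases rule: darts_G_cases)
    case (MC c' x)
    then have c': "c' = c" using e tri_eq_iff cb by simp
    have "x \<noteq> c" using ori_MC[of c x] p_ori[OF e(1)] MC c' by simp
    moreover have "x \<in> insert s V"
      using marked_pred[OF e(1), of x] MC corner_range[OF MC(1-3)] by simp
    ultimately show ?thesis using MC c' by auto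
  next
    case (BM x)
    then have "old x \<in> tri c" using e kap_Marked_Centre by simp
    then have "x = lft c \<or> x = c \<or> x = rgt c" using corner_iff BM cb by simp
    moreover have "x = s" using BM_mem BM e(1) by simp
    ultimately show ?thesis using s cb by auto
  qed (use e in simp_all)
qed

lemma V_succ:
  assumes "c \<in> V" "c \<noteq> j"
  shows "\<exists>c' \<in> V. c = lft c' \<or> c = rgt c'"
proof -
  note cb = V_bounds(1,2)[OF assms(1)]
  have nMB: "(Marked (old c), Boundary (old c)) \<notin> set p" using MB_mem[of c] cb assms(2) by auto
  have nt: "\<not> tip (old c)" using out_dart_mem[OF assms(1)] nMB by (auto simp: out_dart_def)
  then have od: "(Centre (tri c), Marked (old c)) \<in> set p" using out_dart_mem[OF assms(1)] by (simp add: out_dart_def)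
  then obtain e where e: "e \<in> set p" "kap (fst e) = Marked (old c)" using p_succ[OF od] last_p nt by auto
  then have f: "fst e = Marked (old c)" by (simp add: kap_Marked_iff)
  show ?thesis
    using ori_darts[OF p_ori[OF e(1)]]
  proof (cases rule: darts_G_cases)
    case (MC c' x)
    have "x = c" using f MC old_inj[of x c] corner_range[OF MC(1-3)] cb by simp
    moreover have "x \<noteq> c'" using ori_MC[of c' x] p_ori[OF e(1)] MC by simp
    moreover have "c' \<in> V" using X_snd[OF e(1)] MC by (simp add: V_def)
    ultimately show ?thesis using MC by auto
  next
    case (MB x)
    then have "x = c" using f old_inj cb by simp
    then show ?thesis using MB e(1) nMB by simp
  qed (use f in simp_all)
qed

lemma V_target: "j \<in> V"
proof (cases "tip (old j)")
  case True
  have "kap (fst (Marked (old j), Boundary (old j))) = Centre (tri j)"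
    using kap_out_dart[OF j] True by (simp add: out_dart_def)
  then show ?thesis using V_of_fst[OF last_mem] j by simp
next
  case False
  then show ?thesis using marked_pred[OF last_mem, of j] j s_ne_j j_range by auto
qed

definition L :: "(nat \<times> nat) set" where
  "L = {e. face_of (arc e) \<in> faces_left_of G p}"

lemma left_face_mem:
  assumes "d \<in> set p"
  shows "face_of (dart_arc d) \<in> faces_left_of G p"
proof -
  have "left_face G d \<in> faces_left_of G p" unfolding faces_left_of_def using assms by blast
  then show ?thesis using left_face_eq ori_darts p_ori assms by simp
qed

lemma out_dart_corner: "out_dart c = corner_dart c c"
  by (simp add: out_dart_def corner_dart_def)

lemma L_apex: "c \<in> V \<Longrightarrow> (c, rgt c) \<in> L"
  using left_face_mem[OF out_dart_mem, of c] corner_dart(4)[of c c] tri_corners(2)[of c] V_bounds[of c]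
  by (simp add: L_def arc_def out_dart_corner)

lemma L_root: "s = 2 \<Longrightarrow> (2, Suc n) \<in> L"
  using left_face_mem[OF hd_mem] cpred_old[of 2] n_ge by (simp add: L_def arc_def insert_commute)

text \<open>No dart at an unvisited triangle lies on the path. Crossing the dart at the left or
  right end of the base leads from the face of the base to that of the adjacent side.\<close>

lemma L_down:
  assumes c: "2 < c" "c < Suc n" "c \<notin> V" and L: "(lft c, rgt c) \<in> L"
  shows "(lft c, c) \<in> L \<and> (c, rgt c) \<in> L"
proof -
  have nX: "Centre (tri c) \<notin> X" using c by (simp add: V_def)
  have off: "corner_dart c x \<notin> set p" "prod.swap (corner_dart c x) \<notin> set p" if "x = lft c \<or> x = c \<or> x = rgt c" for x
    using X_fst[of "corner_dart c x"] X_snd[of "prod.swap (corner_dart c x)"] corner_dart(3)[OF c(1,2) that] nX by auto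
  note lo = off[of "lft c"] and ro = off[of "rgt c"]
  note lc = corner_dart[OF c(1,2), of "lft c"] and rc = corner_dart[OF c(1,2), of "rgt c"]
  have L': "face_of {old (lft c), old (rgt c)} \<in> faces_left_of G p" using L by (simp add: L_def arc_def)
  have "face_of {old (lft c), old c} \<in> faces_left_of G p"
    by (rule off_path_step[OF L', of "corner_dart c (lft c)"]) (use lo lc in \<open>auto simp: tri_corners[OF c(1,2)]\<close>)
  moreover have "face_of {old c, old (rgt c)} \<in> faces_left_of G p"
    by (rule off_path_step[OF L', of "corner_dart c (rgt c)"])
      (use ro rc in \<open>simp_all add: tri_corners[OF c(1,2)] insert_commute\<close>)
  ultimately show ?thesis by (simp add: L_def arc_def)
qed

sublocale vis: left_of_visited "Suc n" D V s j L
proof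
  show "V \<subseteq> {2<..<Suc n}" by (auto simp: V_def)
qed (use s V_target V_pred V_succ L_apex L_root L_down in auto)

lemma path_degree_eq: "path_degree G p = card {e \<in> D. snd e \<noteq> Suc (fst e) \<and> e \<noteq> (2, Suc n) \<and> e \<in> L}"
proof -
  let ?A = "{e \<in> D. snd e \<noteq> Suc (fst e) \<and> e \<noteq> (2, Suc n) \<and> e \<in> L}"
  have diag: "arc e \<in> boundary_arcs n \<longleftrightarrow> \<not> (snd e \<noteq> Suc (fst e) \<and> e \<noteq> (2, Suc n))" if "e \<in> D" for e
    using that boundary_arc_old[of "fst e" "snd e"] D_range[of "fst e" "snd e"]
    by (cases e) (auto simp: arc_def)
  have "\<Delta> - boundary_arcs n = arc ` {e \<in> D. snd e \<noteq> Suc (fst e) \<and> e \<noteq> (2, Suc n)}"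
  proof (intro equalityI subsetI)
    fix x assume x: "x \<in> \<Delta> - boundary_arcs n"
    then obtain e where "e \<in> D" "x = arc e" using arc_image by blast
    then show "x \<in> arc ` {e \<in> D. snd e \<noteq> Suc (fst e) \<and> e \<noteq> (2, Suc n)}" using diag[of e] x by blast
  next
    fix x assume "x \<in> arc ` {e \<in> D. snd e \<noteq> Suc (fst e) \<and> e \<noteq> (2, Suc n)}"
    then obtain e where e: "e \<in> D" "x = arc e" "snd e \<noteq> Suc (fst e) \<and> e \<noteq> (2, Suc n)" by blast
    then have "arc e \<in> \<Delta>" using arc_image by blast
    then show "x \<in> \<Delta> - boundary_arcs n" using diag[OF e(1)] e by blast
  qed
  then have "internal_faces G \<inter> faces_left_of G p = face_of ` arc ` ?A"
    unfolding internal_faces_G by (auto simp: L_def)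
  moreover have "inj_on face_of (arc ` ?A)"
  proof (rule inj_on_subset[OF face_of_inj])
    have "arc ` ?A \<subseteq> arc ` D" by (rule image_mono) blast
    then show "arc ` ?A \<subseteq> \<Delta>" by (simp only: arc_image)
  qed
  moreover have "inj_on arc ?A" using arc_inj by (rule inj_on_subset) auto
  ultimately show ?thesis by (simp add: path_degree_def card_image)
qed

end

section \<open>Flows\<close>

locale oriented_greedy = oriented_disk n \<Delta> ori + greedy "Suc n" D i k
  for n \<Delta> ori i k
begin

text \<open>The darts between a triangle and an ear are left out, since they are contracted.\<close>

definition greedy_darts :: "nat \<Rightarrow> (vertex \<times> vertex) set" where
  "greedy_darts m = {(Boundary (old src), Marked (old src))} \<union>
    {(Marked (old (nxt c)), Centre (tri c)) | c. c \<in> up m \<and> c \<noteq> src \<and> \<not> tip (old (nxt c))} \<union>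
    {(Centre (tri c), Marked (old c)) | c. c \<in> up m \<and> c \<noteq> src \<and> \<not> tip (old c)}"

definition greedy_verts :: "nat \<Rightarrow> vertex set" where
  "greedy_verts m = {Boundary (old src)} \<union> {Centre (tri x) | x. x \<in> up m \<and> x \<noteq> src} \<union>
    {Marked (old x) | x. x \<in> up m \<and> \<not> tip (old x)}"

text \<open>Invariant of the construction of the greedy walk up to the marked point
  \<open>m\<close>, without the final dart to the boundary. The exact set of darts determines the
  left side, the bound on the vertices yields disjointness, and vertices are compared after
  merging.\<close>

definition greedy_list :: "nat \<Rightarrow> (vertex \<times> vertex) list \<Rightarrow> bool" where
  "greedy_list m p \<longleftrightarrow> p \<noteq> [] \<and> hd p = (Boundary (old src), Marked (old src)) \<and>
    kap (snd (last p)) = kap (Marked (old m)) \<and> set p = greedy_darts m \<and> set p \<subseteq> ori \<and>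
    successively (\<lambda>d e. kap (snd d) = kap (fst e)) p \<and>
    distinct (map (kap \<circ> fst) p @ [kap (Marked (old m))]) \<and>
    set (map (kap \<circ> fst) p) \<subseteq> greedy_verts m"

lemma src_range: "2 \<le> src" "src \<le> Suc n" "src = 2 \<or> src = Suc n"
  using n_ge by (auto simp: src_def)

lemma greedy_list_src: "greedy_list src [(Boundary (old src), Marked (old src))]"
proof -
  have "(Boundary (old src), Marked (old src)) \<in> ori" using ori_BM[OF src_range(1,2)] src_range(3) by simp
  moreover have "kap (Marked (old src)) \<noteq> Boundary (old src)" by (simp add: kap_Boundary_iff)
  ultimately show ?thesis
    by (auto simp: greedy_list_def greedy_darts_def greedy_verts_def up_src)
qed

text \<open>The walk is prolonged through the triangle of \<open>m\<close>: from the end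
  \<open>nxt m\<close> of its base to the centre and on to \<open>m\<close>. Each of the two darts
  is omitted if its marked point is an ear and so coincides with the centre.\<close>

lemma greedy_list_step:
  assumes m: "2 < m" "m < Suc n" "m < k" and p: "greedy_list (nxt m) p"
  shows "\<exists>p. greedy_list m p"
proof -
  define z where "z = nxt m"
  have zc: "z = lft m \<or> z = rgt m" by (simp add: z_def nxt_cases)
  have z_ne: "z \<noteq> m" using zc base_bounds[OF m(1,2)] by auto
  have zr: "2 \<le> z" "z \<le> Suc n" using corner_range[OF m(1,2), of z] zc by auto
  have upm: "up m = insert m (up z)" using up_eq[OF m(1,2)] by (simp add: z_def)
  have ms: "m \<noteq> src" using src_ne m by blast
  have m_up: "x \<noteq> m" if "x \<in> up z" for x
  proof (cases "z = src")
    case True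
    then show ?thesis using that up_src ms by auto
  next
    case False
    then have zb: "2 < z" "z < Suc n" "z < k" using nxt_bounds[OF m] by (auto simp: z_def)
    show ?thesis
      using up_props(3)[OF zb that] ms width_parent[OF m(1,2) zc] by auto
  qed
  have up_range: "x = src \<or> 2 < x \<and> x < Suc n" if "x \<in> up z" for x
  proof (cases "z = src")
    case True
    then show ?thesis using that up_src by auto
  next
    case False
    then have zb: "2 < z" "z < Suc n" "z < k" using nxt_bounds[OF m] by (auto simp: z_def)
    show ?thesis using up_props(2)[OF zb that] .
  qed
  note t = apex_range[OF m(1,2)]
  have tz: "kap (Marked (old z)) = Centre (tri m)" if "tip (old z)"
    using kap_tip[OF that t corner_mem] zc by blast
  have tm: "kap (Marked (old m)) = Centre (tri m)" if "tip (old m)"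
    using kap_tip[OF that t corner_mem] by blast
  define p1 where "p1 = (if tip (old z) then [] else [(Marked (old z), Centre (tri m))])"
  define p2 where "p2 = (if tip (old m) then [] else [(Centre (tri m), Marked (old m))])"
  note pp = p[unfolded greedy_list_def z_def[symmetric]]
  let ?p = "p @ p1 @ p2" and ?vs = "set (map (kap \<circ> fst) p)"
  have vs: "?vs \<subseteq> greedy_verts z" using pp by (elim conjE)
  moreover have "distinct (map (kap \<circ> fst) p) \<and> kap (Marked (old z)) \<notin> ?vs"
    using pp by (elim conjE) simp
  ultimately have vs: "?vs \<subseteq> greedy_verts z" "distinct (map (kap \<circ> fst) p)" "kap (Marked (old z)) \<notin> ?vs" by blast+
  have C_vs: "Centre (tri m) \<notin> ?vs"
  proof (cases "tip (old z)")
    case True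
    then show ?thesis using vs(3) tz by simp
  next
    case False
    have "tri m \<noteq> tri x" if "x \<in> up z" "x \<noteq> src" for x
      using tri_eq_iff[OF m(1,2), of x] up_range[OF that(1)] that m_up by auto
    then have "Centre (tri m) \<notin> greedy_verts z" by (auto simp: greedy_verts_def)
    then show ?thesis using vs(1) by blast
  qed
  have M_vs: "Marked (old m) \<notin> ?vs"
  proof -
    have "old m \<noteq> old x" if "x \<in> up z" for x
      using old_inj[of m x] up_range[OF that] m_up[OF that] m src_range by auto
    then have "Marked (old m) \<notin> greedy_verts z" by (auto simp: greedy_verts_def)
    then show ?thesis using vs(1) by blast
  qed
  have oz: "old z \<noteq> old m" using old_inj[of z m] zr m z_ne by simp
  have "greedy_list m ?p"
    unfolding greedy_list_def
  proof (intro conjI)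
    show "?p \<noteq> []" "hd ?p = (Boundary (old src), Marked (old src))" using pp by auto
    show "kap (snd (last ?p)) = kap (Marked (old m))"
      using pp tz tm by (auto simp: p1_def p2_def)
    show "set ?p = greedy_darts m"
      using pp ms by (auto simp: greedy_darts_def upm p1_def p2_def z_def)
    have "(Marked (old z), Centre (tri m)) \<in> ori" if "\<not> tip (old z)"
      using ori_MC[of m z] m zc that z_ne by blast
    moreover have "(Centre (tri m), Marked (old m)) \<in> ori" if "\<not> tip (old m)"
      using out_dart_ori[OF m(1,2)] that by (simp add: out_dart_def)
    ultimately show "set ?p \<subseteq> ori" using pp by (auto simp: p1_def p2_def)
    show "successively (\<lambda>d e. kap (snd d) = kap (fst e)) ?p"
      using pp tz by (auto simp: successively_append_iff p1_def p2_def)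
    show "distinct (map (kap \<circ> fst) ?p @ [kap (Marked (old m))])"
    proof -
      have v: "distinct (map (kap \<circ> fst) p)" "kap (Marked (old z)) \<notin> ?vs" "Centre (tri m) \<notin> ?vs" "Marked (old m) \<notin> ?vs"
        using vs C_vs M_vs by blast+
      show ?thesis
        by (cases "tip (old z)"; cases "tip (old m)")
          (use v oz tm in \<open>simp_all add: p1_def p2_def\<close>)
    qed
    have "greedy_verts z \<subseteq> greedy_verts m" by (auto simp: greedy_verts_def upm)
    moreover have "Marked (old z) \<in> greedy_verts m" if "\<not> tip (old z)"
      using that up.self[of z] by (auto simp: greedy_verts_def upm)
    moreover have "Centre (tri m) \<in> greedy_verts m" using ms by (auto simp: greedy_verts_def upm)
    ultimately show "set (map (kap \<circ> fst) ?p) \<subseteq> greedy_verts m"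
      using vs(1) by (auto simp: p1_def p2_def)
  qed
  then show ?thesis ..
qed

lemma greedy_list_ex: "\<exists>p. greedy_list i p"
proof -
  have "\<exists>p. greedy_list m p" if "2 < m" "m < Suc n" "m < k" for m
    using that
  proof (induction m rule: greedy_induct)
    case (src m)
    then show ?case using greedy_list_step[of m] greedy_list_src by auto
  next
    case (step m)
    then show ?case using greedy_list_step[of m] by blast
  qed
  then show ?thesis using i k by blast
qed

text \<open>Crossing an edge off the greedy path preserves \<open>S\<close>. At a triangle this is
  \<open>S_cross\<close>; at a boundary vertex the two adjacent boundary arcs are compared, and they
  differ in \<open>S\<close> only at the target and at the source.\<close>

lemma S_dart:
  assumes "d \<in> darts G"
  shows "\<exists>e e'. e \<in> D \<and> e' \<in> D \<and> dart_arc d = arc e \<and> dart_arc (prod.swap d) = arc e' \<and>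
    (S e \<noteq> S e' \<longrightarrow> d \<in> insert (Marked (old i), Boundary (old i)) (greedy_darts i) \<or>
      prod.swap d \<in> insert (Marked (old i), Boundary (old i)) (greedy_darts i))"
    (is "?P d")
proof -
  have sym: "?P (prod.swap d) \<Longrightarrow> ?P d" for d by (simp only: swap_swap) blast
  have CM: "?P (Centre (tri c), Marked (old x))"
    if c: "2 < c" "c < Suc n" and x: "x = lft c \<or> x = c \<or> x = rgt c" and nt: "\<not> tip (old x)" for c x
  proof -
    note b = base[OF c] and tc = tri_corners[OF c]
    have cs: "c \<noteq> src" using src_ne c by blast
    have in1: "(Marked (old (nxt c)), Centre (tri c)) \<in> greedy_darts i" if "c \<in> up i" "\<not> tip (old (nxt c))"
      using that cs unfolding greedy_darts_def by blast
    have in2: "(Centre (tri c), Marked (old c)) \<in> greedy_darts i" if "c \<in> up i" "\<not> tip (old c)"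
      using that cs unfolding greedy_darts_def by blast
    from x consider "x = lft c" | "x = c" | "x = rgt c" by blast
    then show ?thesis
    proof cases
      case 1
      have "(Marked (old (lft c)), Centre (tri c)) \<in> greedy_darts i" if "S (lft c, c) \<noteq> S (lft c, rgt c)"
        using S_cross(1)[OF c that] in1 nt 1 by simp
      then show ?thesis using b tc 1
        by (intro exI[of _ "(lft c, c)"] exI[of _ "(lft c, rgt c)"]) (simp add: arc_def)
    next
      case 2
      have "(Centre (tri c), Marked (old c)) \<in> greedy_darts i" if "S (lft c, c) \<noteq> S (c, rgt c)"
        using S_cross(3)[OF c that] in2 nt 2 by simp
      then show ?thesis using b tc 2
        by (intro exI[of _ "(c, rgt c)"] exI[of _ "(lft c, c)"]) (auto simp: arc_def insert_commute)
    next
      case 3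
      have "(Marked (old (rgt c)), Centre (tri c)) \<in> greedy_darts i" if "S (lft c, rgt c) \<noteq> S (c, rgt c)"
        using S_cross(2)[OF c that] in1 nt 3 by simp
      then show ?thesis using b tc 3
        by (intro exI[of _ "(lft c, rgt c)"] exI[of _ "(c, rgt c)"]) (simp add: arc_def insert_commute)
    qed
  qed
  have MB: "?P (Marked (old x), Boundary (old x))" if x: "2 \<le> x" "x \<le> Suc n" for x
  proof -
    have src_in: "(Boundary (old src), Marked (old src)) \<in> greedy_darts i" by (simp add: greedy_darts_def)
    note a = csucc_old[OF x] cpred_old[OF x]
    consider "2 < x" "x < Suc n" | "x = 2" | "x = Suc n" using x by linarith
    then show ?thesis
    proof cases
      case 1
      then have "(x, Suc x) \<in> D" "(x - 1, x) \<in> D" using side_in_D[of x] side_in_D[of "x - 1"] by auto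
      moreover have "S (x, Suc x) = S (x - 1, x)" if "x \<noteq> i" using that 1 k by (auto simp: S_def)
      ultimately show ?thesis using a 1
        by (intro exI[of _ "(x, Suc x)"] exI[of _ "(x - 1, x)"]) (auto simp: arc_def)
    next
      case 2
      have D: "(2, 3) \<in> D" "(2, Suc n) \<in> D" using side_in_D[of 2] root_in_D n_ge by (auto simp: numeral_eq_Suc)
      have eq: "S (2, 3) = S (2, Suc n)" if "x \<noteq> src" using that 2 i k by (auto simp: S_def src_def)
      then have key: "S (2, 3) \<noteq> S (2, Suc n) \<Longrightarrow> (Boundary (old x), Marked (old x)) \<in> greedy_darts i"
        using src_in by (cases "x = src") simp_all
      have a: "csucc n (old x) = old 3" "cpred n (old x) = old (Suc n)" using a 2 n_ge by simp_all
      show ?thesis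
        by (rule exI[of _ "(2, 3)"], rule exI[of _ "(2, Suc n)"])
          (use D key a 2 in \<open>auto simp: arc_def\<close>)
    next
      case 3
      have D: "(2, Suc n) \<in> D" "(n, Suc n) \<in> D" using side_in_D[of n] root_in_D n_ge by auto
      have "S (2, Suc n) = S (n, Suc n)" if "x \<noteq> src" using that 3 i k by (auto simp: S_def src_def split: if_splits)
      then have key: "S (2, Suc n) \<noteq> S (n, Suc n) \<Longrightarrow> (Boundary (old x), Marked (old x)) \<in> greedy_darts i"
        using src_in by (cases "x = src") simp_all
      have a: "csucc n (old x) = old 2" "cpred n (old x) = old n" using a 3 n_ge by simp_all
      show ?thesis
        by (rule exI[of _ "(2, Suc n)"], rule exI[of _ "(n, Suc n)"])
          (use D key a 3 in \<open>auto simp: arc_def\<close>)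
    qed
  qed
  from assms show ?thesis
  proof (cases rule: darts_G_cases)
    case (CM c x)
    then show ?thesis using \<open>\<And>x c. _ \<Longrightarrow> _ \<Longrightarrow> _ \<Longrightarrow> _ \<Longrightarrow> ?P (Centre (tri c), Marked (old x))\<close> by simp
  next
    case (MC c x)
    then show ?thesis using sym[of d] CM[of c x] by simp
  next
    case (MB x)
    then show ?thesis using \<open>\<And>x. _ \<Longrightarrow> _ \<Longrightarrow> ?P (Marked (old x), Boundary (old x))\<close> by simp
  next
    case (BM x)
    then show ?thesis using sym[of d] MB[of x] by simp
  qed
qed

lemma S_greedy_darts:
  assumes "d \<in> insert (Marked (old i), Boundary (old i)) (greedy_darts i)"
  shows "\<exists>e \<in> D. S e \<and> dart_arc d = arc e"
proof -
  have apex: "2 < c \<and> c < Suc n" if "c \<in> up i" "c \<noteq> src" for c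
    using up_props(2)[OF i k(1) that(1)] that(2) by simp
  have 1: ?thesis if "d = (Boundary (old src), Marked (old src))"
  proof (cases "src = 2")
    case True
    then have "S (2, Suc n)" using i by (auto simp: S_def src_def split: if_splits)
    then show ?thesis using that True cpred_old[OF src_range(1,2)] root_in_D
      by (intro bexI[of _ "(2, Suc n)"]) (auto simp: arc_def)
  next
    case False
    then have "src = Suc n" using src_range by simp
    moreover have "S (n, Suc n)" using i by (simp add: S_def)
    ultimately show ?thesis using that cpred_old[OF src_range(1,2)] side_in_D[of n] n_ge
      by (intro bexI[of _ "(n, Suc n)"]) (auto simp: arc_def)
  qed
  have 2: ?thesis if c: "c \<in> up i" "c \<noteq> src" and d: "d = (Marked (old (nxt c)), Centre (tri c))" for c
  proof (cases "nxt c = lft c")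
    case True
    then show ?thesis using d S_up(2)[OF c True] base[of c] tri_corners[of c] apex[OF c]
      by (intro bexI[of _ "(lft c, rgt c)"]) (auto simp: arc_def)
  next
    case False
    then have "nxt c = rgt c" using nxt_cases[of c] by simp
    then show ?thesis using d S_up(1)[OF c] base[of c] tri_corners[of c] apex[OF c]
      by (intro bexI[of _ "(c, rgt c)"]) (auto simp: arc_def)
  qed
  have 3: ?thesis if c: "c \<in> up i" "c \<noteq> src" and d: "d = (Centre (tri c), Marked (old c))" for c
    using d S_up(1)[OF c] base[of c] tri_corners[of c] apex[OF c]
    by (intro bexI[of _ "(c, rgt c)"]) (auto simp: arc_def)
  have 4: ?thesis if "d = (Marked (old i), Boundary (old i))"
    using that csucc_old[of i] side_in_D[of i] i
    by (intro bexI[of _ "(i, Suc i)"]) (auto simp: arc_def S_def)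
  show ?thesis using assms 1 2 3 4 unfolding greedy_darts_def by blast
qed

lemma greedy_path_ex:
  obtains p where "directed_path G ori p" "org G (hd p) = bdry G (old src)" "dest G (last p) = bdry G (old i)"
    "\<forall>e \<in> D. face_of (arc e) \<in> faces_left_of G p \<longrightarrow> S e"
    "kap ` set (map fst p @ [snd (last p)]) \<subseteq> insert (Boundary (old i)) (greedy_verts i)"
proof -
  obtain q where "greedy_list i q" using greedy_list_ex by blast
  note q = this[unfolded greedy_list_def]
  define p where "p = q @ [(Marked (old i), Boundary (old i))]"
  have i_range: "2 \<le> i" "i \<le> Suc n" "i \<noteq> 2" "i \<noteq> Suc n" using i by auto
  have set_p: "set p = insert (Marked (old i), Boundary (old i)) (greedy_darts i)" using q by (simp add: p_def)
  have qv: "kap ` set (map fst q) \<subseteq> greedy_verts i"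
    using q by (elim conjE) (simp only: set_map image_comp)
  have verts: "kap ` set (map fst p @ [snd (last p)]) \<subseteq> insert (Boundary (old i)) (greedy_verts i)"
  proof -
    have "kap (Marked (old i)) \<in> greedy_verts i"
    proof (cases "tip (old i)")
      case True
      then have "kap (Marked (old i)) = Centre (tri i)"
        using kap_tip[OF True apex_range[OF i] corner_mem] by blast
      then show ?thesis using up.self[of i] src_ne[OF i] by (auto simp: greedy_verts_def)
    next
      case False
      then show ?thesis using up.self[of i] by (auto simp: greedy_verts_def)
    qed
    then show ?thesis using qv by (auto simp: p_def)
  qed
  have dist_kap: "distinct (map kap (map fst p @ [snd (last p)]))"
  proof -
    have "Boundary (old i) \<notin> greedy_verts i"
      using old_inj[of i src] i_range src_range src_ne[OF i] by (auto simp: greedy_verts_def)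
    then have "Boundary (old i) \<notin> kap ` set (map fst q)" using qv by blast
    moreover have "distinct (map kap (map fst q) @ [kap (Marked (old i))])"
      using q by (elim conjE) (simp only: map_map)
    moreover have "kap (Marked (old i)) \<noteq> Boundary (old i)" by (simp add: kap_Boundary_iff)
    ultimately show ?thesis by (simp add: p_def image_image)
  qed
  have "distinct (walk_verts G p)"
  proof -
    have *: "distinct (map (merge_class U) vs)" if "distinct (map kap vs)" for vs
      using that by (induction vs) (auto simp: image_iff merge_iff)
    have "walk_verts G p = map (merge_class U) (map fst p @ [snd (last p)])"
      by (simp add: walk_verts_def)
    then show ?thesis using *[OF dist_kap] by simp
  qed
  moreover have "successively (\<lambda>d e. dest G d = org G e) p"
    using q by (auto simp: p_def merge_iff successively_append_iff)
  moreover have "set p \<subseteq> ori" using q ori_MB[OF i_range(1,2)] i_range by (auto simp: p_def)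
  ultimately have path: "directed_path G ori p" using q by (simp add: directed_path_def p_def)
  \<comment> \<open>\<open>T\<close> contains the faces along the left of the path and is closed
    under crossing edges off it, so it bounds \<open>faces_left_of G p\<close> from above.\<close>
  define T where "T = face_of ` arc ` {e \<in> D. S e}"
  have inj: "e = e'" if "face_of (arc e) = face_of (arc e')" "e \<in> D" "e' \<in> D" for e e'
  proof -
    have "arc e \<in> \<Delta>" "arc e' \<in> \<Delta>" using that arc_image by blast+
    then have "arc e = arc e'" using face_of_inj that(1) by (auto dest: inj_onD)
    then show ?thesis using arc_inj that by (auto dest: inj_onD)
  qed
  have start: "left_face G ` set p \<subseteq> T"
  proof
    fix F assume "F \<in> left_face G ` set p"
    then obtain d where d: "d \<in> set p" "F = left_face G d" by blast
    have "d \<in> darts G" using d \<open>set p \<subseteq> ori\<close> ori_darts by blast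
    then have "F = face_of (dart_arc d)" using d left_face_eq by simp
    then show "F \<in> T" using S_greedy_darts[of d] d set_p by (auto simp: T_def)
  qed
  have closed: "F' \<in> T" if FT: "F \<in> T" and FF': "(F, F') \<in> off_path_adj G p" for F F'
  proof -
    obtain d where d: "d \<in> darts G" "d \<notin> set p" "d \<notin> prod.swap ` set p" "F = left_face G d" "F' = left_face G (prod.swap d)"
      using FF' by (auto simp: off_path_adj_def)
    have d': "prod.swap d \<in> darts G" using d(1) unfolding darts_G by auto
    have "prod.swap d \<notin> set p" using d(3) by (metis imageI swap_swap)
    then obtain e e' where e: "e \<in> D" "e' \<in> D" "dart_arc d = arc e" "dart_arc (prod.swap d) = arc e'" "S e = S e'"
      using S_dart[OF d(1)] d(2) set_p by metis
    obtain e0 where e0: "e0 \<in> D" "S e0" "F = face_of (arc e0)" using FT by (auto simp: T_def)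
    have F: "F = face_of (arc e)" "F' = face_of (arc e')" using d d' e left_face_eq by simp_all
    have "e = e0" by (rule inj[OF _ e(1) e0(1)]) (simp only: F(1)[symmetric] e0(3)[symmetric])
    then have "S e'" using e(5) e0(2) by simp
    then show "F' \<in> T" unfolding T_def F(2) using e(2) by blast
  qed
  have left: "F \<in> T" if F: "F \<in> faces_left_of G p" for F
  proof -
    obtain F0 where "F0 \<in> left_face G ` set p" "(F0, F) \<in> (off_path_adj G p)\<^sup>*"
      using F unfolding faces_left_of_def by blast
    from this(2) show ?thesis
    proof induction
      case base
      then show ?case using start \<open>F0 \<in> _\<close> by blast
    next
      case (step F F')
      then show ?case using closed by blast
    qed
  qed
  have "S e" if e: "e \<in> D" "face_of (arc e) \<in> faces_left_of G p" for e
  proof -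
    obtain e0 where e0: "e0 \<in> D" "S e0" "face_of (arc e) = face_of (arc e0)"
      using left[OF e(2)] unfolding T_def by blast
    then show "S e" using inj[OF e0(3) e(1) e0(1)] by simp
  qed
  moreover have "org G (hd p) = bdry G (old src)" "dest G (last p) = bdry G (old i)"
    using q by (simp_all add: p_def)
  ultimately show thesis using that path verts by blast
qed

end

section \<open>Degrees of greedy paths\<close>

context oriented_disk
begin

text \<open>The number of diagonals satisfying \<open>S\<close>, on which the upper bound for greedy
  paths and the lower bounds for arbitrary ones agree.\<close>

definition cnt :: "nat \<Rightarrow> nat \<Rightarrow> nat" where
  "cnt i k = card {e \<in> Diag. i \<le> fst e \<or> k \<le> snd e}"

definition path_verts :: "(vertex \<times> vertex) list \<Rightarrow> vertex set" where
  "path_verts p = kap ` set (map fst p @ [snd (last p)])"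

lemma walk_verts_disjoint: "set (walk_verts G p) \<inter> set (walk_verts G q) = {} \<longleftrightarrow> path_verts p \<inter> path_verts q = {}"
proof -
  have "set (walk_verts G r) = merge_class U ` set (map fst r @ [snd (last r)])" for r
    by (auto simp: walk_verts_def)
  then show ?thesis
    unfolding path_verts_def by (simp only: disjoint_iff image_iff) (metis merge_iff)
qed

text \<open>Designed for disjointness: the greedy path to \<open>i\<close> with bound j uses only
  points below j, and the one from \<open>n + 1\<close> to j, with bound \<open>n + 2\<close>, only
  points from j on.\<close>

definition verts_bound :: "nat \<Rightarrow> nat \<Rightarrow> nat \<Rightarrow> vertex set" where
  "verts_bound s i k = {Boundary (old s), Boundary (old i)} \<union>
    {Centre (tri x) | x. 2 < x \<and> x < Suc n \<and> x < k \<and> (k = Suc (Suc n) \<longrightarrow> i \<le> x)} \<union>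
    {Marked (old x) | x. 2 \<le> x \<and> x \<le> Suc n \<and> x < k \<and> (k = Suc (Suc n) \<longrightarrow> i \<le> x)}"

lemma greedy_path:
  assumes i: "2 < i" "i < Suc n" and k: "i < k" "k \<le> Suc (Suc n)"
  defines "s \<equiv> (if k \<le> Suc n then 2 else Suc n)"
  obtains p where "oriented_path n \<Delta> ori p s i" "path_degree G p \<le> cnt i k"
    "path_verts p \<subseteq> verts_bound s i k"
proof -
  interpret g: oriented_greedy n \<Delta> ori i k
    by unfold_locales (use i k in auto)
  have src: "g.src = s" by (simp add: g.src_def s_def)
  obtain p where p: "directed_path G ori p" "org G (hd p) = bdry G (old g.src)" "dest G (last p) = bdry G (old i)"
    "\<forall>e \<in> D. face_of (arc e) \<in> faces_left_of G p \<longrightarrow> g.S e"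
    "kap ` set (map fst p @ [snd (last p)]) \<subseteq> insert (Boundary (old i)) (g.greedy_verts i)"
    by (rule g.greedy_path_ex)
  interpret q: oriented_path n \<Delta> ori p s i
    by unfold_locales (use p i src in \<open>auto simp: s_def\<close>)
  have "{e \<in> D. snd e \<noteq> Suc (fst e) \<and> e \<noteq> (2, Suc n) \<and> e \<in> q.L} \<subseteq> {e \<in> Diag. i \<le> fst e \<or> k \<le> snd e}"
    using p(4) by (auto simp: q.L_def Diag_def g.S_def)
  then have deg: "path_degree G p \<le> cnt i k"
    unfolding q.path_degree_eq cnt_def using finite_Diag by (intro card_mono) auto
  have up: "2 \<le> x \<and> x \<le> Suc n \<and> x < k \<and> (k = Suc (Suc n) \<longrightarrow> i \<le> x) \<and> (x \<noteq> s \<longrightarrow> 2 < x \<and> x < Suc n)" if x: "x \<in> g.up i" for x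
  proof -
    note u = g.up_props[OF i k(1) x]
    \<comment> \<open>No base reaches \<open>n + 2\<close>, so only the first alternative of the
      last claim in \<open>up_props\<close> remains.\<close>
    have "i \<le> x" if "k = Suc (Suc n)"
    proof (cases "x = s")
      case True
      then show ?thesis using that i by (simp add: s_def)
    next
      case False
      then have "rgt x \<le> Suc n" using u(2) src base_bounds[of x] by auto
      then show ?thesis using u(4) False src that by auto
    qed
    then show ?thesis using u(1,2) src n_ge by (auto simp: s_def)
  qed
  have "path_verts p \<subseteq> verts_bound s i k"
  proof
    fix v assume "v \<in> path_verts p"
    then have "v \<in> insert (Boundary (old i)) (g.greedy_verts i)" using p(5) by (auto simp: path_verts_def)
    then show "v \<in> verts_bound s i k"
      unfolding verts_bound_def g.greedy_verts_def src using up by blast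
  qed
  then show thesis using that deg q.oriented_path_axioms by blast
qed

end

lemma (in oriented_path) cnt_le_path_degree:
  assumes "\<And>e. e \<in> D \<Longrightarrow> i \<le> fst e \<or> k \<le> snd e \<Longrightarrow> e \<in> L"
  shows "cnt i k \<le> path_degree G p"
  unfolding path_degree_eq cnt_def using finite_D assms by (intro card_mono) (auto simp: Diag_def)

section \<open>Lower bounds for the degrees of paths\<close>

context oriented_disk
begin

text \<open>A chord ending at \<open>Suc n\<close> cannot lie below a side
  \<open>(lft c, c)\<close>, since apexes are smaller than \<open>Suc n\<close>; so
  \<open>left_or_right\<close> puts it on the left.\<close>

lemma lower_left:
  assumes "oriented_path n \<Delta> ori p 2 i"
  shows "cnt i (Suc n) \<le> path_degree G p"
proof -
  interpret q: oriented_path n \<Delta> ori p 2 i by fact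
  have "e \<in> q.L" if e: "e \<in> D" "i \<le> fst e \<or> Suc n \<le> snd e" for e
  proof -
    obtain a b where ab: "e = (a, b)" by (cases e)
    show ?thesis using q.vis.left_or_right[of a b] e q.V_bounds(2) by (force simp: ab)
  qed
  then show ?thesis by (rule q.cnt_le_path_degree)
qed

text \<open>The bound \<open>Suc (Suc n)\<close> is beyond all points, so only the diagonals
  starting at or after \<open>j\<close> are counted.\<close>

lemma lower_right:
  assumes "oriented_path n \<Delta> ori p (Suc n) j"
  shows "cnt j (Suc (Suc n)) \<le> path_degree G p"
proof -
  interpret q: oriented_path n \<Delta> ori p "Suc n" j by fact
  have "e \<in> q.L" if e: "e \<in> D" "j \<le> fst e \<or> Suc (Suc n) \<le> snd e" for e
  proof -
    obtain a b where ab: "e = (a, b)" by (cases e)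
    show ?thesis using q.vis.left_or_right[of a b] e D_range[of a b] by (auto simp: ab)
  qed
  then show ?thesis by (rule q.cnt_le_path_degree)
qed

text \<open>A chord ending at or after \<open>j\<close> but not on the left of \<open>p\<close>
  would lie below \<open>(lft c, c)\<close> for some \<open>c\<close> visited by \<open>p\<close>,
  with j < c. The path \<open>q\<close> to \<open>j\<close> leaves this interval at
  \<open>lft c\<close>, as \<open>c\<close> belongs to \<open>p\<close>, and then
  \<open>(lft c, c)\<close> contradicts \<open>no_crossing\<close>.\<close>

lemma lower_pair:
  assumes p: "oriented_path n \<Delta> ori p 2 i" and q: "oriented_path n \<Delta> ori q (Suc n) j"
    and disj: "path_verts p \<inter> path_verts q = {}"
  shows "i < j" "cnt i j \<le> path_degree G p"
proof -
  interpret p: oriented_path n \<Delta> ori p 2 i by fact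
  interpret q: oriented_path n \<Delta> ori q "Suc n" j by fact
  have "p.V \<inter> q.V = {}"
    using disj unfolding p.V_def q.V_def p.X_def q.X_def path_verts_def by blast
  then interpret tp: two_paths "Suc n" D p.V q.V i j
    by unfold_locales
  show ij: "i < j" by (rule tp.targets_ordered)
  have "e \<in> p.L" if e: "e \<in> D" "i \<le> fst e \<or> j \<le> snd e" for e
  proof -
    obtain a b where ab: "e = (a, b)" by (cases e)
    show ?thesis
    proof (rule ccontr)
      assume "e \<notin> p.L"
      then obtain c where c: "c \<in> p.V" "a < i" "lft c \<le> a" "b \<le> c"
        using p.vis.left_or_right[of a b] e by (auto simp: ab)
      then have jb: "j \<le> b" using e by (auto simp: ab)
      have "j \<noteq> c" using c(1) q.V_target \<open>p.V \<inter> q.V = {}\<close> by auto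
      then have "j < c" using jb c by auto
      have D: "(lft c, c) \<in> D" using base p.V_bounds c(1) by blast
      have "lft c \<in> insert (Suc n) q.V \<or> c \<in> insert (Suc n) q.V"
        using q.vis.exit[OF D _ \<open>j < c\<close> q.V_target] c ij by simp
      moreover have "c \<notin> insert (Suc n) q.V" using c(1) p.V_bounds(2) \<open>p.V \<inter> q.V = {}\<close> by auto
      moreover have "lft c \<noteq> Suc n" using D_range[OF D] by auto
      ultimately show False using tp.no_crossing[OF D] c(1) by auto
    qed
  qed
  then show "cnt i j \<le> path_degree G p" by (rule p.cnt_le_path_degree)
qed

section \<open>Minimal degree of a flow\<close>

lemma bdry_eq_iff: "bdry G m = bdry G m' \<longleftrightarrow> m = m'"
  by (simp add: merge_iff)

lemma is_flowD:
  assumes "is_flow G ori J P"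
  shows "p \<in> P \<Longrightarrow> directed_path G ori p"
    "pairwise (\<lambda>p q. set (walk_verts G p) \<inter> set (walk_verts G q) = {}) P"
    "(\<lambda>p. org G (hd p)) ` P = bdry G ` (source_set G ori - J)"
    "(\<lambda>p. dest G (last p)) ` P = bdry G ` (J - source_set G ori)"
proof -
  note f = assms[unfolded is_flow_def]
  show "p \<in> P \<Longrightarrow> directed_path G ori p" by (rule bspec[OF conjunct1[OF conjunct2[OF f]]])
  note f = conjunct2[OF conjunct2[OF f]]
  show "pairwise (\<lambda>p q. set (walk_verts G p) \<inter> set (walk_verts G q) = {}) P" by (rule conjunct1[OF f])
  show "(\<lambda>p. org G (hd p)) ` P = bdry G ` (source_set G ori - J)" by (rule conjunct1[OF conjunct2[OF f]])
  show "(\<lambda>p. dest G (last p)) ` P = bdry G ` (J - source_set G ori)" by (rule conjunct2[OF conjunct2[OF f]])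
qed

lemma flow_start_inj:
  assumes "is_flow G ori J P" "p \<in> P" "q \<in> P" "org G (hd p) = org G (hd q) \<or> dest G (last p) = dest G (last q)"
  shows "p = q"
proof (rule ccontr)
  assume "p \<noteq> q"
  have disj: "set (walk_verts G p) \<inter> set (walk_verts G q) = {}"
    using pairwiseD[OF is_flowD(2)[OF assms(1)] assms(2,3) \<open>p \<noteq> q\<close>] .
  have mem: "org G (hd r) \<in> set (walk_verts G r) \<and> dest G (last r) \<in> set (walk_verts G r)" if "r \<in> P" for r
  proof -
    have "r \<noteq> []" using is_flowD(1)[OF assms(1) that] by (simp add: directed_path_def)
    then show ?thesis using hd_in_set[of r] by (simp add: walk_verts_def del: G_simps)
  qed
  show False using assms(4) disj mem[OF assms(2)] mem[OF assms(3)] by (elim disjE) (metis disjoint_iff)+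
qed

lemma oriented_pathI:
  assumes "is_flow G ori J P" "p \<in> P" "org G (hd p) = bdry G (old s)" "dest G (last p) = bdry G (old j)"
    "s = 2 \<or> s = Suc n" "2 < j" "j < Suc n"
  shows "oriented_path n \<Delta> ori p s j"
proof
  show "directed_path G ori p" using is_flowD(1)[OF assms(1,2)] .
qed (use assms in simp_all)

lemma single_flow:
  assumes p: "oriented_path n \<Delta> ori p s j" and J: "source_set G ori - J = {old s}" "J - source_set G ori = {old j}"
  shows "is_flow G ori J {p}" "flow_degree G {p} = path_degree G p"
proof -
  interpret p: oriented_path n \<Delta> ori p s j by fact
  show "is_flow G ori J {p}" unfolding is_flow_def J using p.path p.start p.target by (simp add: pairwise_def)
  show "flow_degree G {p} = path_degree G p" by (simp add: flow_degree_def)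
qed

lemma single_flowD:
  assumes P: "is_flow G ori J P" and J: "source_set G ori - J = {old s}" "J - source_set G ori = {old j}"
    and sj: "s = 2 \<or> s = Suc n" "2 < j" "j < Suc n"
  obtains p where "oriented_path n \<Delta> ori p s j" "flow_degree G P = path_degree G p"
proof -
  have im: "(\<lambda>p. org G (hd p)) ` P = {bdry G (old s)}" "(\<lambda>p. dest G (last p)) ` P = {bdry G (old j)}"
    using is_flowD(3,4)[OF P] unfolding J by simp_all
  have "bdry G (old s) \<in> (\<lambda>p. org G (hd p)) ` P" unfolding im(1) by (rule singletonI)
  then obtain p where p1: "bdry G (old s) = org G (hd p)" "p \<in> P" by (rule imageE)
  have "dest G (last p) \<in> {bdry G (old j)}"
    using imageI[OF p1(2), of "\<lambda>p. dest G (last p)"] unfolding im(2) .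
  then have p: "p \<in> P" "org G (hd p) = bdry G (old s)" "dest G (last p) = bdry G (old j)"
    using p1 by (simp_all only: singleton_iff)
  have "q = p" if "q \<in> P" for q
  proof (rule flow_start_inj[OF P that p(1)])
    have "org G (hd q) \<in> {bdry G (old s)}"
      using imageI[OF that, of "\<lambda>p. org G (hd p)"] unfolding im(1) .
    then show "org G (hd q) = org G (hd p) \<or> dest G (last q) = dest G (last p)" unfolding p(2) by blast
  qed
  then have "P = {p}" using p(1) by blast
  then show thesis using that[OF oriented_pathI[OF P p sj]] by (simp add: flow_degree_def)
qed

lemma source_diffs:
  assumes "2 \<le> i" "i < j" "j \<le> Suc n"
  shows "source_set G ori - {old i, old j} = (if i = 2 then {} else {old 2}) \<union> (if j = Suc n then {} else {old (Suc n)})"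
    "{old i, old j} - source_set G ori = (if i = 2 then {} else {old i}) \<union> (if j = Suc n then {} else {old j})"
  using assms n_ge unfolding sources by (auto simp: old_def)

text \<open>For i = 2 or j = n + 1 the corresponding source belongs to the prescribed set and no
  path starts there. For j = n + 1 the term \<open>cnt i j\<close> is already the bound for a path
  from \<open>2\<close> alone.\<close>

definition flow_min :: "nat \<Rightarrow> nat \<Rightarrow> nat" where
  "flow_min i j = (if i = 2 then 0 else cnt i j) + (if j = Suc n then 0 else cnt j (Suc (Suc n)))"

lemma flow_exists:
  assumes ij: "2 \<le> i" "i < j" "j \<le> Suc n"
  shows "\<exists>P. is_flow G ori {old i, old j} P \<and> flow_degree G P \<le> flow_min i j"
proof -
  note J = source_diffs[OF ij]
  consider "i = 2" "j = Suc n" | "i = 2" "j < Suc n" | "2 < i" "j = Suc n" | "2 < i" "j < Suc n" using ij by linarith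
  then show ?thesis
  proof cases
    case 1
    then have "is_flow G ori {old i, old j} {}" unfolding is_flow_def J by simp
    then show ?thesis by (intro exI[of _ "{}"]) (simp add: flow_degree_def)
  next
    case 2
    obtain p where p: "oriented_path n \<Delta> ori p (Suc n) j" "path_degree G p \<le> cnt j (Suc (Suc n))"
      using greedy_path[of j "Suc (Suc n)"] 2 ij by auto
    then show ?thesis using single_flow[OF p(1)] J 2 by (intro exI[of _ "{p}"]) (simp add: flow_min_def)
  next
    case 3
    obtain p where p: "oriented_path n \<Delta> ori p 2 i" "path_degree G p \<le> cnt i (Suc n)"
      using greedy_path[of i "Suc n"] 3 ij by auto
    then show ?thesis using single_flow[OF p(1)] J 3 by (intro exI[of _ "{p}"]) (simp add: flow_min_def)
  next
    case 4
    obtain p where p: "oriented_path n \<Delta> ori p 2 i" "path_degree G p \<le> cnt i j"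
      and "path_verts p \<subseteq> verts_bound 2 i j"
      using greedy_path[of i j] 4 ij by auto
    then have pv: "path_verts p \<subseteq> {Boundary (old 2), Boundary (old i)} \<union> {Centre (tri x) | x. 2 < x \<and> x < Suc n \<and> x < j} \<union>
        {Marked (old x) | x. 2 \<le> x \<and> x \<le> Suc n \<and> x < j}"
      unfolding verts_bound_def by blast
    obtain q where q: "oriented_path n \<Delta> ori q (Suc n) j" "path_degree G q \<le> cnt j (Suc (Suc n))"
      and "path_verts q \<subseteq> verts_bound (Suc n) j (Suc (Suc n))"
      using greedy_path[of j "Suc (Suc n)"] 4 ij by auto
    then have qv: "path_verts q \<subseteq> {Boundary (old (Suc n)), Boundary (old j)} \<union> {Centre (tri x) | x. 2 < x \<and> x < Suc n \<and> j \<le> x} \<union>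
        {Marked (old x) | x. 2 \<le> x \<and> x \<le> Suc n \<and> j \<le> x}"
      unfolding verts_bound_def by blast
    \<comment> \<open>Coloured vertices of \<open>p\<close> carry points below \<open>j\<close>,
      those of \<open>q\<close> points from \<open>j\<close> on; the four boundary vertices are
      distinct.\<close>
    have "path_verts p \<inter> path_verts q = {}"
    proof (rule ccontr)
      assume "path_verts p \<inter> path_verts q \<noteq> {}"
      then obtain v where v: "v \<in> path_verts p" "v \<in> path_verts q" by blast
      show False
      proof (cases v)
        case (Centre t)
        then obtain x y where "t = tri x" "2 < x" "x < Suc n" "x < j" "t = tri y" "2 < y" "y < Suc n" "j \<le> y"
          using subsetD[OF pv v(1)] subsetD[OF qv v(2)] by auto
        then show False using tri_eq_iff[of x y] by auto
      next
        case (Marked m)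
        obtain x where "m = old x" "2 \<le> x" "x < j" using subsetD[OF pv v(1)] Marked by auto
        moreover obtain y where "m = old y" "2 \<le> y" "j \<le> y" using subsetD[OF qv v(2)] Marked by auto
        ultimately show False using old_inj[of x y] by auto
      next
        case (Boundary m)
        then have "m = old 2 \<or> m = old i" "m = old (Suc n) \<or> m = old j"
          using subsetD[OF pv v(1)] subsetD[OF qv v(2)] by auto
        then show False using 4 ij n_ge by (auto simp: old_def split: if_splits)
      qed
    qed
    then have disj: "set (walk_verts G p) \<inter> set (walk_verts G q) = {}" using walk_verts_disjoint by blast
    interpret p: oriented_path n \<Delta> ori p 2 i by fact
    interpret q: oriented_path n \<Delta> ori q "Suc n" j by fact
    have "p \<noteq> q" using disj by (auto simp: walk_verts_def)
    have "is_flow G ori {old i, old j} {p, q}"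
      unfolding is_flow_def J using 4 p.path q.path p.start q.start p.target q.target disj
      by (auto simp: pairwise_def)
    then show ?thesis using p(2) q(2) 4 \<open>p \<noteq> q\<close>
      by (intro exI[of _ "{p, q}"]) (auto simp: flow_degree_def flow_min_def)
  qed
qed

lemma flow_min_le:
  assumes ij: "2 \<le> i" "i < j" "j \<le> Suc n" and P: "is_flow G ori {old i, old j} P"
  shows "flow_min i j \<le> flow_degree G P"
proof -
  note J = source_diffs[OF ij]
  consider "i = 2" "j = Suc n" | "i = 2" "j < Suc n" | "2 < i" "j = Suc n" | "2 < i" "j < Suc n" using ij by linarith
  then show ?thesis
  proof cases
    case 1
    then show ?thesis by (simp add: flow_min_def)
  next
    case 2
    obtain p where "oriented_path n \<Delta> ori p (Suc n) j" "flow_degree G P = path_degree G p"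
      using single_flowD[OF P, of "Suc n" j] J 2 ij by auto
    then show ?thesis using lower_right 2 by (simp add: flow_min_def)
  next
    case 3
    obtain p where "oriented_path n \<Delta> ori p 2 i" "flow_degree G P = path_degree G p"
      using single_flowD[OF P, of 2 i] J 3 ij by auto
    then show ?thesis using lower_left 3 by (simp add: flow_min_def)
  next
    case 4
    have im: "(\<lambda>p. org G (hd p)) ` P = {bdry G (old 2), bdry G (old (Suc n))}"
      "(\<lambda>p. dest G (last p)) ` P = {bdry G (old i), bdry G (old j)}"
      using is_flowD(3,4)[OF P] 4 unfolding J by auto
    have "bdry G (old 2) \<in> (\<lambda>p. org G (hd p)) ` P" unfolding im(1) by (rule insertI1)
    then obtain p where p': "bdry G (old 2) = org G (hd p)" "p \<in> P" by (rule imageE)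
    note p = p'(2) p'(1)[symmetric]
    have "bdry G (old (Suc n)) \<in> (\<lambda>p. org G (hd p)) ` P" unfolding im(1) by (rule insertI2[OF singletonI])
    then obtain q where q': "bdry G (old (Suc n)) = org G (hd q)" "q \<in> P" by (rule imageE)
    note q = q'(2) q'(1)[symmetric]
    have ne: "old 2 \<noteq> old (Suc n)" "old i \<noteq> old j" using n_ge ij by (auto simp: old_def)
    then have "p \<noteq> q" using p q bdry_eq_iff by metis
    have "r = p \<or> r = q" if "r \<in> P" for r
    proof -
      have "org G (hd r) \<in> {bdry G (old 2), bdry G (old (Suc n))}"
        using imageI[OF that, of "\<lambda>p. org G (hd p)"] unfolding im(1) .
      then have "org G (hd r) = org G (hd p) \<or> org G (hd r) = org G (hd q)" unfolding p(2) q(2) by blast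
      then show ?thesis using flow_start_inj[OF P that p(1)] flow_start_inj[OF P that q(1)] by blast
    qed
    then have Peq: "P = {p, q}" using p(1) q(1) by blast
    have d: "flow_degree G P = path_degree G p + path_degree G q"
      using \<open>p \<noteq> q\<close> by (simp add: flow_degree_def Peq)
    have "set (walk_verts G p) \<inter> set (walk_verts G q) = {}"
      using pairwiseD[OF is_flowD(2)[OF P] p(1) q(1) \<open>p \<noteq> q\<close>] .
    then have disj: "path_verts p \<inter> path_verts q = {}" using walk_verts_disjoint by blast
    have "{dest G (last p), dest G (last q)} = {bdry G (old i), bdry G (old j)}" using im(2) by (simp add: Peq)
    then consider "dest G (last p) = bdry G (old i)" "dest G (last q) = bdry G (old j)"
      | "dest G (last p) = bdry G (old j)" "dest G (last q) = bdry G (old i)"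
      by (auto simp only: doubleton_eq_iff)
    then show ?thesis
    proof cases
      case 1
      have p': "oriented_path n \<Delta> ori p 2 i" using oriented_pathI[OF P p 1(1)] 4 ij by simp
      have q': "oriented_path n \<Delta> ori q (Suc n) j" using oriented_pathI[OF P q 1(2)] 4 ij by simp
      show ?thesis
        using lower_pair(2)[OF p' q' disj] lower_right[OF q'] d 4 by (simp add: flow_min_def)
    next
      \<comment> \<open>Exchanged targets would give j < i by the ordering of disjoint
        paths.\<close>
      case 2
      have p': "oriented_path n \<Delta> ori p 2 j" using oriented_pathI[OF P p 2(1)] 4 ij by simp
      have q': "oriented_path n \<Delta> ori q (Suc n) i" using oriented_pathI[OF P q 2(2)] 4 ij by simp
      show ?thesis using lower_pair(1)[OF p' q' disj] ij by simp
    qed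
  qed
qed

text \<open>The pair enters as a set because the label 1 comes first in \<open>pairs n\<close> but
  last after relabelling.\<close>

lemma plabic_weight_eq:
  assumes ij: "2 \<le> i" "i < j" "j \<le> Suc n" and ab: "{a, b} = {old i, old j}"
  shows "plabic_weight G ori (a, b) = real (flow_min i j)"
proof -
  obtain P where P: "is_flow G ori {old i, old j} P" "flow_degree G P \<le> flow_min i j"
    using flow_exists[OF ij] by blast
  have "(LEAST k. \<exists>P. is_flow G ori {old i, old j} P \<and> k = flow_degree G P) = flow_min i j"
  proof (rule Least_equality)
    show "\<exists>P. is_flow G ori {old i, old j} P \<and> flow_min i j = flow_degree G P"
      using P flow_min_le[OF ij P(1)] by (intro exI[of _ P]) simp
    show "flow_min i j \<le> k" if "\<exists>P. is_flow G ori {old i, old j} P \<and> k = flow_degree G P" for k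
      using that flow_min_le[OF ij] by auto
  qed
  then show ?thesis by (simp add: plabic_weight_def ab)
qed

end

section \<open>Paths in the dual tree\<close>

lemma walk_no_flip:
  assumes "successively (\<lambda>x y. {x, y} \<in> E) p" "p \<noteq> []" "u \<notin> set p"
    "\<And>x y. {x, y} \<in> E \<Longrightarrow> s x \<noteq> s y \<Longrightarrow> u \<in> {x, y}"
  shows "s (hd p) = s (last p)"
  using assms(1-3)
proof (induction p)
  case (Cons x p)
  show ?case
  proof (cases p)
    case (Cons y q)
    then have "{x, y} \<in> E" "u \<notin> {x, y}" using Cons.prems by auto
    then have "s x = s y" using assms(4) by blast
    then show ?thesis using Cons.IH Cons.prems Cons by simp
  qed simp
qed simp

text \<open>Every edge of a tree is a bridge; the two sides of a bridge are given by a predicate that changes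
  its value along that edge only.\<close>

lemma unique_simple_path:
  assumes bridge: "\<And>x y. {x, y} \<in> E \<Longrightarrow>
      \<exists>s :: 'a \<Rightarrow> bool. s x \<noteq> s y \<and> (\<forall>x' y'. {x', y'} \<in> E \<longrightarrow> s x' \<noteq> s y' \<longrightarrow> {x', y'} = {x, y})"
    and p: "successively (\<lambda>x y. {x, y} \<in> E) p" "distinct p" "p \<noteq> []"
    and q: "successively (\<lambda>x y. {x, y} \<in> E) q" "distinct q" "q \<noteq> []"
    and "hd p = hd q" "last p = last q"
  shows "p = q"
  using assms(2-)
proof (induction p arbitrary: q)
  case (Cons u p)
  obtain q' where q': "q = u # q'" using Cons.prems by (cases q) auto
  show ?case
  proof (cases "p = [] \<or> q' = []")
    case True
    have "last (u # p) = last (u # q')" using Cons.prems q' by simp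
    then have "p = []" "q' = []"
      using True Cons.prems(2,5) q' last_in_set[of p] last_in_set[of q'] by (auto split: if_splits)
    then show ?thesis using q' by simp
  next
    case False
    then obtain y p1 z q1 where yz: "p = y # p1" "q' = z # q1" by (metis list.exhaust)
    have "y = z"
    \<comment> \<open>The bridge from \<open>u\<close> to \<open>y\<close> separates
      \<open>u\<close> from \<open>y\<close>. Both remaining paths avoid \<open>u\<close>, so
      neither crosses it; one stays on the side of \<open>y\<close>, the other on the side of
      \<open>u\<close>, and they cannot end at the same vertex.\<close>
    proof (rule ccontr)
      assume "y \<noteq> z"
      have E: "{u, y} \<in> E" "{u, z} \<in> E" using Cons.prems q' yz by auto
      obtain s :: "'a \<Rightarrow> bool" where s: "s u \<noteq> s y"
        and s': "\<forall>x' y'. {x', y'} \<in> E \<longrightarrow> s x' \<noteq> s y' \<longrightarrow> {x', y'} = {u, y}"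
        using bridge[OF E(1)] by (elim exE conjE)
      note s = s s'[rule_format]
      have flip: "u \<in> {x', y'}" if "{x', y'} \<in> E" "s x' \<noteq> s y'" for x' y' using s(2)[OF that] by blast
      have "s (hd p) = s (last p)"
        by (rule walk_no_flip[of E p u, OF _ _ _ flip]) (use Cons.prems yz in auto)
      moreover have "s (hd q') = s (last q')"
        by (rule walk_no_flip[of E q' u, OF _ _ _ flip]) (use Cons.prems q' yz in auto)
      moreover have "last p = last q'" using Cons.prems q' yz by simp
      moreover have "s u = s z"
      proof (rule ccontr)
        assume "s u \<noteq> s z"
        then have "{u, z} = {u, y}" using s(2)[OF E(2)] by simp
        then show False using \<open>y \<noteq> z\<close> by (auto simp: doubleton_eq_iff)
      qed
      ultimately show False using s(1) yz by simp
    qed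
    moreover have "p = q'"
      by (rule Cons.IH) (use Cons.prems q' yz calculation in auto)
    ultimately show ?thesis using q' by simp
  qed
qed simp

lemma simple_path_ex:
  assumes "(u, v) \<in> {(x, y). {x, y} \<in> E}\<^sup>*"
  shows "\<exists>p. p \<noteq> [] \<and> hd p = u \<and> last p = v \<and> distinct p \<and> successively (\<lambda>x y. {x, y} \<in> E) p"
  using assms
proof (induction rule: converse_rtrancl_induct)
  case base
  show ?case by (intro exI[of _ "[v]"]) simp
next
  case (step u y)
  then obtain p where p: "p \<noteq> []" "hd p = y" "last p = v" "distinct p" "successively (\<lambda>x y. {x, y} \<in> E) p" by blast
  show ?case
  proof (cases "u \<in> set p")
    case True
    then obtain p1 p2 where "p = p1 @ u # p2" by (meson split_list)
    then show ?thesis using p by (intro exI[of _ "u # p2"]) (auto simp: successively_append_iff)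
  next
    case False
    then show ?thesis using p step by (intro exI[of _ "u # p"]) (auto simp: successively_Cons)
  qed
qed

section \<open>The two sides of a diagonal in the tree\<close>

context disk
begin

text \<open>The part of the tree below the chord \<open>e\<close>. The leaf of the arc from i to i +
  1 is labelled i + 1, so leaf m hangs at the side from m - 1 to m; hence the half-open
  interval.\<close>

definition side :: "nat \<times> nat \<Rightarrow> tree_vertex \<Rightarrow> bool" where
  "side e v = (case v of Node t \<Rightarrow> t \<in> tri ` {fst e<..<snd e} | Leaf m \<Rightarrow> m \<in> old ` {fst e<..snd e})"

lemma side_Node:
  assumes "e \<in> D" "2 < c" "c < Suc n"
  shows "side e (Node (tri c)) \<longleftrightarrow> fst e < c \<and> c < snd e"
proof -
  have r: "2 \<le> fst e" "snd e \<le> Suc n" using assms(1) D_range[of "fst e" "snd e"] by auto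
  have "x = c" if "fst e < x" "x < snd e" "tri c = tri x" for x
    using tri_eq_iff[of c x] that assms(2,3) r by simp
  then show ?thesis by (auto simp: side_def)
qed

lemma side_Leaf:
  assumes "e \<in> D" "2 \<le> x"
  shows "side e (Leaf (old x)) \<longleftrightarrow> fst e < x \<and> x \<le> snd e"
proof -
  have r: "2 \<le> fst e" using assms(1) D_range[of "fst e" "snd e"] by auto
  have "y = x" if "fst e < y" "y \<le> snd e" "old x = old y" for y
    using old_inj[of x y] that r assms(2) by auto
  then show ?thesis by (auto simp: side_def)
qed

definition above_chord :: "nat \<times> nat \<Rightarrow> nat \<Rightarrow> bool" where
  "above_chord e d \<longleftrightarrow> 2 < d \<and> d < Suc n \<and> (fst e = d \<and> snd e = rgt d \<or> snd e = d \<and> fst e = lft d)"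

lemma above_chord_unique:
  assumes "above_chord e d" "above_chord e d'"
  shows "d = d'"
proof -
  have False if "above_chord e a" "above_chord e b" "fst e = a" "snd e = rgt a" "snd e = b" "fst e = lft b" for a b
    by (rule upper_not_both[of a b]) (use that in \<open>simp_all add: above_chord_def\<close>)
  then show ?thesis using assms unfolding above_chord_def by metis
qed

text \<open>Each edge crosses one chord, with a triangle below it and one above it. At a side a leaf
  replaces the lower triangle, and at \<open>(2, Suc n)\<close> the leaf 2 replaces the upper
  one.\<close>

lemma tree_edgeE:
  assumes "{x, y} \<in> tree_edges n \<Delta>"
  obtains (inner) c d where "2 < c" "c < Suc n" "above_chord (lft c, rgt c) d" "{x, y} = {Node (tri c), Node (tri d)}"
    | (leaf) c m where "2 < c" "c < Suc n" "2 < m" "m \<le> Suc n" "above_chord (m - 1, m) c" "{x, y} = {Node (tri c), Leaf (old m)}"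
    | (root) c where "2 < c" "c < Suc n" "lft c = 2" "rgt c = Suc n" "{x, y} = {Node (tri c), Leaf (old 2)}"
proof -
  have mem: "old a \<in> tri c \<longleftrightarrow> a = lft c \<or> a = c \<or> a = rgt c" if "2 \<le> a" "2 < c" "c < Suc n" for a c
    using that base_bounds[of c] by (auto simp: tri_def old_inj)
  have pos: "above_chord (a, b) c \<or> a = lft c \<and> b = rgt c"
    if "2 \<le> a" "a < b" "old a \<in> tri c" "old b \<in> tri c" "2 < c" "c < Suc n" for a b c
  proof -
    have "a = lft c \<or> a = c \<or> a = rgt c" "b = lft c \<or> b = c \<or> b = rgt c"
      using that mem[of a c] mem[of b c] by simp_all
    then show ?thesis
      using that(2,5,6) base_bounds[OF that(5,6)] unfolding above_chord_def
      by (elim disjE) simp_all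
  qed
  from assms consider
    (NN) t t' e where "{x, y} = {Node t, Node t'}" "t \<in> triangles \<Delta>" "t' \<in> triangles \<Delta>" "t \<noteq> t'" "e \<in> \<Delta>" "e \<subseteq> t" "e \<subseteq> t'"
    | (NL) t i where "{x, y} = {Node t, Leaf (csucc n i)}" "t \<in> triangles \<Delta>" "1 \<le> i" "i \<le> n" "{i, csucc n i} \<subseteq> t"
    unfolding tree_edges_def
  proof (elim UnE CollectE exE conjE bexE)
    fix t t' e assume "{x, y} = {Node t, Node t'}" "t \<in> triangles \<Delta>" "t' \<in> triangles \<Delta>" "t \<noteq> t'" "e \<in> \<Delta>" "e \<subseteq> t" "e \<subseteq> t'"
    then show thesis by (rule that(1))
  next
    fix t i assume "{x, y} = {Node t, Leaf (csucc n i)}" "t \<in> triangles \<Delta>" "1 \<le> i" "i \<le> n" "{i, csucc n i} \<subseteq> t"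
    then show thesis by (rule that(2))
  qed
  then show thesis
  proof cases
    case NN
    obtain c where c: "2 < c" "c < Suc n" "t = tri c" using trianglesE[OF NN(2)] .
    obtain d where d: "2 < d" "d < Suc n" "t' = tri d" using trianglesE[OF NN(3)] .
    have "c \<noteq> d" using NN c d by auto
    obtain p where p: "p \<in> D" "e = arc p" using NN(5) arc_image by blast
    obtain a b where ab: "p = (a, b)" by (cases p)
    have r: "2 \<le> a" "a < b" using p D_range[of a b] ab by auto
    have "old a \<in> tri c" "old b \<in> tri c" "old a \<in> tri d" "old b \<in> tri d"
      using NN(6,7) p ab c d by (auto simp: arc_def)
    then have "above_chord (a, b) c \<or> a = lft c \<and> b = rgt c" "above_chord (a, b) d \<or> a = lft d \<and> b = rgt d"
      using pos[OF r] c d by blast+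
    moreover have "\<not> (above_chord (a, b) c \<and> above_chord (a, b) d)" using above_chord_unique \<open>c \<noteq> d\<close> by blast
    moreover have "\<not> ((a = lft c \<and> b = rgt c) \<and> (a = lft d \<and> b = rgt d))"
      using base_inj[of c d] c d \<open>c \<noteq> d\<close> by auto
    ultimately consider "a = lft c" "b = rgt c" "above_chord (a, b) d" | "a = lft d" "b = rgt d" "above_chord (a, b) c" by blast
    then show thesis
    proof cases
      case 1
      then show thesis using inner[of c d] NN(1) c d by simp
    next
      case 2
      then show thesis using inner[of d c] NN(1) c d by (simp add: insert_commute)
    qed
  next
    case NL
    obtain c where c: "2 < c" "c < Suc n" "t = tri c" using trianglesE[OF NL(2)] .
    obtain v where v: "2 \<le> v" "v \<le> Suc n" "i = old v" using old_surj NL by blast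
    show thesis
    proof (cases "v = Suc n")
      case True
      then have cs: "csucc n i = old 2" using v csucc_old by simp
      then have "old 2 \<in> tri c" "old (Suc n) \<in> tri c" using NL(5) c v True by auto
      then have "above_chord (2, Suc n) c \<or> 2 = lft c \<and> Suc n = rgt c" using pos[of 2 "Suc n" c] c n_ge by auto
      then have "lft c = 2" "rgt c = Suc n" using c by (auto simp: above_chord_def)
      then show thesis using root[of c] NL(1) c cs by simp
    next
      case False
      then have cs: "csucc n i = old (Suc v)" using v csucc_old by simp
      then have "old v \<in> tri c" "old (Suc v) \<in> tri c" using NL(5) c v by auto
      then have "above_chord (v, Suc v) c \<or> v = lft c \<and> Suc v = rgt c" using pos[of v "Suc v" c] c v by auto
      then have "above_chord (v, Suc v) c" using base_bounds[of c] c by auto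
      then show thesis using leaf[of c "Suc v"] NL(1) c cs v False by simp
    qed
  qed
qed

lemma lower_in_Diag:
  assumes "2 < c" "c < Suc n" "above_chord (lft c, rgt c) d"
  shows "(lft c, rgt c) \<in> Diag"
  using assms base[of c] base_bounds[of c] by (auto simp: Diag_def above_chord_def)

text \<open>Another diagonal passing over the lower triangle only would start or end at the apex of
  the upper one and cross the base of the latter.\<close>

lemma side_inner:
  assumes e: "e \<in> Diag" and c: "2 < c" "c < Suc n" and d: "above_chord (lft c, rgt c) d"
  shows "side e (Node (tri c)) \<noteq> side e (Node (tri d)) \<longleftrightarrow> e = (lft c, rgt c)"
proof -
  obtain a b where ab: "e = (a, b)" by (cases e)
  have D: "(a, b) \<in> D" using e by (simp add: Diag_def ab)
  have dr: "2 < d" "d < Suc n" using d by (auto simp: above_chord_def)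
  note bc = base[OF c] base_bounds[OF c] and bd = base[OF dr] base_bounds[OF dr]
  have s: "side e (Node (tri c)) \<longleftrightarrow> a < c \<and> c < b" "side e (Node (tri d)) \<longleftrightarrow> a < d \<and> d < b"
    using side_Node[OF D] c dr by (auto simp: ab)
  have up: "a < c \<and> c < b" if "a < d" "d < b"
    using base_below[OF D that] d bc bd by (auto simp: above_chord_def)
  have down: "a < d \<and> d < b" if "a < c" "c < b" "(a, b) \<noteq> (lft c, rgt c)"
  proof -
    note bb = base_below[OF D that(1,2)]
    from d consider "d = lft c" "rgt d = rgt c" | "d = rgt c" "lft d = lft c" by (auto simp: above_chord_def)
    then show ?thesis
    proof cases
      case 1
      have "a \<noteq> d"
        using D_nc[OF bd(1) D] bb that 1 bd bc by auto
      then show ?thesis using bb 1 that bc by auto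
    next
      case 2
      have "b \<noteq> d"
        using D_nc[OF D bd(1)] bb that 2 bd bc by auto
      then show ?thesis using bb 2 that bc by auto
    qed
  qed
  show ?thesis
    using up down s d bc by (auto simp: ab above_chord_def)
qed

text \<open>A diagonal that separates the leaf from its triangle would have an end at the apex
  \<open>c\<close>, pass over the side of the leaf, and cross the base of the triangle.\<close>

lemma side_leaf:
  assumes e: "e \<in> Diag" and c: "2 < c" "c < Suc n" and m: "2 < m" "m \<le> Suc n" and d: "above_chord (m - 1, m) c"
  shows "side e (Node (tri c)) = side e (Leaf (old m))"
proof -
  obtain a b where ab: "e = (a, b)" by (cases e)
  have D: "(a, b) \<in> D" "b \<noteq> Suc a" using e by (auto simp: Diag_def ab)
  note bc = base[OF c] base_bounds[OF c]
  have s: "side e (Node (tri c)) \<longleftrightarrow> a < c \<and> c < b" "side e (Leaf (old m)) \<longleftrightarrow> a < m \<and> m \<le> b"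
    using side_Node[OF D(1) c] side_Leaf[OF D(1), of m] m by (auto simp: ab)
  from d consider "c = m - 1" "rgt c = m" | "c = m" "lft c = m - 1" by (auto simp: above_chord_def)
  then show ?thesis
  proof cases
    case 1
    have "\<not> (a = c \<and> m \<le> b)"
      using D_nc[OF bc(1) D(1)] 1 bc D(2) m by auto
    then show ?thesis using s 1 m by auto
  next
    case 2
    have "\<not> (b = c \<and> a < m)"
    proof
      assume *: "b = c \<and> a < m"
      then have "a < lft c" using 2 D(2) by linarith
      then show False using D_nc[OF D(1) bc(1)] * bc by auto
    qed
    then show ?thesis using s 2 m by auto
  qed
qed

lemma side_root:
  assumes e: "e \<in> Diag" and c: "2 < c" "c < Suc n" "lft c = 2" "rgt c = Suc n"
  shows "side e (Node (tri c)) = side e (Leaf (old 2))"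
proof -
  obtain a b where ab: "e = (a, b)" by (cases e)
  have D: "(a, b) \<in> D" "(a, b) \<noteq> (2, Suc n)" using e by (auto simp: Diag_def ab)
  have "\<not> (a < c \<and> c < b)" using base_below[OF D(1)] c D D_range[OF D(1)] by force
  moreover have "\<not> a < 2" using D_range[OF D(1)] by simp
  ultimately show ?thesis using side_Node[OF D(1) c(1,2)] side_Leaf[OF D(1), of 2] by (simp add: ab)
qed

lemma side_flip:
  assumes c: "2 < c" "c < Suc n" "above_chord (lft c, rgt c) d"
    and E: "{x, y} \<in> tree_edges n \<Delta>" and ne: "side (lft c, rgt c) x \<noteq> side (lft c, rgt c) y"
  shows "{x, y} = {Node (tri c), Node (tri d)}"
proof -
  note e = lower_in_Diag[OF c]
  from E show ?thesis
  proof (cases rule: tree_edgeE)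
    case (inner c' d')
    then have "(lft c, rgt c) = (lft c', rgt c')" using side_inner[OF e inner(1-3)] ne by (auto simp: doubleton_eq_iff)
    then have "c' = c" using base_inj[of c c'] inner(1,2) c by simp
    moreover have "d' = d" using above_chord_unique[OF inner(3)] c(3) \<open>c' = c\<close> by simp
    ultimately show ?thesis using inner(4) by simp
  next
    case (leaf c' m)
    then show ?thesis using side_leaf[OF e leaf(1-5)] ne by (auto simp: doubleton_eq_iff)
  next
    case (root c')
    then show ?thesis using side_root[OF e root(1-4)] ne by (auto simp: doubleton_eq_iff)
  qed
qed

text \<open>For an inner edge the witness is the side of the diagonal that it crosses; for the edge
  at a leaf it is the indicator of that leaf, which has no other edge.\<close>

lemma tree_bridge:
  assumes "{x, y} \<in> tree_edges n \<Delta>"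
  shows "\<exists>s :: tree_vertex \<Rightarrow> bool. s x \<noteq> s y \<and> (\<forall>x' y'. {x', y'} \<in> tree_edges n \<Delta> \<longrightarrow> s x' \<noteq> s y' \<longrightarrow> {x', y'} = {x, y})"
proof -
  have leaf_bridge: "\<exists>s :: tree_vertex \<Rightarrow> bool. s x \<noteq> s y \<and> (\<forall>x' y'. {x', y'} \<in> tree_edges n \<Delta> \<longrightarrow> s x' \<noteq> s y' \<longrightarrow> {x', y'} = {x, y})"
    if xy: "{x, y} = {Node (tri c), Leaf m}"
      and uniq: "\<And>x' y'. {x', y'} \<in> tree_edges n \<Delta> \<Longrightarrow> Leaf m \<in> {x', y'} \<Longrightarrow> {x', y'} = {Node (tri c), Leaf m}" for c m
  proof (intro exI[of _ "\<lambda>v. v = Leaf m"] conjI allI impI)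
    show "(x = Leaf m) \<noteq> (y = Leaf m)" using xy by (auto simp: doubleton_eq_iff)
    fix x' y' assume "{x', y'} \<in> tree_edges n \<Delta>" "(x' = Leaf m) \<noteq> (y' = Leaf m)"
    then show "{x', y'} = {x, y}" using uniq[of x' y'] unfolding xy by blast
  qed
  from assms show ?thesis
  proof (cases rule: tree_edgeE)
    case (inner c d)
    define e where "e = (lft c, rgt c)"
    have e: "e \<in> Diag" using lower_in_Diag[OF inner(1-3)] by (simp add: e_def)
    show ?thesis
    proof (intro exI[of _ "side e"] conjI allI impI)
      show "side e x \<noteq> side e y" using side_inner[OF e inner(1-3)] inner(4) by (auto simp: e_def doubleton_eq_iff)
      fix x' y' assume "{x', y'} \<in> tree_edges n \<Delta>" "side e x' \<noteq> side e y'"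
      then show "{x', y'} = {x, y}" using side_flip[OF inner(1-3)] inner(4) by (simp add: e_def)
    qed
  next
    case (leaf c m)
    show ?thesis
    proof (rule leaf_bridge[OF leaf(6)])
      fix x' y' assume E: "{x', y'} \<in> tree_edges n \<Delta>" and L: "Leaf (old m) \<in> {x', y'}"
      from E show "{x', y'} = {Node (tri c), Leaf (old m)}"
      proof (cases rule: tree_edgeE)
        case (leaf c' m')
        then have "Leaf (old m) = Leaf (old m')" using L by auto
        then have "m = m'" using old_inj[of m m'] leaf(3) \<open>2 < m\<close> by simp
        then have "c = c'" using above_chord_unique leaf(5) \<open>above_chord (m - 1, m) c\<close> by blast
        then show ?thesis using leaf(6) \<open>m = m'\<close> by simp
      next
        case (root c')
        then show ?thesis using L old_inj[of m 2] \<open>2 < m\<close> by auto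
      qed (use L in auto)
    qed
  next
    case (root c)
    show ?thesis
    proof (rule leaf_bridge[OF root(5)])
      fix x' y' assume E: "{x', y'} \<in> tree_edges n \<Delta>" and L: "Leaf (old 2) \<in> {x', y'}"
      from E show "{x', y'} = {Node (tri c), Leaf (old 2)}"
      proof (cases rule: tree_edgeE)
        case (leaf c' m')
        then show ?thesis using L old_inj[of m' 2] by auto
      next
        case (root c')
        then have "c = c'" using base_inj[of c c'] \<open>2 < c\<close> \<open>c < Suc n\<close> \<open>lft c = 2\<close> \<open>rgt c = Suc n\<close> by simp
        then show ?thesis using root(5) by simp
      qed (use L in auto)
    qed
  qed
qed

text \<open>An inner edge changes the side of exactly its own diagonal, and the rest of the path
  cannot change it back without returning to \<open>x\<close>. Edges at leaves change no
  side.\<close>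

lemma internal_edge_count_eq:
  assumes "p \<noteq> []" "distinct p" "successively (\<lambda>x y. {x, y} \<in> tree_edges n \<Delta>) p"
  shows "internal_edge_count p = card {e \<in> Diag. side e (hd p) \<noteq> side e (last p)}"
  using assms
proof (induction p)
  case (Cons x p)
  show ?case
  proof (cases p)
    case Nil
    then show ?thesis by simp
  next
    case p: (Cons y q)
    have E: "{x, y} \<in> tree_edges n \<Delta>" using Cons.prems p by simp
    have walk: "successively (\<lambda>x y. {x, y} \<in> tree_edges n \<Delta>) p" using Cons.prems p by simp
    have IH: "internal_edge_count p = card {e \<in> Diag. side e y \<noteq> side e (last p)}"
      using Cons.IH Cons.prems p by simp
    have noflip: "internal_edge_count (x # p) = card {e \<in> Diag. side e (hd (x # p)) \<noteq> side e (last (x # p))}"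
      if "\<And>e. e \<in> Diag \<Longrightarrow> side e x = side e y" "internal_edge_count (x # p) = internal_edge_count p"
    proof -
      have "{e \<in> Diag. side e (hd (x # p)) \<noteq> side e (last (x # p))} = {e \<in> Diag. side e y \<noteq> side e (last p)}"
        using that(1) p by auto
      then show ?thesis using that(2) IH by simp
    qed
    from E show ?thesis
    proof (cases rule: tree_edgeE)
      case (inner c d)
      define e0 where "e0 = (lft c, rgt c)"
      have e0: "e0 \<in> Diag" using lower_in_Diag[OF inner(1-3)] by (simp add: e0_def)
      have flip: "side e x \<noteq> side e y \<longleftrightarrow> e = e0" if "e \<in> Diag" for e
        using side_inner[OF that inner(1-3)] inner(4) by (auto simp: e0_def doubleton_eq_iff)
      have "side e0 (hd p) = side e0 (last p)"
      proof (rule walk_no_flip[OF walk, of x])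
        show "x \<notin> set p" using Cons.prems by simp
        fix x' y' assume "{x', y'} \<in> tree_edges n \<Delta>" "side e0 x' \<noteq> side e0 y'"
        then have "{x', y'} = {x, y}" using side_flip[OF inner(1-3)] inner(4) by (simp add: e0_def)
        then show "x \<in> {x', y'}" by auto
      qed (use p in simp)
      then have "e0 \<notin> {e \<in> Diag. side e y \<noteq> side e (last p)}" using p by simp
      moreover have "{e \<in> Diag. side e (hd (x # p)) \<noteq> side e (last (x # p))} = insert e0 {e \<in> Diag. side e y \<noteq> side e (last p)}"
      proof -
        have l: "hd (x # p) = x" "last (x # p) = last p" using p by simp_all
        have "side e0 y = side e0 (last p)" using \<open>side e0 (hd p) = side e0 (last p)\<close> p by simp
        then have "(side e x \<noteq> side e (last p)) \<longleftrightarrow> e = e0 \<or> side e y \<noteq> side e (last p)" if "e \<in> Diag" for e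
          using flip[OF that] by (cases "e = e0") simp_all
        then show ?thesis unfolding l using e0 by blast
      qed
      moreover have "internal_edge_count (x # p) = Suc (internal_edge_count p)"
        using inner(4) p by (auto simp: doubleton_eq_iff)
      ultimately show ?thesis using IH finite_Diag by simp
    next
      case (leaf c m)
      show ?thesis
        by (rule noflip) (use side_leaf[OF _ leaf(1-5)] leaf(6) p in \<open>auto simp: doubleton_eq_iff\<close>)
    next
      case (root c)
      show ?thesis
        by (rule noflip) (use side_root[OF _ root(1-4)] root(5) p in \<open>auto simp: doubleton_eq_iff\<close>)
    qed
  qed
qed simp

text \<open>Climbing from a triangle to the one above its base ends at the triangle of
  \<open>(2, Suc n)\<close>, and each leaf hangs on some triangle.\<close>

lemma tree_connected:
  assumes "1 \<le> a" "a \<le> n" "1 \<le> b" "b \<le> n"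
  shows "(Leaf a, Leaf b) \<in> {(x, y). {x, y} \<in> tree_edges n \<Delta>}\<^sup>*" (is "_ \<in> ?R\<^sup>*")
proof -
  have "Suc 2 < Suc n" using n_ge by simp
  then obtain r where r: "2 < r" "r < Suc n" "lft r = 2" "rgt r = Suc n" using apex_base[OF root_in_D] by auto
  have node: "(Node (tri c), Node (tri r)) \<in> ?R\<^sup>*" if "2 < c" "c < Suc n" for c
    using that
  proof (induction c rule: up_induct)
    case (up c)
    show ?case
    proof (cases "(lft c, rgt c) = (2, Suc n)")
      case True
      then have "c = r" using base_inj[of c r] up.hyps r by simp
      then show ?thesis by simp
    next
      case False
      \<comment> \<open>The apex of the triangle above the base of \<open>c\<close>, chosen by the
        alternatives of \<open>upper_ex\<close>.\<close>
      define d where "d = (if 2 < lft c \<and> rgt (lft c) = rgt c then lft c else rgt c)"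
      have u: "(2 < lft c \<and> rgt (lft c) = rgt c) \<or> (rgt c < Suc n \<and> lft (rgt c) = lft c)"
        using upper_ex[OF base(1)[OF up.hyps] False] .
      have d: "2 < d" "d < Suc n" "d = lft c \<or> d = rgt c" "{old (lft c), old (rgt c)} \<subseteq> tri d"
        using u base_bounds[OF up.hyps] up.hyps by (auto simp: d_def tri_def)
      have "tri c \<noteq> tri d"
        using tri_eq_iff[of c d] up.hyps d(1-3) base_bounds[OF up.hyps] by auto
      moreover have "arc (lft c, rgt c) \<in> \<Delta>" using base(1)[OF up.hyps] arc_image by blast
      moreover have "arc (lft c, rgt c) \<subseteq> tri c" "arc (lft c, rgt c) \<subseteq> tri d" using d by (auto simp: arc_def tri_def)
      moreover have "tri c \<in> triangles \<Delta>" "tri d \<in> triangles \<Delta>" using up.hyps d by (auto simp: triangles_eq)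
      ultimately have "{Node (tri c), Node (tri d)} \<in> tree_edges n \<Delta>" unfolding tree_edges_def by blast
      then have "(Node (tri c), Node (tri d)) \<in> ?R" by simp
      then show ?thesis using up.IH[OF d(1-3)] by (rule converse_rtrancl_into_rtrancl)
    qed
  qed
  have leaf: "\<exists>c. 2 < c \<and> c < Suc n \<and> {Node (tri c), Leaf m} \<in> tree_edges n \<Delta>" if m: "1 \<le> m" "m \<le> n" for m
  proof -
    obtain t where t: "t \<in> triangles \<Delta>" "m \<in> t" "cw_corner t m = cpred n m" using triangle_at[OF m] by blast
    then have "{cpred n m, csucc n (cpred n m)} \<subseteq> t" using triangle_corners(4)[OF t(1,2)] csucc_cpred(1)[OF m] by auto
    then have "{Node t, Leaf (csucc n (cpred n m))} \<in> tree_edges n \<Delta>"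
      using t(1) csucc_cpred(4)[OF m] unfolding tree_edges_def by blast
    then show ?thesis using trianglesE[OF t(1)] csucc_cpred(1)[OF m] by metis
  qed
  obtain c where c: "2 < c" "c < Suc n" "{Node (tri c), Leaf a} \<in> tree_edges n \<Delta>" using leaf assms by blast
  obtain d where d: "2 < d" "d < Suc n" "{Node (tri d), Leaf b} \<in> tree_edges n \<Delta>" using leaf assms by blast
  have sym: "sym ?R" by (auto simp: sym_def insert_commute)
  have "(Leaf a, Node (tri c)) \<in> ?R" using c(3) by (simp add: insert_commute)
  moreover have "(Node (tri r), Node (tri d)) \<in> ?R\<^sup>*" using node[OF d(1,2)] sym by (meson sym_rtrancl symD)
  moreover have "(Node (tri d), Leaf b) \<in> ?R" using d(3) by simp
  ultimately show ?thesis using node[OF c(1,2)]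
    by (meson converse_rtrancl_into_rtrancl rtrancl.rtrancl_into_rtrancl rtrancl_trans)
qed

lemma tree_weight_eq:
  assumes "2 \<le> i" "i \<le> Suc n" "2 \<le> j" "j \<le> Suc n"
  shows "tree_weight n \<Delta> (old i, old j) =
    - real (card {e \<in> Diag. (fst e < i \<and> i \<le> snd e) \<noteq> (fst e < j \<and> j \<le> snd e)})"
proof -
  have r: "1 \<le> old i" "old i \<le> n" "1 \<le> old j" "old j \<le> n" using old_range assms by auto
  obtain p where p: "tree_path n \<Delta> (Leaf (old i)) (Leaf (old j)) p"
    using simple_path_ex[OF tree_connected[OF r]] unfolding tree_path_def by blast
  have "(THE q. tree_path n \<Delta> (Leaf (old i)) (Leaf (old j)) q) = p"
  proof (rule the_equality)
    show "tree_path n \<Delta> (Leaf (old i)) (Leaf (old j)) p" by (rule p)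
    fix q assume "tree_path n \<Delta> (Leaf (old i)) (Leaf (old j)) q"
    then show "q = p"
      using p unfolding tree_path_def by (intro unique_simple_path[of "tree_edges n \<Delta>"] tree_bridge) auto
  qed
  moreover have "internal_edge_count p = card {e \<in> Diag. side e (Leaf (old i)) \<noteq> side e (Leaf (old j))}"
    using internal_edge_count_eq[of p] p by (simp add: tree_path_def)
  moreover have "{e \<in> Diag. side e (Leaf (old i)) \<noteq> side e (Leaf (old j))} =
      {e \<in> Diag. (fst e < i \<and> i \<le> snd e) \<noteq> (fst e < j \<and> j \<le> snd e)}"
    using side_Leaf assms by (auto simp: Diag_def)
  ultimately show ?thesis by (simp add: tree_weight_def)
qed

end

section \<open>Comparison of the two weights\<close>

context oriented_disk
begin

text \<open>Diagonals starting at or after \<open>v\<close> are counted in full, those passing over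
  \<open>v\<close> with the factor 1/2 from inclusion and exclusion. All diagonals are subtracted
  for v = 2, where no path starts although \<open>cnt 2 j\<close> would count every
  diagonal.\<close>

definition shift :: "nat \<Rightarrow> real" where
  "shift v = real (card {e \<in> Diag. v \<le> fst e}) + real (card {e \<in> Diag. fst e < v \<and> v \<le> snd e}) / 2
    - (if v = 2 then real (card Diag) else 0)"

lemma flow_min_eq:
  assumes ij: "2 \<le> i" "i < j" "j \<le> Suc n"
  shows "real (flow_min i j) =
    (1 / 2) * - real (card {e \<in> Diag. (fst e < i \<and> i \<le> snd e) \<noteq> (fst e < j \<and> j \<le> snd e)}) + shift i + shift j"
proof -
  define A where "A v = {e \<in> Diag. v \<le> fst e}" for v
  define B where "B v = {e \<in> Diag. fst e < v \<and> v \<le> snd e}" for v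
  define C where "C = {e \<in> Diag. fst e < i \<and> j \<le> snd e}"
  have fin: "finite (A v)" "finite (B v)" "finite C" for v using finite_Diag by (auto simp: A_def B_def C_def)
  have rng: "2 \<le> fst e" "snd e \<le> Suc n" "fst e < snd e" if "e \<in> Diag" for e
    using that D_range[of "fst e" "snd e"] by (auto simp: Diag_def)
  have "{e \<in> Diag. i \<le> fst e \<or> j \<le> snd e} = A i \<union> C" "A i \<inter> C = {}" by (auto simp: A_def C_def)
  then have cij: "cnt i j = card (A i) + card C" using fin by (simp add: cnt_def card_Un_disjoint)
  have "{e \<in> Diag. j \<le> fst e \<or> Suc (Suc n) \<le> snd e} = A j" using rng by (fastforce simp: A_def)
  then have cj: "cnt j (Suc (Suc n)) = card (A j)" by (simp add: cnt_def)
  have A2: "A 2 = Diag" using rng by (auto simp: A_def)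
  have C2: "C = {}" if "i = 2" using rng that by (fastforce simp: C_def)
  \<comment> \<open>For j = n + 1 the second summand of \<open>flow_min\<close> is set to 0, which
    is also what \<open>cnt\<close> would give; so no correction as for i = 2 arises.\<close>
  have AN: "A (Suc n) = {}" using rng by (fastforce simp: A_def)
  have min: "real (flow_min i j) = real (card (A i)) + real (card C) + real (card (A j)) - (if i = 2 then real (card Diag) else 0)"
    using cij cj A2 C2 AN by (auto simp: flow_min_def)
  let ?X = "{e \<in> Diag. (fst e < i \<and> i \<le> snd e) \<noteq> (fst e < j \<and> j \<le> snd e)}"
  have BC: "B i \<inter> B j = C" using ij by (auto simp: B_def C_def)
  have "B i \<union> B j = ?X \<union> C" "?X \<inter> C = {}" using ij by (auto simp: B_def C_def)
  then have "card (B i \<union> B j) = card ?X + card C" using finite_Diag fin by (simp add: card_Un_disjoint)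
  then have "card (B i) + card (B j) = card ?X + 2 * card C"
    using card_Un_Int[OF fin(2) fin(2), of i j] BC by simp
  then have X: "real (card (B i)) + real (card (B j)) = real (card ?X) + 2 * real (card C)" by linarith
  show ?thesis
    unfolding min shift_def A_def[symmetric] B_def[symmetric] using X ij by (auto simp: field_simps)
qed

lemma plabic_weight_tree_weight:
  assumes "(a, b) \<in> pairs n"
  shows "plabic_weight G ori (a, b) = (1 / 2) * tree_weight n \<Delta> (a, b)
    + shift (if a = 1 then Suc n else a) + shift (if b = 1 then Suc n else b)"
proof -
  have ab: "1 \<le> a" "a < b" "b \<le> n" using assms by (auto simp: pairs_def)
  show ?thesis
  proof (cases "a = 1")
    \<comment> \<open>The label 1 becomes \<open>n + 1\<close>, which reverses the pair; flows
      depend only on its set of entries, and separating two leaves is a symmetric condition.\<close>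
    case True
    have o: "old b = b" "old (Suc n) = 1" using ab True by (auto simp: old_def)
    have "plabic_weight G ori (a, b) = real (flow_min b (Suc n))"
      using plabic_weight_eq[of b "Suc n" a b] ab True o by (auto simp: insert_commute)
    moreover have "tree_weight n \<Delta> (a, b) =
        - real (card {e \<in> Diag. (fst e < Suc n \<and> Suc n \<le> snd e) \<noteq> (fst e < b \<and> b \<le> snd e)})"
      using tree_weight_eq[of "Suc n" b] ab True o by simp
    moreover have "{e \<in> Diag. (fst e < Suc n \<and> Suc n \<le> snd e) \<noteq> (fst e < b \<and> b \<le> snd e)} =
        {e \<in> Diag. (fst e < b \<and> b \<le> snd e) \<noteq> (fst e < Suc n \<and> Suc n \<le> snd e)}" by blast
    ultimately show ?thesis using flow_min_eq[of b "Suc n"] ab True by simp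
  next
    case False
    have o: "old a = a" "old b = b" using ab by (auto simp: old_def)
    have "plabic_weight G ori (a, b) = real (flow_min a b)"
      using plabic_weight_eq[of a b a b] ab False o by simp
    moreover have "tree_weight n \<Delta> (a, b) =
        - real (card {e \<in> Diag. (fst e < a \<and> a \<le> snd e) \<noteq> (fst e < b \<and> b \<le> snd e)})"
      using tree_weight_eq[of a b] ab False o by simp
    ultimately show ?thesis using flow_min_eq[of a b] ab False by simp
  qed
qed

end

theorem theorem4:
  fixes n :: nat
    and \<Delta> :: "nat set set"
    and ori :: "(vertex \<times> vertex) set"
  assumes "n \<ge> 4"
    and "triangulation n \<Delta>"
    and "perfect_orientation (plabic_graph n \<Delta>) ori"
    and "source_set (plabic_graph n \<Delta>) ori = {1, 2}"
  shows "initial_ideal n (plabic_weight (plabic_graph n \<Delta>) ori) (plucker_ideal n) =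
         initial_ideal n (tree_weight n \<Delta>) (plucker_ideal n)"
proof -
  interpret oriented_disk n \<Delta> ori
    by unfold_locales (use assms in auto)
  show ?thesis
    by (rule initial_ideal_eq[where s = "1 / 2" and c = "\<lambda>m. shift (if m = 1 then Suc n else m)"])
      (use plabic_weight_tree_weight in simp_all)
qed

end
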